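(* Let $\ell>0$ be an integer, and let $\alpha=(\alpha_1,\alpha_2)\in(0,\pi)^2$ be such that $\alpha_1+\alpha_2\ne\pi m/\ell$ and $\alpha_1-\alpha_2+\pi\ne\pi m/\ell$ for all integers $m$ with $0<m<\ell$ or $\ell<m<2\ell$. Then the Bénard--Conway invariant $h_{L_\ell}(\alpha)$ of the $(2,2\ell)$--torus link $L_\ell$ is well defined and is equal to the number of integers $m\in\{1,\dots,\ell-1\}$ such that $$\cos(\pi m/\ell)\in[\,\cos(\alpha_1+\alpha_2),\,\cos(\alpha_1-\alpha_2)\,].$$
   Context: **Torus link.** $L_\ell$ ($\ell>0$) is the right-handed oriented $(2,2\ell)$--torus link, viewed as an ordered two-component link; it is the closure of the braid $\sigma_1^{2\ell}\in B_2$ with coloring $c=(1,2)$, and its components have linking number $\ell$. **Alexander polynomial.** $\Delta_L(t_1,t_2)\in\mathbb Z[t_1^{\pm1},t_2^{\pm1}]$ is the usual two-variable Alexander polynomial of an ordered oriented link $L=L_1\cup L_2$, defined up to multiplication by $\pm t_1^at_2^b$. **Bénard--Conway invariant.** $\mathrm{SU}(2)$ is identified with the unit quaternions. The braid group $B_n$ has standard generators $\sigma_1,\dots,\sigma_{n-1}$; geometrically, in $\sigma_i$ the $(i+1)$-st strand crosses over the $i$-th, strands are oriented downward (so the closure of $\sigma_1^2\in B_2$ has linking number $+1$), and closures of braids are oriented accordingly. $B_n$ acts on the right on the free group on $x_1,\dots,x_n$ by $x_i\sigma_i = x_ix_{i+1}x_i^{-1}$, $x_{i+1}\sigma_i = x_i$,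 $x_j\sigma_i=x_j$ for $j\ne i,i+1$; hence each $\beta\in B_n$ induces a homeomorphism $(X_1,\dots,X_n)\mapsto(X_1\beta,\dots,X_n\beta)$ of $\mathrm{SU}(2)^n$ (e.g. $(X_1,X_2)\sigma_1=(X_1X_2X_1^{-1},X_1)$ for $n=2$). Represent a two-component ordered oriented link $L$ as the closure of a braid $\beta\in B_n$ whose strands are colored by $1$ or $2$ according to the component of $L$ they belong to; let $c=(c_1,\dots,c_n)\in\{1,2\}^n$ be the resulting coloring of the upper endpoints (equal to that of the lower endpoints). For $\alpha=(\alpha_1,\alpha_2)\in(0,\pi)^2$ set - $R_n^{\alpha,c}=\{(X_1,\dots,X_n)\in\mathrm{SU}(2)^n : \operatorname{tr}X_i=2\cos\alpha_{c_i}\text{ for all }i\}$; - $\Gamma_\beta^{\alpha,c}=\{(X_1,\dots,X_n,X_1\beta,\dots,X_n\beta)\}\subset R_n^{\alpha,c}\times R_n^{\alpha,c}$, the graph of $\beta$; - $\Lambda_n^{\alpha,c}=\{(X_1,\dots,X_n,X_1,\dots,X_n)\}\subset R_n^{\alpha,c}\times R_n^{\alpha,c}$, the diagonal; - $H_n^{\alpha,c}=\{(X_1,\dots,X_n,Y_1,\dots,Y_n)\in R_n^{\alpha,c}\times R_n^{\alpha,c}: X_1\cdots X_n=Y_1\cdots Y_n\}$, which contains both. Let $\widehat\Gamma_\beta^{\alpha,c},\widehat\Lambda_n^{\alpha,c},\widehat H_n^{\alpha,c}$ be the quotients, by the conjugation action of $\mathrm{SO}(3)=\mathrm{SU}(2)/\{\pm1\}$,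 of the subsets of irreducible tuples (those whose entries generate a non-abelian subgroup). They are smooth open manifolds of dimensions $2n-3$, $2n-3$, $4n-6$. Orientations: each conjugacy class $\{X\in \mathrm{SU}(2):\operatorname{tr}X=2\cos\theta\}=\{\cos\theta+\sin\theta\, Q\}$, $0<\theta<\pi$, is identified with the sphere $S^2$ of purely imaginary unit quaternions $Q$, with a fixed (arbitrary) orientation; $R_n^{\alpha,c}$ has the product orientation; $\Lambda_n^{\alpha,c}$ and $\Gamma_\beta^{\alpha,c}$ are oriented by the projection to the first $n$ factors; $H_n^{\alpha,c}=f_n^{-1}(1)$, with $f_n(X,Y)=X_1\cdots X_n(Y_1\cdots Y_n)^{-1}\in\mathrm{SU}(2)$, is oriented by the base-first, fiber-second rule using the orientation of $\mathrm{SU}(2)$ for which $(\mathbf i,\mathbf j,\mathbf k)$ is positive at $1$; quotients by $\mathrm{SO}(3)$ are oriented by the same base (quotient) first, fiber (orbit) second rule. The invariant $h_L(\alpha)$ is well defined if $\Delta_L(e^{2\mathbf{i}\epsilon_1\alpha_1},e^{2\mathbf{i}\epsilon_2\alpha_2})\ne0$ for all $\epsilon_1,\epsilon_2=\pm1$: then $\widehat\Lambda_n^{\alpha,c}\cap\widehat\Gamma_\beta^{\alpha,c}$ is compact, and $h_L(\alpha)=\langle\widehat\Lambda_n^{\alpha,c},\widehat\Gamma_\beta^{\alpha,c}\rangle_{\widehat H_n^{\alpha,c}}$ is the oriented intersection number ($\widehat\Lambda$ first, $\widehat\Gamma$ second) after a compactly supported perturbation of $\widehat\Gamma_\beta^{\alpha,c}$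 making the intersection transversal. It depends only on $L$ and $\alpha$. *)

theory Defs
  imports "HOL-Analysis.Analysis" "HOL-Library.Poly_Mapping" "Jordan_Normal_Form.Determinant"
begin

no_notation vec_index (infixl "$" 100)
no_notation scalar_prod (infix "\<bullet>" 70)

section \<open>Unit quaternions\<close>

text \<open>The pair \<open>(a, v)\<close> is the quaternion with real part \<open>a\<close> and imaginary part
  \<open>v\<^sub>1 i + v\<^sub>2 j + v\<^sub>3 k\<close>.\<close>

type_synonym quat = "real \<times> (real^3)"

definition qmul :: "quat \<Rightarrow> quat \<Rightarrow> quat" (infixl "\<star>" 70) where
  "x \<star> y = (fst x * fst y - snd x \<bullet> snd y,
            fst x *\<^sub>R snd y + fst y *\<^sub>R snd x + cross3 (snd x) (snd y))"

type_synonym 'n tuple = "quat^'n"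
type_synonym 'n tuple2 = "'n tuple \<times> 'n tuple"

definition qone :: quat where "qone = (1, 0)"

text \<open>On unit quaternions conjugation is inversion.\<close>

definition qcnj :: "quat \<Rightarrow> quat" where "qcnj x = (fst x, - snd x)"

definition SU2 :: "quat set" where "SU2 = sphere 0 1"

text \<open>The trace of the corresponding \<open>2 \<times> 2\<close> matrix.\<close>

definition qtrace :: "quat \<Rightarrow> real" where "qtrace x = 2 * fst x"

inductive_set generated :: "quat set \<Rightarrow> quat set" for S where
  one: "qone \<in> generated S"
| incl: "x \<in> S \<Longrightarrow> x \<in> generated S"
| inv: "x \<in> generated S \<Longrightarrow> qcnj x \<in> generated S"
| mult: "x \<in> generated S \<Longrightarrow> y \<in> generated S \<Longrightarrow> x \<star> y \<in> generated S"

definition irreducible_set :: "quat set \<Rightarrow> bool" where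
  "irreducible_set S \<longleftrightarrow> (\<exists>x\<in>generated S. \<exists>y\<in>generated S. x \<star> y \<noteq> y \<star> x)"


section \<open>Colored braids\<close>

text \<open>The strands of a braid are indexed by a finite linearly ordered type; they are numbered
  \<open>1, \<dots>, n\<close> from the left as in the usual notation. In the type \<^typ>\<open>2\<close> the two strands
  are \<open>0 < 1\<close>.\<close>

definition strands :: "'n::{finite,linorder} list" where
  "strands = sorted_list_of_set UNIV"

definition strand :: "nat \<Rightarrow> 'n::{finite,linorder}" where
  "strand k = strands ! (k - 1)"

text \<open>A letter \<open>(k, True)\<close> is \<open>\<sigma>\<^sub>k\<close> (with \<open>1 \<le> k < n\<close>), and \<open>(k, False)\<close> is its inverse.\<close>

type_synonym braid = "(nat \<times> bool) list"

text \<open>Colors are the elements \<open>1\<close> and \<open>2\<close> of the type \<^typ>\<open>2\<close>, the index type of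
  \<^typ>\<open>real^2\<close>.\<close>

type_synonym 'n colored_braid = "braid \<times> ('n \<Rightarrow> 2)"

definition torus_link :: "nat \<Rightarrow> 2 colored_braid" where
  "torus_link l = (replicate (2 * l) (1, True), \<lambda>j. if j = strand 1 then 1 else 2)"

text \<open>Elements of the free group on \<open>x\<^sub>j\<close> are represented by (not necessarily reduced) words;
  \<open>(j, True)\<close> is \<open>x\<^sub>j\<close> and \<open>(j, False)\<close> is its inverse.\<close>

type_synonym 'n word = "('n \<times> bool) list"

definition word_inv :: "'n word \<Rightarrow> 'n word" where
  "word_inv w = rev (map (\<lambda>(j, e). (j, \<not> e)) w)"

definition word_subst :: "('n \<Rightarrow> 'n word) \<Rightarrow> 'n word \<Rightarrow> 'n word" where
  "word_subst h w = concat (map (\<lambda>(j, e). if e then h j else word_inv (h j)) w)"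

fun sigma_act :: "nat \<times> bool \<Rightarrow> 'n::{finite,linorder} \<Rightarrow> 'n word" where
  "sigma_act (k, True) j =
     (if j = strand k then [(strand k, True), (strand (k + 1), True), (strand k, False)]
      else if j = strand (k + 1) then [(strand k, True)]
      else [(j, True)])"
| "sigma_act (k, False) j =
     (if j = strand k then [(strand (k + 1), True)]
      else if j = strand (k + 1)
        then [(strand (k + 1), False), (strand k, True), (strand (k + 1), True)]
      else [(j, True)])"

text \<open>\<open>x\<^sub>j\<beta>\<close>, for the right action: the first letter of the braid word acts first.\<close>

definition braid_act :: "braid \<Rightarrow> 'n::{finite,linorder} \<Rightarrow> 'n word" where
  "braid_act \<beta> j = fold (\<lambda>s. word_subst (sigma_act s)) \<beta> [(j, True)]"

primrec word_eval :: "'n::finite tuple \<Rightarrow> 'n word \<Rightarrow> quat" where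
  "word_eval X [] = qone"
| "word_eval X (s # w) = (if snd s then X $ fst s else qcnj (X $ fst s)) \<star> word_eval X w"

text \<open>\<open>(X\<^sub>1\<beta>, \<dots>, X\<^sub>n\<beta>)\<close>\<close>

definition braid_map :: "braid \<Rightarrow> 'n tuple \<Rightarrow> 'n::{finite,linorder} tuple" where
  "braid_map \<beta> X = (\<chi> j. word_eval X (braid_act \<beta> j))"


section \<open>The two-variable Alexander polynomial\<close>

text \<open>The Laurent polynomial ring in \<open>t\<^sub>1, t\<^sub>2\<close>, as the group ring of \<open>\<int>\<^sup>2\<close>.\<close>

type_synonym laurent = "(int^2) \<Rightarrow>\<^sub>0 int"

definition t_pow :: "2 \<Rightarrow> int \<Rightarrow> laurent" where
  "t_pow k m = Poly_Mapping.single (axis k m) 1"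

definition laurent_eval :: "complex^2 \<Rightarrow> laurent \<Rightarrow> complex" where
  "laurent_eval z p =
     (\<Sum>e\<in>Poly_Mapping.keys p. of_int (Poly_Mapping.lookup p e) * (\<Prod>k\<in>UNIV. (z $ k) powi (e $ k)))"

text \<open>The Fox derivative of a word with respect to \<open>x\<^sub>j\<close>, after abelianization \<open>x\<^sub>i \<mapsto> t\<^bsub>c i\<^esub>\<close>.\<close>

primrec fox :: "('n \<Rightarrow> 2) \<Rightarrow> 'n \<Rightarrow> 'n word \<Rightarrow> laurent" where
  "fox c j [] = 0"
| "fox c j (s # w) =
     (if snd s
      then (if fst s = j then 1 else 0) + t_pow (c (fst s)) 1 * fox c j w
      else t_pow (c (fst s)) (-1) * (fox c j w - (if fst s = j then 1 else 0)))"

text \<open>The link group of the closure of \<open>\<beta>\<close> is \<open>\<langle>x\<^sub>1, \<dots>, x\<^sub>n | x\<^sub>i\<beta> = x\<^sub>i\<rangle>\<close>, the \<open>x\<^sub>i\<close> being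
  meridians; its Alexander matrix consists of the Fox derivatives of the relators. The Alexander
  polynomial is the greatest common divisor of the \<open>(n-1) \<times> (n-1)\<close> minors, and so is defined up
  to units.\<close>

definition alexander_matrix :: "'n::{finite,linorder} colored_braid \<Rightarrow> laurent mat" where
  "alexander_matrix L = mat CARD('n) CARD('n)
     (\<lambda>(i, j). fox (snd L) (strand (j + 1))
                  (braid_act (fst L) (strand (i + 1)) @ [(strand (i + 1), False)]))"

definition is_gcd :: "'a::comm_ring_1 set \<Rightarrow> 'a \<Rightarrow> bool" where
  "is_gcd S d \<longleftrightarrow> (\<forall>s\<in>S. d dvd s) \<and> (\<forall>e. (\<forall>s\<in>S. e dvd s) \<longrightarrow> e dvd d)"

definition is_alexander_polynomial :: "'n::{finite,linorder} colored_braid \<Rightarrow> laurent \<Rightarrow> bool" where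
  "is_alexander_polynomial L \<Delta> \<longleftrightarrow>
     is_gcd {Determinant.det (mat_delete (alexander_matrix L) i j) | i j. i < CARD('n) \<and> j < CARD('n)} \<Delta>"


section \<open>The representation spaces\<close>

definition ordered_prod :: "'n::{finite,linorder} tuple \<Rightarrow> quat" where
  "ordered_prod X = foldr (\<lambda>j q. X $ j \<star> q) strands qone"

definition R_space :: "('n::finite \<Rightarrow> 2) \<Rightarrow> real^2 \<Rightarrow> 'n tuple set" where
  "R_space c \<alpha> = {X. \<forall>j. X $ j \<in> SU2 \<and> qtrace (X $ j) = 2 * cos (\<alpha> $ c j)}"

definition Irr :: "'n tuple2 set \<Rightarrow> 'n::finite tuple2 set" where
  "Irr M = {p \<in> M. irreducible_set (range (($) (fst p)) \<union> range (($) (snd p)))}"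

definition f_map :: "'n::{finite,linorder} tuple2 \<Rightarrow> quat" where
  "f_map p = ordered_prod (fst p) \<star> qcnj (ordered_prod (snd p))"

text \<open>Irreducible parts of \<open>\<Gamma>\<close>, \<open>\<Lambda>\<close> and \<open>H\<close>. Their quotients by conjugation are treated as
  sets of orbits.\<close>

definition Gamma_irr :: "'n::{finite,linorder} colored_braid \<Rightarrow> real^2 \<Rightarrow> 'n tuple2 set" where
  "Gamma_irr L \<alpha> = Irr {(X, braid_map (fst L) X) | X. X \<in> R_space (snd L) \<alpha>}"

definition Lambda_irr :: "'n::{finite,linorder} colored_braid \<Rightarrow> real^2 \<Rightarrow> 'n tuple2 set" where
  "Lambda_irr L \<alpha> = Irr {(X, X) | X. X \<in> R_space (snd L) \<alpha>}"

definition H_irr :: "'n::{finite,linorder} colored_braid \<Rightarrow> real^2 \<Rightarrow> 'n tuple2 set" where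
  "H_irr L \<alpha> = Irr {(X, Y) | X Y. X \<in> R_space (snd L) \<alpha> \<and> Y \<in> R_space (snd L) \<alpha> \<and>
                                   ordered_prod X = ordered_prod Y}"

definition conj_act :: "quat \<Rightarrow> 'n::finite tuple2 \<Rightarrow> 'n tuple2" where
  "conj_act g p = (\<chi> j. g \<star> (fst p $ j) \<star> qcnj g, \<chi> j. g \<star> (snd p $ j) \<star> qcnj g)"

definition orbit :: "'n::finite tuple2 \<Rightarrow> 'n tuple2 set" where
  "orbit p = {conj_act g p | g. g \<in> SU2}"


section \<open>Tangent vectors and smooth maps\<close>

definition curve_at :: "'a::real_normed_vector set \<Rightarrow> 'a \<Rightarrow> (real \<Rightarrow> 'a) \<Rightarrow> bool" where
  "curve_at M p \<gamma> \<longleftrightarrow> \<gamma> 0 = p \<and> (\<forall>\<^sub>F t in nhds 0. \<gamma> t \<in> M)"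

text \<open>For a submanifold this is the usual tangent space, the space of velocities of curves.\<close>

definition tangent_space :: "'a::real_normed_vector set \<Rightarrow> 'a \<Rightarrow> 'a set" where
  "tangent_space M p = {v. \<exists>\<gamma>. curve_at M p \<gamma> \<and> (\<gamma> has_vector_derivative v) (at 0)}"

text \<open>\<open>tangent_map M f p u v\<close> says that \<open>u\<close> is tangent to \<open>M\<close> at \<open>p\<close> and \<open>df\<^sub>p(u) = v\<close>.\<close>

definition tangent_map ::
    "'a::real_normed_vector set \<Rightarrow> ('a \<Rightarrow> 'b::real_normed_vector) \<Rightarrow> 'a \<Rightarrow> 'a \<Rightarrow> 'b \<Rightarrow> bool" where
  "tangent_map M f p u v \<longleftrightarrow>
     (\<exists>\<gamma>. curve_at M p \<gamma> \<and> (\<gamma> has_vector_derivative u) (at 0) \<and>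
          ((f \<circ> \<gamma>) has_vector_derivative v) (at 0))"

primrec Ck_on :: "nat \<Rightarrow> ('a::real_normed_vector \<Rightarrow> 'b::real_normed_vector) \<Rightarrow> 'a set \<Rightarrow> bool" where
  "Ck_on 0 f U \<longleftrightarrow> continuous_on U f"
| "Ck_on (Suc k) f U \<longleftrightarrow> f differentiable_on U \<and> (\<forall>v. Ck_on k (\<lambda>x. frechet_derivative f (at x) v) U)"

text \<open>A map on an arbitrary subset is smooth if it extends, locally, to smooth maps on open sets.\<close>

definition smooth_map_on :: "'a::real_normed_vector set \<Rightarrow> ('a \<Rightarrow> 'b::real_normed_vector) \<Rightarrow> bool" where
  "smooth_map_on S f \<longleftrightarrow>
     (\<forall>x\<in>S. \<exists>U F. open U \<and> x \<in> U \<and> (\<forall>k. Ck_on k F U) \<and> (\<forall>y\<in>U \<inter> S. F y = f y))"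


section \<open>Orientations\<close>

text \<open>An orientation of \<open>M\<close> is given by its positive bases: \<open>o p bs\<close> says that the list \<open>bs\<close> is a
  positively oriented basis of the tangent space at \<open>p\<close>.\<close>

type_synonym 'a orientation = "'a \<Rightarrow> 'a list \<Rightarrow> bool"

definition same_orientation :: "'a::real_vector list \<Rightarrow> 'a list \<Rightarrow> bool" where
  "same_orientation bs vs \<longleftrightarrow> length vs = length bs \<and>
     (\<exists>A\<in>carrier_mat (length bs) (length bs). Determinant.det A > 0 \<and>
        (\<forall>i<length bs. vs ! i = (\<Sum>j<length bs. (A $$ (i, j)) *\<^sub>R (bs ! j))))"

text \<open>The sphere of purely imaginary unit quaternions is oriented by its outward normal. As
  \<open>X\<^sub>j = cos \<theta> + sin \<theta> Q\<^sub>j\<close> with \<open>sin \<theta> > 0\<close>, the imaginary part of \<open>X\<^sub>j\<close> is a positive multiple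
  of \<open>Q\<^sub>j\<close>, and \<open>(0, a), (0, b)\<close> is a positive basis at \<open>X\<^sub>j\<close> iff \<open>a, b\<close> is one at \<open>Q\<^sub>j\<close>.\<close>

definition ori_R :: "'n::{finite,linorder} tuple orientation" where
  "ori_R X vs \<longleftrightarrow>
     (\<exists>a b. (\<forall>j. a j \<bullet> snd (X $ j) = 0 \<and> b j \<bullet> snd (X $ j) = 0 \<and>
                 snd (X $ j) \<bullet> cross3 (a j) (b j) > 0) \<and>
            same_orientation (concat (map (\<lambda>j. [axis j (0, a j), axis j (0, b j)]) strands)) vs)"

definition ori_RR :: "'n::{finite,linorder} tuple2 orientation" where
  "ori_RR p vs \<longleftrightarrow>
     (\<exists>es fs. ori_R (fst p) es \<and> ori_R (snd p) fs \<and>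
              same_orientation (map (\<lambda>e. (e, 0)) es @ map (\<lambda>f. (0, f)) fs) vs)"

text \<open>The orientation of a graph over \<open>R\<close>, by projection to the first \<open>n\<close> factors.\<close>

definition ori_graph :: "'n tuple2 set \<Rightarrow> 'n::{finite,linorder} tuple2 orientation" where
  "ori_graph M p vs \<longleftrightarrow> set vs \<subseteq> tangent_space M p \<and> ori_R (fst p) (map fst vs)"

text \<open>\<open>H = f\<^sup>-\<^sup>1(1)\<close>, base first and fiber second; the tangent space of \<open>SU(2)\<close> at \<open>1\<close> consists of
  the purely imaginary quaternions \<open>(0, d)\<close>.\<close>

definition ori_H :: "'n::{finite,linorder} colored_braid \<Rightarrow> real^2 \<Rightarrow> 'n tuple2 orientation" where
  "ori_H L \<alpha> p hs \<longleftrightarrow> set hs \<subseteq> tangent_space (H_irr L \<alpha>) p \<and>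
     (\<exists>u1 u2 u3 d1 d2 d3.
        tangent_map (R_space (snd L) \<alpha> \<times> R_space (snd L) \<alpha>) f_map p u1 (0, d1) \<and>
        tangent_map (R_space (snd L) \<alpha> \<times> R_space (snd L) \<alpha>) f_map p u2 (0, d2) \<and>
        tangent_map (R_space (snd L) \<alpha> \<times> R_space (snd L) \<alpha>) f_map p u3 (0, d3) \<and>
        d1 \<bullet> cross3 d2 d3 > 0 \<and> ori_RR p ([u1, u2, u3] @ hs))"

text \<open>The image of an oriented submanifold under an embedding.\<close>

definition ori_image :: "'a::real_normed_vector set \<Rightarrow> ('a \<Rightarrow> 'a) \<Rightarrow> 'a orientation \<Rightarrow> 'a orientation" where
  "ori_image M \<phi> ori q ws \<longleftrightarrow>
     (\<exists>p\<in>M. \<exists>vs. q = \<phi> p \<and> ori p vs \<and> list_all2 (tangent_map M \<phi> p) vs ws)"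

text \<open>Velocities at \<open>0\<close> of the curves \<open>t \<mapsto> exp(tq) \<cdot> p\<close> for \<open>q = i, j, k\<close>: a positive basis of
  the tangent space of the orbit of an irreducible \<open>p\<close>, for the orientation of \<open>SO(3)\<close> induced from
  \<open>SU(2)\<close>.\<close>

definition orbit_frame :: "'n::finite tuple2 \<Rightarrow> 'n tuple2 list" where
  "orbit_frame p = map (\<lambda>m. let q = (0, axis m 1) in
      (\<chi> j. q \<star> (fst p $ j) - (fst p $ j) \<star> q, \<chi> j. q \<star> (snd p $ j) - (snd p $ j) \<star> q)) [1, 2, 3]"

text \<open>The tangent space of the quotient of \<open>M\<close> at the orbit of \<open>p\<close> is the tangent space of \<open>M\<close>
  at \<open>p\<close> modulo that of the orbit. Tangent vectors of the quotient are represented by lifts: the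
  lifts \<open>vs\<close> represent a positive basis if together with a positive basis of the orbit, placed
  second, they form a positive basis of \<open>M\<close>.\<close>

definition ori_quotient :: "'n::finite tuple2 orientation \<Rightarrow> 'n tuple2 orientation" where
  "ori_quotient ori p vs \<longleftrightarrow> ori p (vs @ orbit_frame p)"


section \<open>Intersection numbers and the invariant\<close>

text \<open>Transversality of invariant submanifolds \<open>A\<close>, \<open>B\<close> of \<open>H\<close>. All three tangent spaces contain
  the tangent space of the orbit, so this is transversality of the quotients. The opposite inclusion
  always holds, as \<open>A\<close> and \<open>B\<close> are submanifolds of \<open>H\<close>.\<close>

definition transversal_in ::
    "'a::real_normed_vector set \<Rightarrow> 'a set \<Rightarrow> 'a set \<Rightarrow> bool" where
  "transversal_in H A B \<longleftrightarrow>
     (\<forall>p\<in>A \<inter> B. tangent_space H p \<subseteq> {v + w | v w. v \<in> tangent_space A p \<and> w \<in> tangent_space B p})"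

text \<open>The sign of an intersection point of the quotients, which is an orbit \<open>P\<close>, and the sum of
  these signs. The orientations are those of the quotients.\<close>

definition intersection_sign ::
    "'n tuple2 orientation \<Rightarrow> 'n tuple2 orientation \<Rightarrow> 'n tuple2 orientation \<Rightarrow> 'n tuple2 set \<Rightarrow> int" where
  "intersection_sign oriH oriA oriB P =
     (if \<exists>p\<in>P. \<exists>vs ws. oriA p vs \<and> oriB p ws \<and> oriH p (vs @ ws) then 1 else -1)"

definition signed_count ::
    "'n::finite tuple2 orientation \<Rightarrow> 'n tuple2 orientation \<Rightarrow> 'n tuple2 orientation \<Rightarrow>
     'n tuple2 set \<Rightarrow> 'n tuple2 set \<Rightarrow> int" where
  "signed_count oriH oriA oriB A B =
     (\<Sum>P\<in>orbit ` A \<inter> orbit ` B. intersection_sign oriH oriA oriB P)"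

text \<open>Compactly supported isotopies of the quotient of \<open>H\<close>, starting at the identity, correspond to
  equivariant isotopies of \<open>H\<close> with the same property.\<close>

definition equivariant_isotopy :: "'n tuple2 set \<Rightarrow> (real \<Rightarrow> 'n tuple2 \<Rightarrow> 'n::finite tuple2) \<Rightarrow> bool" where
  "equivariant_isotopy H \<Phi> \<longleftrightarrow>
     smooth_map_on ({0..1} \<times> H) (\<lambda>(t, p). \<Phi> t p) \<and>
     (\<forall>p\<in>H. \<Phi> 0 p = p) \<and>
     (\<forall>t\<in>{0..1}. bij_betw (\<Phi> t) H H \<and> smooth_map_on H (inv_into H (\<Phi> t)) \<and>
        (\<forall>g\<in>SU2. \<forall>p\<in>H. \<Phi> t (conj_act g p) = conj_act g (\<Phi> t p))) \<and>
     (\<exists>K\<subseteq>H. compact K \<and> (\<forall>t\<in>{0..1}. \<forall>p\<in>H - K. \<Phi> t p = p))"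

text \<open>The following two definitions concern \<open>\<Lambda>\<close> and the image \<open>\<phi>(\<Gamma>)\<close>.\<close>

definition generic_perturbation ::
    "'n::{finite,linorder} colored_braid \<Rightarrow> real^2 \<Rightarrow> ('n tuple2 \<Rightarrow> 'n tuple2) \<Rightarrow> bool" where
  "generic_perturbation L \<alpha> \<phi> \<longleftrightarrow>
     transversal_in (H_irr L \<alpha>) (Lambda_irr L \<alpha>) (\<phi> ` Gamma_irr L \<alpha>)"

definition perturbed_count ::
    "'n::{finite,linorder} colored_braid \<Rightarrow> real^2 \<Rightarrow> ('n tuple2 \<Rightarrow> 'n tuple2) \<Rightarrow> int" where
  "perturbed_count L \<alpha> \<phi> =
     signed_count (ori_quotient (ori_H L \<alpha>))
       (ori_quotient (ori_graph (Lambda_irr L \<alpha>)))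
       (ori_quotient (ori_image (Gamma_irr L \<alpha>) \<phi> (ori_graph (Gamma_irr L \<alpha>))))
       (Lambda_irr L \<alpha>) (\<phi> ` Gamma_irr L \<alpha>)"

text \<open>The invariant of the closure of a colored braid. The intersection number does not depend on
  the perturbation; the zero perturbation is used whenever it is admissible.\<close>

definition benard_conway :: "'n::{finite,linorder} colored_braid \<Rightarrow> real^2 \<Rightarrow> int" where
  "benard_conway L \<alpha> =
     (if generic_perturbation L \<alpha> id then perturbed_count L \<alpha> id
      else (SOME k. \<exists>\<Phi>. equivariant_isotopy (H_irr L \<alpha>) \<Phi> \<and>
                        generic_perturbation L \<alpha> (\<Phi> 1) \<and> k = perturbed_count L \<alpha> (\<Phi> 1)))"

text \<open>The criterion under which the invariant is defined, together with compactness of the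
  intersection of the quotients. The group acting is compact, so this is equivalent to compactness
  of the preimage of the intersection.\<close>

definition benard_conway_well_defined :: "'n::{finite,linorder} colored_braid \<Rightarrow> real^2 \<Rightarrow> bool" where
  "benard_conway_well_defined L \<alpha> \<longleftrightarrow>
     (\<exists>\<Delta>. is_alexander_polynomial L \<Delta> \<and>
        (\<forall>\<epsilon>::2 \<Rightarrow> real. (\<forall>k. \<epsilon> k \<in> {1, -1}) \<longrightarrow>
           laurent_eval (\<chi> k. exp (2 * \<i> * \<epsilon> k * (\<alpha> $ k))) \<Delta> \<noteq> 0)) \<and>
     compact (Lambda_irr L \<alpha> \<inter> Gamma_irr L \<alpha>)"

end

theory Submission
  imports Defs
begin

text \<open>The braid \<open>\<sigma>\<^sub>1\<^sup>2\<close> conjugates a pair \<open>X = (X\<^sub>1, X\<^sub>2)\<close> by the product \<open>P = X\<^sub>1 X\<^sub>2\<close>, which it preserves.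
Hence \<open>\<sigma>\<^sub>1\<^bsup>2l\<^esup>\<close> conjugates \<open>X\<close> by \<open>P\<^sup>l\<close>, and an irreducible pair is fixed iff \<open>P\<^sup>l = \<plusminus>1\<close>, that is, iff
the real part of \<open>P\<close> is \<open>cos (\<pi> m / l)\<close> with \<open>0 < m < l\<close>. Up to conjugation a pair is determined by
the real part of \<open>P\<close>, which for irreducible pairs takes exactly the values strictly between
\<open>cos (\<alpha>\<^sub>1 + \<alpha>\<^sub>2)\<close> and \<open>cos (\<alpha>\<^sub>1 - \<alpha>\<^sub>2)\<close>. The intersection of \<open>\<Lambda>\<close> and \<open>\<Gamma>\<close> is therefore a finite union of
orbits, one for each \<open>m\<close> with \<open>cos (\<pi> m / l)\<close> in this open interval (\<open>intersection_eq_orbits\<close>,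
\<open>inj_normal_orbits\<close>); in particular it is compact. The hypothesis on \<open>\<alpha>\<close> says that no
\<open>cos (\<pi> m / l)\<close> is an endpoint, so the interval may be closed. It remains to see that every orbit
is a transversal intersection point of the quotients, of sign \<open>+1\<close>.

Each orbit contains a normal form \<open>N(\<theta>)\<close>, \<open>\<theta> = \<pi> m / l\<close>, whose product is \<open>exp(\<theta> i)\<close>. Along the curve
\<open>\<theta> \<mapsto> N(\<theta>)\<close> the braid conjugates by \<open>exp(l \<theta> i)\<close>. With \<open>V\<close> the velocity of this curve and \<open>F\<close> the
velocity of \<open>N\<close> under conjugation by \<open>exp(t i)\<close>, the derivative of the braid map is the identity on the
tangent space of the orbit and takes \<open>V\<close> to \<open>V + l F\<close>. But \<open>F\<close> spans the kernel of the derivative of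
the product map (\<open>product_kernel\<close>), and the difference of the two components of a tangent vector of \<open>H\<close>
lies in this kernel; so it is a multiple of \<open>(V + l F) - V\<close>, which is transversality
(\<open>transversal_at_normal_point\<close>).
For the sign, \<open>(V, V)\<close> and \<open>(V, V + l F)\<close> represent the tangent lines of the two quotients, and both
have the same first component, so that the choice of the direction of \<open>V\<close> cancels. The
determinant that compares the bases is \<open>l\<close>, which is positive
(\<open>ori_RR_normal_point\<close>, \<open>intersection_sign_normal_point\<close>).

For the Alexander polynomial, Fox calculus gives the matrix \<open>S E\<close>, where
\<open>S = 1 + t\<^sub>1 t\<^sub>2 + \<dots> + (t\<^sub>1 t\<^sub>2)\<^bsup>l-1\<^esup>\<close> and the entries of \<open>E\<close> are, up to units, \<open>t\<^sub>1 - 1\<close> and \<open>t\<^sub>2 - 1\<close>. These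
are coprime, so \<open>S\<close> is the Alexander polynomial (\<open>is_alexander_polynomial_torus\<close>). It vanishes only where
\<open>t\<^sub>1 t\<^sub>2\<close> is an \<open>l\<close>-th root of unity other than \<open>1\<close>, and the hypothesis on \<open>\<alpha>\<close> says that this does
not happen at the four points in question.\<close>

section \<open>The two strands\<close>

text \<open>The strands are \<open>0\<close> and \<open>1\<close>, whereas colors and angles are indexed by \<open>1\<close> and \<open>2\<close>. In this type
the numeral \<open>2\<close> is \<open>0\<close>, so the first strand \<open>0\<close> has color \<open>1\<close>, and the second strand \<open>1\<close> has color
\<open>2 = 0\<close>.\<close>

lemma two_index_exhaust: "(j::2) = 0 \<or> j = 1"
  using exhaust_2[of j] by auto

lemma forall_two_index: "(\<forall>j::2. P j) \<longleftrightarrow> P 0 \<and> P 1"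
  by (metis two_index_exhaust)

lemma UNIV_two_index: "(UNIV :: 2 set) = {0, 1}"
  using two_index_exhaust by auto

lemma sum_two_index: "(\<Sum>j\<in>UNIV. f (j::2)) = f 0 + f 1"
  by (simp add: UNIV_two_index)

lemma strands_two: "strands = [0, 1 :: 2]"
proof -
  have "sorted_list_of_set (UNIV :: 2 set) = [0, 1]"
    unfolding UNIV_two_index by (simp add: less_eq_bit0_def bit0.Rep_0 bit0.Rep_1)
  then show ?thesis by (simp add: strands_def)
qed

lemma strand_two: "strand (Suc 0) = (0::2)" "strand (Suc (Suc 0)) = (1::2)" "strand 2 = (1::2)"
  by (simp_all add: strand_def strands_two)

lemma snd_torus_link: "snd (torus_link l) 0 = 1" "snd (torus_link l) 1 = 2"
  by (simp_all add: torus_link_def strand_two)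

section \<open>Fox calculus\<close>

text \<open>The image of a word in the group ring of the abelianization. It is the factor by which Fox
derivatives are twisted in a product.\<close>

definition word_monomial :: "('n \<Rightarrow> 2) \<Rightarrow> 'n word \<Rightarrow> laurent" where
  "word_monomial c w = prod_list (map (\<lambda>(j, e). t_pow (c j) (if e then 1 else -1)) w)"

lemma t_pow_add: "t_pow k m * t_pow k n = t_pow k (m + n)"
proof -
  have "axis k m + axis k n = axis k (m + n)"
    by (simp add: axis_def Finite_Cartesian_Product.vec_eq_iff)
  then show ?thesis by (simp add: t_pow_def mult_single)
qed

lemma axis_zero: "axis k 0 = (0 :: int^2)"
  by (simp add: axis_def Finite_Cartesian_Product.vec_eq_iff)

lemma t_pow_0 [simp]: "t_pow k 0 = 1"
  by (simp only: t_pow_def axis_zero single_one)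

lemma t_pow_inverse [simp]: "t_pow k 1 * t_pow k (-1) = 1" "t_pow k (-1) * t_pow k 1 = 1"
  "t_pow k 1 * (t_pow k (-1) * x) = x" "t_pow k (-1) * (t_pow k 1 * x) = x"
  by (simp_all add: t_pow_add flip: mult.assoc)

lemma word_monomial_simps [simp]:
  "word_monomial c [] = 1"
  "word_monomial c (s # w) = t_pow (c (fst s)) (if snd s then 1 else -1) * word_monomial c w"
  "word_monomial c (u @ v) = word_monomial c u * word_monomial c v"
  by (simp_all add: word_monomial_def split: prod.splits)

lemma fox_append: "fox c j (u @ v) = fox c j u + word_monomial c u * fox c j v"
  by (induction u) (auto simp: algebra_simps)

lemma word_inv_Cons: "word_inv (s # w) = word_inv w @ [(fst s, \<not> snd s)]"
  by (simp add: word_inv_def split: prod.splits)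

lemma word_monomial_word_inv: "word_monomial c w * word_monomial c (word_inv w) = 1"
proof (induction w)
  case (Cons s w)
  have "word_monomial c (s # w) * word_monomial c (word_inv (s # w)) =
    (word_monomial c w * word_monomial c (word_inv w)) *
    (t_pow (c (fst s)) (if snd s then 1 else -1) * t_pow (c (fst s)) (if snd s then -1 else 1))"
    by (simp add: word_inv_Cons mult.assoc mult.left_commute)
  then show ?case using Cons by simp
qed (simp add: word_inv_def)

lemma fox_word_inv: "fox c j (word_inv w) = - word_monomial c (word_inv w) * fox c j w"
proof -
  have "word_monomial c w * fox c j (word_inv w) = - fox c j w" for w
  proof (induction w)
    case (Cons s w)
    define t where "t = t_pow (c (fst s)) (if snd s then 1 else -1)"
    define B where "B = fox c j [(fst s, \<not> snd s)]"
    have 1: "fox c j (word_inv (s # w)) = fox c j (word_inv w) + word_monomial c (word_inv w) * B"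
      by (simp only: word_inv_Cons fox_append B_def)
    have 2: "word_monomial c (s # w) = t * word_monomial c w"
      by (simp add: t_def)
    have 3: "fox c j (s # w) = - (t * B) + t * fox c j w"
      by (cases "snd s") (simp_all add: t_def B_def right_diff_distrib)
    show ?case
    proof -
      have "t * word_monomial c w * (fox c j (word_inv w) + word_monomial c (word_inv w) * B) =
        t * (word_monomial c w * fox c j (word_inv w)) + (word_monomial c w * word_monomial c (word_inv w)) * (t * B)"
        by (simp add: distrib_left mult.assoc mult.left_commute)
      then show ?thesis
        unfolding 1 2 3 Cons word_monomial_word_inv by simp
    qed
  qed (simp add: word_inv_def)
  then have "word_monomial c (word_inv w) * (word_monomial c w * fox c j (word_inv w)) = - word_monomial c (word_inv w) * fox c j w"
    by simp
  moreover have "word_monomial c (word_inv w) * word_monomial c w = 1"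
    by (subst mult.commute) (rule word_monomial_word_inv)
  then have "word_monomial c (word_inv w) * (word_monomial c w * x) = x" for x
    by (simp flip: mult.assoc)
  ultimately show ?thesis by simp
qed

lemma word_subst_Cons: "word_subst h (s # w) =
    (if snd s then h (fst s) else word_inv (h (fst s))) @ word_subst h w"
  by (simp add: word_subst_def split: prod.splits)

lemma word_monomial_word_inv_eq:
  assumes "word_monomial c w = t_pow k 1"
  shows "word_monomial c (word_inv w) = t_pow k (-1)"
proof -
  have "t_pow k (-1) * (t_pow k 1 * word_monomial c (word_inv w)) = t_pow k (-1)"
    using word_monomial_word_inv[of c w] assms by simp
  then show ?thesis by simp
qed

text \<open>The chain rule of Fox calculus. As \<open>h\<close> respects the abelianization, the coefficients
\<open>fox c k w\<close> are not changed by the substitution.\<close>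

lemma fox_word_subst:
  fixes c :: "'n::finite \<Rightarrow> 2"
  assumes "\<And>k. word_monomial c (h k) = t_pow (c k) 1"
  shows "fox c j (word_subst h w) = (\<Sum>k\<in>UNIV. fox c k w * fox c j (h k))"
    and "word_monomial c (word_subst h w) = word_monomial c w"
proof -
  note inv = word_monomial_word_inv_eq[OF assms]
  have delta: "(\<Sum>k\<in>UNIV. (if m = k then 1 else 0) * fox c j (h k)) = fox c j (h m)" for m
    by (simp add: if_distrib[where f="\<lambda>x. x * _"] cong: if_cong)
  show "fox c j (word_subst h w) = (\<Sum>k\<in>UNIV. fox c k w * fox c j (h k))"
  proof (induction w)
    case (Cons s w)
    show ?case
    proof (cases "snd s")
      case True
      then show ?thesis
        by (simp add: word_subst_Cons fox_append assms Cons distrib_right sum.distrib delta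
            sum_distrib_left mult.assoc)
    next
      case False
      let ?t = "t_pow (c (fst s)) (-1)"
      have "(\<Sum>k\<in>UNIV. fox c k (s # w) * fox c j (h k)) =
        (\<Sum>k\<in>UNIV. ?t * (fox c k w * fox c j (h k)) - ?t * ((if fst s = k then 1 else 0) * fox c j (h k)))"
        using False by (intro sum.cong) (simp_all add: algebra_simps)
      also have "\<dots> = ?t * (\<Sum>k\<in>UNIV. fox c k w * fox c j (h k)) - ?t * fox c j (h (fst s))"
        by (simp only: sum_subtractf delta flip: sum_distrib_left)
      finally show ?thesis
        using False by (simp add: word_subst_Cons fox_append inv Cons fox_word_inv)
    qed
  qed (simp add: word_subst_def)
  show "word_monomial c (word_subst h w) = word_monomial c w"
    by (induction w) (simp_all add: word_subst_Cons assms inv, simp add: word_subst_def)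
qed

section \<open>The Alexander matrix of the torus link\<close>

lemma braid_act_Cons_outer:
  "braid_act (replicate (Suc n) s) j = word_subst (sigma_act s) (braid_act (replicate n s) j)"
proof -
  have "replicate (Suc n) s = replicate n s @ [s]"
    by (simp only: replicate_append_same replicate_Suc)
  then show ?thesis by (simp only: braid_act_def fold_append comp_apply fold_simps)
qed

abbreviation "T1 \<equiv> t_pow 1 1"
abbreviation "T2 \<equiv> t_pow 2 1"

text \<open>The Alexander polynomial of the torus link: the quotient of \<open>(t\<^sub>1 t\<^sub>2)\<^sup>l - 1\<close> by \<open>t\<^sub>1 t\<^sub>2 - 1\<close>.\<close>

definition geometric :: "nat \<Rightarrow> laurent" where
  "geometric l = (\<Sum>k<l. (T1 * T2) ^ k)"

text \<open>A single generator exchanges the colors of the strands, whereas its square is a pure braid. The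
Fox matrices of the powers of the square are therefore powers of one matrix.\<close>

definition full_twist :: "2 \<Rightarrow> 2 word" where
  "full_twist j = word_subst (sigma_act (1, True)) (word_subst (sigma_act (1, True)) [(j, True)])"

lemma two_index_simps [simp]: "(2::2) \<noteq> 1" "(0::2) \<noteq> 1" "(1::2) \<noteq> 0" "(1::2)\<noteq>2" "(2::2)=0"
  by simp_all

lemma word_subst_append: "word_subst h (u @ v) = word_subst h u @ word_subst h v"
  by (simp add: word_subst_def)

lemma word_subst_word_inv: "word_subst h (word_inv w) = word_inv (word_subst h w)"
proof -
  have inv_inv: "word_inv (word_inv u) = u" for u :: "'b word"
    by (simp add: word_inv_def rev_map comp_def split: prod.splits)
       (simp add: case_prod_unfold)
  have inv_app: "word_inv (u @ v) = word_inv v @ word_inv u" for u v :: "'b word"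
    by (simp add: word_inv_def)
  show ?thesis
    by (induction w) (auto simp: word_inv_Cons word_subst_append word_subst_Cons inv_app inv_inv,
      auto simp: word_inv_def word_subst_def)
qed

lemma word_subst_comp: "word_subst h (word_subst g w) = word_subst (\<lambda>j. word_subst h (g j)) w"
  by (induction w) (auto simp: word_subst_Cons word_subst_append word_subst_word_inv,
    simp add: word_subst_def)

lemma full_twist:
  "full_twist 0 = [(0, True), (1, True), (0, False), (0, True), (0, True), (1, False), (0, False)]"
  "full_twist 1 = [(0, True), (1, True), (0, False)]"
  by (simp_all add: full_twist_def word_subst_def word_inv_def strand_two)

lemma word_subst_single: "word_subst h [(j, True)] = h j"
  by (simp add: word_subst_def)

lemma braid_act_double:
  "braid_act (replicate (2 * Suc n) (1, True)) j =
     word_subst full_twist (braid_act (replicate (2 * n) (1, True)) j)"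
proof -
  have "2 * Suc n = Suc (Suc (2 * n))" by simp
  then show ?thesis
    unfolding full_twist_def
    by (simp only: braid_act_Cons_outer word_subst_comp word_subst_single)
qed

text \<open>The Fox matrix of the full twist minus the identity. This matrix \<open>E\<close> is singular and has
trace \<open>t\<^sub>1 t\<^sub>2 - 1\<close>, whence \<open>E\<^sup>2 = (t\<^sub>1 t\<^sub>2 - 1) E\<close>.\<close>

definition twist_entry :: "2 \<Rightarrow> 2 \<Rightarrow> laurent" where
  "twist_entry i j = (if i = 0 then (if j = 0 then T1 * (T2 - 1) else T1 * (1 - T1))
                 else (if j = 0 then 1 - T2 else T1 - 1))"

lemma fox_full_twist:
  "fox (snd (torus_link l)) j (full_twist i) = (if i = j then 1 else 0) + twist_entry i j"
proof -
  have c: "snd (torus_link l) 0 = 1" "snd (torus_link l) 1 = 0" using snd_torus_link[of l] by simp_all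
  have inv: "T1 * (x * t_pow 1 (- 1)) = x" for x
    using t_pow_inverse(3)[of 1 x] by (simp only: mult.commute)
  show ?thesis
    using two_index_exhaust[of i] two_index_exhaust[of j]
    by (auto simp: full_twist c inv twist_entry_def algebra_simps)
qed

lemma monomial_full_twist:
  "word_monomial (snd (torus_link l)) (full_twist i) = t_pow (snd (torus_link l) i) 1"
proof -
  have c: "snd (torus_link l) 0 = 1" "snd (torus_link l) 1 = 0" using snd_torus_link[of l] by simp_all
  have inv: "T1 * (x * t_pow 1 (- 1)) = x" for x
    using t_pow_inverse(3)[of 1 x] by (simp only: mult.commute)
  show ?thesis
    using two_index_exhaust[of i]
    by (auto simp: full_twist c inv mult.assoc mult.left_commute)
qed

text \<open>By the chain rule the Fox matrix of \<open>n\<close> full twists is \<open>(1 + E)\<^sup>n\<close>, and the relation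
\<open>E\<^sup>2 = (t\<^sub>1 t\<^sub>2 - 1) E\<close> turns the binomial expansion into \<open>1 + (1 + t\<^sub>1 t\<^sub>2 + \<dots> + (t\<^sub>1 t\<^sub>2)\<^bsup>n-1\<^esup>) E\<close>.\<close>

lemma fox_torus_braid:
  "fox (snd (torus_link l)) j (braid_act (replicate (2 * n) (1, True)) i) =
     (if i = j then 1 else 0) + geometric n * twist_entry i j"
  "word_monomial (snd (torus_link l)) (braid_act (replicate (2 * n) (1, True)) i) =
     t_pow (snd (torus_link l) i) 1"
proof (induction n arbitrary: j)
  case 0
  { case 1 then show ?case by (auto simp: braid_act_def geometric_def) next
    case 2 then show ?case by (auto simp: braid_act_def) }
next
  case (Suc n)
  note chain = fox_word_subst[where h=full_twist, OF monomial_full_twist]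
  { case 1
    have g: "geometric (Suc n) = 1 + T1 * T2 * geometric n"
      unfolding geometric_def by (subst sum.lessThan_Suc_shift) (simp add: sum_distrib_left)
    show ?case
      unfolding braid_act_double chain sum_two_index Suc fox_full_twist g
      using two_index_exhaust[of i] two_index_exhaust[of j]
      by (auto simp: twist_entry_def algebra_simps) next
    case 2 then show ?case unfolding braid_act_double chain Suc .. }
qed

lemma alexander_matrix_torus:
  assumes "i < 2" "j < 2"
  shows "alexander_matrix (torus_link l) $$ (i, j) =
    geometric l * twist_entry (strand (i + 1)) (strand (j + 1))"
proof -
  have "fox (snd (torus_link l)) (strand (j + 1)) (braid_act (fst (torus_link l)) (strand (i + 1)) @ [(strand (i + 1), False)])
    = geometric l * twist_entry (strand (i + 1)) (strand (j + 1))"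
  proof -
    have b: "fst (torus_link l) = replicate (2 * l) (1, True)"
      by (simp add: torus_link_def)
    show ?thesis
      unfolding b fox_append fox_torus_braid by simp
  qed
  then show ?thesis using assms by (simp add: alexander_matrix_def)
qed

lemma torus_minors:
  "{Determinant.det (mat_delete (alexander_matrix (torus_link l)) i j) | i j. i < CARD(2) \<and> j < CARD(2)}
   = {geometric l * twist_entry i j | i j. True}"
proof -
  have carr: "alexander_matrix (torus_link l) \<in> carrier_mat 2 2"
    by (simp add: alexander_matrix_def)
  have det: "Determinant.det (mat_delete (alexander_matrix (torus_link l)) i j) =
      geometric l * twist_entry (strand (1 - i + 1)) (strand (1 - j + 1))" if "i < 2" "j < 2" for i j
  proof -
    have "mat_delete (alexander_matrix (torus_link l)) i j \<in> carrier_mat 1 1"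
      using mat_delete_carrier[OF carr, of i j] by simp
    then have "Determinant.det (mat_delete (alexander_matrix (torus_link l)) i j) =
       mat_delete (alexander_matrix (torus_link l)) i j $$ (0, 0)"
      by (rule det_single)
    also have "\<dots> = alexander_matrix (torus_link l) $$ (1 - i, 1 - j)"
      using that carr unfolding mat_delete_def by (cases i; cases j; simp)
    also have "\<dots> = geometric l * twist_entry (strand (1 - i + 1)) (strand (1 - j + 1))"
      by (rule alexander_matrix_torus) auto
    finally show ?thesis .
  qed
  show ?thesis
  proof (intro equalityI subsetI)
    fix x assume "x \<in> {Determinant.det (mat_delete (alexander_matrix (torus_link l)) i j) | i j. i < CARD(2) \<and> j < CARD(2)}"
    then show "x \<in> {geometric l * twist_entry i j | i j. True}" using det by auto
  next
    fix x assume "x \<in> {geometric l * twist_entry i j | i j. True}"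
    then obtain i j where x: "x = geometric l * twist_entry i j" by auto
    have "\<exists>i'<2. i = strand (1 - i' + 1)" for i :: 2
      using two_index_exhaust[of i] strand_two by (metis add.commute diff_self_eq_0 diff_zero less_2_cases_iff plus_1_eq_Suc plus_nat.add_0 Suc_1 One_nat_def)
    then show "x \<in> {Determinant.det (mat_delete (alexander_matrix (torus_link l)) i j) | i j. i < CARD(2) \<and> j < CARD(2)}"
      using det x by simp metis
  qed
qed

section \<open>Divisibility of Laurent polynomials\<close>

abbreviation monomial :: "int^2 \<Rightarrow> laurent" where
  "monomial v \<equiv> Poly_Mapping.single v 1"

lemma lookup_monomial_mult: "Poly_Mapping.lookup (monomial v * f) e = Poly_Mapping.lookup f (e - v)"
  using subset_UNIV[of "Poly_Mapping.keys f"]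
proof (induction f rule: frag_induction)
  case (one u)
  have "v + u = e \<longleftrightarrow> u = e - v" by (auto simp: algebra_simps)
  then show ?case by (auto simp: mult_single lookup_single when_def)
qed (simp_all add: right_diff_distrib lookup_minus)

text \<open>The coefficients of \<open>f\<close> would be invariant under translation by \<open>v\<close>, which is impossible
for a nonempty finite support.\<close>

lemma monomial_minus_one_regular:
  assumes "v \<noteq> 0" and 0: "(monomial v - 1) * f = 0"
  shows "f = 0"
proof (rule poly_mapping_eqI)
  fix e
  have shift: "Poly_Mapping.lookup f (u - v) = Poly_Mapping.lookup f u" for u
  proof -
    have "Poly_Mapping.lookup (monomial v * f) u = Poly_Mapping.lookup f u"
      using 0 by (simp add: left_diff_distrib)
    then show ?thesis by (simp add: lookup_monomial_mult)
  qed
  have shifts: "Poly_Mapping.lookup f (e - (\<chi> k. int n * v $ k)) = Poly_Mapping.lookup f e" for n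
  proof (induction n)
    case 0
    have "e - (\<chi> k. int 0 * v $ k) = e" by (simp add: Finite_Cartesian_Product.vec_eq_iff)
    then show ?case by simp
  next
    case (Suc n)
    have eq: "e - (\<chi> k. int (Suc n) * v $ k) = e - (\<chi> k. int n * v $ k) - v"
      by (simp add: Finite_Cartesian_Product.vec_eq_iff algebra_simps)
    show ?case unfolding eq shift by (rule Suc)
  qed
  show "Poly_Mapping.lookup f e = Poly_Mapping.lookup 0 e"
  proof (rule ccontr)
    assume "Poly_Mapping.lookup f e \<noteq> Poly_Mapping.lookup 0 e"
    then have "range (\<lambda>n::nat. e - (\<chi> k. int n * v $ k)) \<subseteq> Poly_Mapping.keys f"
      using shifts by (auto simp: in_keys_iff)
    moreover obtain k where "v $ k \<noteq> 0"
      using assms by (auto simp: Finite_Cartesian_Product.vec_eq_iff)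
    then have "inj (\<lambda>n::nat. e - (\<chi> k. int n * v $ k))"
      by (auto simp: inj_def Finite_Cartesian_Product.vec_eq_iff)
    ultimately show False
      using finite_keys finite_subset range_inj_infinite by blast
  qed
qed

lemma t_pow_minus_one_regular:
  assumes "(t_pow k 1 - 1) * f = 0"
  shows "f = 0"
  using monomial_minus_one_regular[of "axis k 1" f] assms
  by (simp add: t_pow_def axis_eq_0_iff)

lemma t_pow_diff_one_dvd: "t_pow k 1 - 1 dvd t_pow k m - 1"
proof -
  have nat: "t_pow k 1 - 1 dvd t_pow k (int n) - 1" for n
  proof (induction n)
    case (Suc n)
    have "t_pow k (int (Suc n)) - 1 = t_pow k 1 * (t_pow k (int n) - 1) + (t_pow k 1 - 1)"
      by (simp add: algebra_simps t_pow_add)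
    then show ?case using Suc by (metis dvd_add dvd_mult dvd_refl)
  qed simp
  show ?thesis
  proof (cases "m \<ge> 0")
    case True
    then show ?thesis using nat[of "nat m"] by simp
  next
    case False
    have "t_pow k m - 1 = - t_pow k m * (t_pow k (- m) - 1)"
      by (simp add: algebra_simps t_pow_add)
    moreover have "t_pow k 1 - 1 dvd t_pow k (- m) - 1"
      using nat[of "nat (- m)"] False by simp
    ultimately show ?thesis by (metis dvd_mult)
  qed
qed

text \<open>Division with remainder; the remainder is a polynomial in \<open>t\<^sub>2\<close> alone, obtained by setting
\<open>t\<^sub>1 = 1\<close>.\<close>

lemma division_by_t1_minus_one:
  "\<exists>q r. a = (T1 - 1) * q + r \<and> (\<forall>e\<in>Poly_Mapping.keys r. e $ 1 = 0)"
  using subset_UNIV[of "Poly_Mapping.keys a"]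
proof (induction a rule: frag_induction)
  case zero
  show ?case by (rule exI[of _ 0], rule exI[of _ 0]) simp
next
  case (one e)
  obtain q where q: "t_pow 1 (e $ 1) - 1 = (T1 - 1) * q"
    using t_pow_diff_one_dvd by blast
  have e: "e = axis 1 (e $ 1) + axis 2 (e $ 2)"
    by (auto simp: Finite_Cartesian_Product.vec_eq_iff forall_two_index axis_def)
  have "frag_of e = t_pow 1 (e $ 1) * t_pow 2 (e $ 2)"
    by (subst e) (simp add: t_pow_def mult_single)
  also have "\<dots> = (T1 - 1) * (q * t_pow 2 (e $ 2)) + t_pow 2 (e $ 2)"
  proof -
    have "t_pow 1 (e $ 1) = (T1 - 1) * q + 1"
      unfolding q[symmetric] by simp
    then show ?thesis by (simp only: distrib_right mult_1_left mult.assoc)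
  qed
  finally show ?case
    by (intro exI conjI) (auto simp: t_pow_def axis_def)
next
  case (diff a b)
  then obtain q r q' r' where
    a: "a = (T1 - 1) * q + r" and b: "b = (T1 - 1) * q' + r'" and
    r: "\<forall>e\<in>Poly_Mapping.keys r. e $ 1 = 0" "\<forall>e\<in>Poly_Mapping.keys r'. e $ 1 = 0"
    by blast
  have "a - b = (T1 - 1) * (q - q') + (r - r')"
    unfolding a b by (simp add: algebra_simps)
  moreover have "\<forall>e\<in>Poly_Mapping.keys (r - r'). e $ 1 = 0"
    using r keys_diff[of r r'] by blast
  ultimately show ?case by blast
qed

text \<open>A multiple of \<open>t\<^sub>1 - 1\<close> that does not involve \<open>t\<^sub>1\<close> is zero: the coefficients of \<open>g\<close> would be constant
along rays in the direction of \<open>t\<^sub>1\<close>.\<close>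

lemma t1_minus_one_multiple_constant:
  assumes "\<And>e. e \<in> Poly_Mapping.keys ((T1 - 1) * g) \<Longrightarrow> e $ 1 = 0"
  shows "g = 0"
proof (rule ccontr)
  assume "g \<noteq> 0"
  then obtain e where e: "e \<in> Poly_Mapping.keys g" by (metis all_not_in_conv keys_eq_empty)
  have step: "Poly_Mapping.lookup g (u - axis 1 1) = Poly_Mapping.lookup g u" if "u $ 1 \<noteq> 0" for u
  proof -
    have "Poly_Mapping.lookup ((T1 - 1) * g) u = 0"
      using assms that by (meson in_keys_iff)
    then show ?thesis
      by (simp add: left_diff_distrib lookup_minus t_pow_def lookup_monomial_mult)
  qed
  \<comment> \<open>A ray that starts at \<open>e\<close> and points away from the hyperplane of exponents with first coordinate
     zero stays where \<open>step\<close> applies.\<close>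
  have ray: "\<exists>s::int. s \<noteq> 0 \<and> (\<forall>n::nat. Poly_Mapping.lookup g (e + axis 1 (s * int n)) = Poly_Mapping.lookup g e)"
  proof (cases "e $ 1 \<ge> 0")
    case True
    have "Poly_Mapping.lookup g (e + axis 1 (1 * int n)) = Poly_Mapping.lookup g e" for n
    proof (induction n)
      case (Suc n)
      have eq: "e + axis 1 (1 * int n) = e + axis 1 (1 * int (Suc n)) - axis 1 1"
        by (simp add: Finite_Cartesian_Product.vec_eq_iff axis_def)
      have "(e + axis 1 (1 * int (Suc n))) $ 1 \<noteq> 0"
        using True by (simp add: axis_def)
      from step[OF this] Suc show ?case unfolding eq by (simp only:)
    qed (simp add: axis_zero)
    then show ?thesis by (intro exI[of _ 1]) simp
  next
    case False
    have "Poly_Mapping.lookup g (e + axis 1 (- 1 * int n)) = Poly_Mapping.lookup g e" for n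
    proof (induction n)
      case (Suc n)
      have eq: "e + axis 1 (- 1 * int (Suc n)) = e + axis 1 (- 1 * int n) - axis 1 1"
        by (simp add: Finite_Cartesian_Product.vec_eq_iff axis_def)
      have "(e + axis 1 (- 1 * int n)) $ 1 \<noteq> 0"
        using False by (simp add: axis_def)
      from step[OF this] Suc show ?case unfolding eq by (simp only:)
    qed (simp add: axis_zero)
    then show ?thesis by (intro exI[of _ "-1"]) simp
  qed
  then obtain s :: int where s: "s \<noteq> 0"
    and eqs: "\<And>n::nat. Poly_Mapping.lookup g (e + axis 1 (s * int n)) = Poly_Mapping.lookup g e"
    by blast
  have keys: "range (\<lambda>n::nat. e + axis 1 (s * int n)) \<subseteq> Poly_Mapping.keys g"
    using e eqs by (auto simp: in_keys_iff)
  have "inj (\<lambda>n::nat. e + axis 1 (s * int n))"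
    using s by (auto simp: inj_def axis_eq_axis)
  then show False
    using keys finite_keys finite_subset range_inj_infinite by blast
qed

text \<open>Setting \<open>t\<^sub>1 = 1\<close> shows that the remainder of \<open>a\<close> is annihilated by \<open>t\<^sub>2 - 1\<close>.\<close>

lemma t_pow_minus_ones_coprime:
  assumes "a * (T2 - 1) = b * (T1 - 1)"
  shows "T1 - 1 dvd a"
proof -
  obtain q r where a: "a = (T1 - 1) * q + r" and r: "\<And>e. e \<in> Poly_Mapping.keys r \<Longrightarrow> e $ 1 = 0"
    using division_by_t1_minus_one[of a] by blast
  have eq: "(T1 - 1) * (b - q * (T2 - 1)) = (T2 - 1) * r"
    using assms unfolding a by (simp add: algebra_simps)
  have "e $ 1 = 0" if "e \<in> Poly_Mapping.keys ((T2 - 1) * r)" for e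
  proof -
    have "e \<in> Poly_Mapping.keys r \<or> e - axis 2 1 \<in> Poly_Mapping.keys r"
      using that by (auto simp: left_diff_distrib in_keys_iff lookup_minus t_pow_def lookup_monomial_mult)
    then show ?thesis using r by (force simp: axis_def)
  qed
  then have "b - q * (T2 - 1) = 0"
    by (intro t1_minus_one_multiple_constant) (simp only: eq)
  then have "r = 0"
    using eq t_pow_minus_one_regular by simp
  then show ?thesis using a by simp
qed

section \<open>The Alexander polynomial\<close>

lemma geometric_times: "(T1 * T2 - 1) * geometric l = (T1 * T2) ^ l - 1"
  unfolding geometric_def by (simp add: power_diff_1_eq)

lemma T_power: "(T1 * T2) ^ l = monomial (\<chi> k. int l)"
proof (induction l)
  case 0
  have "(\<chi> k. int 0) = (0 :: int^2)" by (simp add: Finite_Cartesian_Product.vec_eq_iff)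
  then show ?case by simp
next
  case (Suc l)
  have "axis 1 1 + (axis 2 1 + (\<chi> k. int l)) = ((\<chi> k. int (Suc l)) :: int^2)"
    by (simp add: Finite_Cartesian_Product.vec_eq_iff forall_two_index axis_def)
  then show ?case using Suc by (simp add: t_pow_def mult_single add.assoc)
qed

text \<open>A factor of \<open>(t\<^sub>1 t\<^sub>2)\<^sup>l - 1\<close> inherits cancellation from it.\<close>

lemma geometric_regular:
  assumes "l > 0" "geometric l * f = 0"
  shows "f = 0"
proof (rule monomial_minus_one_regular)
  show "(\<chi> k. int l) \<noteq> (0 :: int^2)" using assms by (simp add: Finite_Cartesian_Product.vec_eq_iff)
  have "((T1 * T2) ^ l - 1) * f = 0"
    unfolding geometric_times[symmetric] using assms by (simp add: mult.assoc)
  then show "(monomial (\<chi> k. int l) - 1) * f = 0" by (simp only: T_power)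
qed

text \<open>The minors are the entries of \<open>S E\<close>. The second row alone, with entries \<open>(1 - t\<^sub>2) S\<close> and
\<open>(t\<^sub>1 - 1) S\<close>, forces a common divisor to divide \<open>S\<close>.\<close>

lemma is_alexander_polynomial_torus:
  assumes "l > 0"
  shows "is_alexander_polynomial (torus_link l) (geometric l)"
  unfolding is_alexander_polynomial_def torus_minors is_gcd_def
proof (intro conjI allI impI)
  show "\<forall>s\<in>{geometric l * twist_entry i j |i j. True}. geometric l dvd s" by auto
next
  fix e assume "\<forall>s\<in>{geometric l * twist_entry i j |i j. True}. e dvd s"
  then have dvd: "e dvd geometric l * twist_entry i j" for i j by blast
  obtain a where a: "geometric l * (T1 - 1) = e * a"
    using dvd[of 1 1] by (auto simp: twist_entry_def)
  obtain b where "geometric l * (1 - T2) = e * b"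
    using dvd[of 1 0] by (auto simp: twist_entry_def)
  moreover have "geometric l * (T2 - 1) = - (geometric l * (1 - T2))"
    by (simp add: right_diff_distrib)
  ultimately have b: "geometric l * (T2 - 1) = e * (- b)"
    by simp
  have "geometric l * ((T1 - 1) * (a * (T2 - 1) - (- b) * (T1 - 1))) = 0"
  proof -
    have "geometric l * ((T1 - 1) * (a * (T2 - 1) - (- b) * (T1 - 1))) =
       (T1 - 1) * a * (geometric l * (T2 - 1)) - (T1 - 1) * (- b) * (geometric l * (T1 - 1))"
      by (simp add: algebra_simps)
    also have "\<dots> = (T1 - 1) * a * (e * (- b)) - (T1 - 1) * (- b) * (e * a)"
      by (simp only: a b)
    finally show ?thesis by (simp add: algebra_simps)
  qed
  then have "a * (T2 - 1) = (- b) * (T1 - 1)"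
    using geometric_regular[OF assms] t_pow_minus_one_regular by (metis eq_iff_diff_eq_0)
  then obtain a' where a': "a = (T1 - 1) * a'"
    using t_pow_minus_ones_coprime by blast
  have "(T1 - 1) * (geometric l - e * a') = 0"
    using a unfolding a' by (simp add: algebra_simps)
  then have "geometric l = e * a'"
    using t_pow_minus_one_regular by (metis eq_iff_diff_eq_0)
  then show "e dvd geometric l" by simp
qed

section \<open>Values of the Alexander polynomial\<close>

lemma laurent_eval_geometric:
  assumes "z $ 1 \<noteq> 0" "z $ 2 \<noteq> 0"
  shows "laurent_eval z (geometric l) = (\<Sum>k<l. (z $ 1 * z $ 2) ^ k)"
proof -
  have inj: "inj_on (\<lambda>n. (\<chi> k. int n) :: int^2) {..<l}"
    by (simp add: inj_on_def Finite_Cartesian_Product.vec_eq_iff)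
  have g: "geometric l = (\<Sum>n<l. monomial (\<chi> k. int n))"
    unfolding geometric_def T_power by (rule refl)
  have lookup: "Poly_Mapping.lookup (geometric l) e = (if e \<in> (\<lambda>n. \<chi> k. int n) ` {..<l} then 1 else 0)" for e
  proof -
    have "Poly_Mapping.lookup (geometric l) e = (\<Sum>n<l. if e = (\<chi> k. int n) then 1 else 0)"
      unfolding g lookup_sum by (intro sum.cong) (auto simp: lookup_single when_def)
    also have "\<dots> = (\<Sum>v\<in>(\<lambda>n. \<chi> k. int n) ` {..<l}. if e = v then 1 else 0)"
      by (simp add: sum.reindex[OF inj])
    finally show ?thesis by simp
  qed
  then have keys: "Poly_Mapping.keys (geometric l) = (\<lambda>n. \<chi> k. int n) ` {..<l}"
    by (auto simp: in_keys_iff split: if_splits)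
  show ?thesis
    unfolding laurent_eval_def keys sum.reindex[OF inj]
    by (intro sum.cong) (auto simp: lookup UNIV_two_index power_mult_distrib)
qed

lemma geometric_sum_nonzero:
  fixes w :: complex
  assumes "l > 0" "w ^ l = 1 \<Longrightarrow> w = 1"
  shows "(\<Sum>k<l. w ^ k) \<noteq> 0"
proof (cases "w = 1")
  case False
  then have "w ^ l \<noteq> 1" using assms by blast
  then show ?thesis using False by (simp add: geometric_sum)
qed (use assms in auto)

lemma exp_2i_root_of_unity:
  assumes "l > 0" "exp (2 * \<i> * complex_of_real x) ^ l = 1"
  shows "\<exists>m::int. x = pi * m / l"
proof -
  have "exp (of_nat l * (2 * \<i> * complex_of_real x)) = 1"
    using assms by (simp add: exp_of_nat_mult)
  then obtain n :: int where "Im (of_nat l * (2 * \<i> * complex_of_real x)) = of_int (2 * n) * pi"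
    using exp_eq_1 by blast
  then have "l * x = n * pi" by simp
  then show ?thesis using assms by (intro exI[of _ n]) (simp add: field_simps)
qed

lemma exp_2i_eq_1:
  "exp (2 * \<i> * complex_of_real (pi * of_int n)) = 1"
  unfolding exp_eq_1 by (intro conjI exI[of _ n]) auto

lemma exp_2i_neg: "exp (2 * \<i> * complex_of_real (- x)) ^ l = 1 \<longleftrightarrow> exp (2 * \<i> * complex_of_real x) ^ l = 1"
  by (simp add: exp_minus power_inverse)

text \<open>At the point given by \<open>\<epsilon>\<close> the product of the two coordinates is \<open>exp(2i x)\<close> with
\<open>x = \<plusminus>\<alpha>\<^sub>1 \<plusminus> \<alpha>\<^sub>2\<close>, so \<open>S\<close> vanishes iff \<open>l x\<close> is a multiple of \<open>\<pi>\<close> but \<open>x\<close> is not. The multiples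
that the hypothesis omits, \<open>m = l\<close> for the sum and for the shifted difference, are those with
\<open>x \<in> {0, \<pi>, -\<pi>}\<close>.\<close>

lemma torus_alexander_nonzero:
  fixes \<alpha> :: "real^2"
  assumes "l > 0" "0 < \<alpha> $ 1" "\<alpha> $ 1 < pi" "0 < \<alpha> $ 2" "\<alpha> $ 2 < pi"
    and generic: "\<And>m::int. (0 < m \<and> m < int l) \<or> (int l < m \<and> m < 2 * int l) \<Longrightarrow>
           \<alpha> $ 1 + \<alpha> $ 2 \<noteq> pi * m / l \<and> \<alpha> $ 1 - \<alpha> $ 2 + pi \<noteq> pi * m / l"
    and \<epsilon>: "\<And>k. \<epsilon> k \<in> {1, -1::real}"
  shows "laurent_eval (\<chi> k. exp (2 * \<i> * \<epsilon> k * (\<alpha> $ k))) (geometric l) \<noteq> 0"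
proof -
  define x where "x = \<epsilon> 1 * \<alpha> $ 1 + \<epsilon> 2 * \<alpha> $ 2"
  define w where "w = (\<lambda>x::real. exp (2 * \<i> * complex_of_real x))"
  have sum: "w x = 1" if h: "w x ^ l = 1" "x = \<alpha> $ 1 + \<alpha> $ 2" for x
  proof -
    obtain m :: int where m: "x = pi * m / l"
      using exp_2i_root_of_unity[OF assms(1)] h unfolding w_def by blast
    have "0 < pi * m / l" "pi * m / l < 2 * pi"
      using assms h m by linarith+
    then have "0 < m" "real_of_int m < 2 * real l"
      using assms(1) by (auto simp: zero_less_divide_iff zero_less_mult_iff field_simps)
    then have "0 < m" "m < 2 * int l" by linarith+
    then have "m = int l" using generic[of m] m h by force
    then have "x = pi * of_int 1" using m assms(1) by simp
    then show ?thesis using exp_2i_eq_1 unfolding w_def by blast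
  qed
  have diff: "w x = 1" if h: "w x ^ l = 1" "x = \<alpha> $ 1 - \<alpha> $ 2" for x
  proof -
    obtain m :: int where m: "x = pi * m / l"
      using exp_2i_root_of_unity[OF assms(1)] h unfolding w_def by blast
    have "- pi < pi * m / l" "pi * m / l < pi"
      using assms h m by linarith+
    then have "pi * (- real l) < pi * real_of_int m" "pi * real_of_int m < pi * real l"
      using assms(1) by (simp_all add: field_simps)
    then have "- real l < real_of_int m" "real_of_int m < real l"
      by (simp_all only: mult_less_cancel_left_pos[OF pi_gt_zero])
    then have "0 < m + int l" "m + int l < 2 * int l" by linarith+
    moreover have "\<alpha> $ 1 - \<alpha> $ 2 + pi = pi * (m + int l) / l"
      using m h assms(1) by (simp add: field_simps)
    ultimately have "m + int l = int l" using generic[of "m + int l"] by force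
    then have "x = pi * of_int 0" using m assms(1) by simp
    then show ?thesis using exp_2i_eq_1 unfolding w_def by blast
  qed
  have "w x = 1" if h: "w x ^ l = 1"
  proof -
    have neg: "w (- y) ^ n = 1 \<longleftrightarrow> w y ^ n = 1" for y n
      unfolding w_def by (rule exp_2i_neg)
    have "x = \<alpha> $ 1 + \<alpha> $ 2 \<or> x = - (\<alpha> $ 1 + \<alpha> $ 2) \<or> x = \<alpha> $ 1 - \<alpha> $ 2 \<or> x = - (\<alpha> $ 1 - \<alpha> $ 2)"
      using \<epsilon>[of 1] \<epsilon>[of 2] unfolding x_def by auto
    then show ?thesis
      using h sum diff neg[where n=1] neg[where n=l] by (metis power_one_right)
  qed
  then have "(\<Sum>k<l. w x ^ k) \<noteq> 0"
    by (rule geometric_sum_nonzero[OF assms(1)])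
  moreover have "laurent_eval (\<chi> k. exp (2 * \<i> * \<epsilon> k * (\<alpha> $ k))) (geometric l) = (\<Sum>k<l. w x ^ k)"
  proof -
    have "exp (2 * \<i> * \<epsilon> 1 * (\<alpha> $ 1)) * exp (2 * \<i> * \<epsilon> 2 * (\<alpha> $ 2)) = w x"
      unfolding w_def x_def by (simp add: algebra_simps flip: exp_add)
    then show ?thesis
      by (subst laurent_eval_geometric) auto
  qed
  ultimately show ?thesis by simp
qed

section \<open>Quaternions\<close>

unbundle cross3_syntax

lemma qmul_assoc: "(x \<star> y) \<star> z = x \<star> (y \<star> z)"
  by (simp add: qmul_def prod_eq_iff Finite_Cartesian_Product.vec_eq_iff forall_3 cross_components inner_vec_def sum_3 algebra_simps)

lemma qmul_add_left: "(x + y) \<star> z = x \<star> z + y \<star> z"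
  and qmul_add_right: "z \<star> (x + y) = z \<star> x + z \<star> y"
  by (simp_all add: qmul_def prod_eq_iff Finite_Cartesian_Product.vec_eq_iff forall_3 cross_components inner_vec_def sum_3 algebra_simps)

lemma qmul_scale_left: "(r *\<^sub>R x) \<star> z = r *\<^sub>R (x \<star> z)"
  and qmul_scale_right: "z \<star> (r *\<^sub>R x) = r *\<^sub>R (z \<star> x)"
  by (simp_all add: qmul_def prod_eq_iff Finite_Cartesian_Product.vec_eq_iff forall_3 cross_components inner_vec_def sum_3 algebra_simps)

lemma norm_quat: "(norm x)\<^sup>2 = (fst x)\<^sup>2 + snd x \<bullet> snd (x::quat)"
  by (simp add: norm_prod_def dot_square_norm)

lemma norm_qmul: "norm (x \<star> y) = norm x * norm y"
proof -
  have "(norm (x \<star> y))\<^sup>2 = (norm x * norm y)\<^sup>2"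
    unfolding power_mult_distrib norm_quat
    by (simp add: qmul_def cross_components inner_vec_def sum_3 power2_eq_square algebra_simps)
  then show ?thesis by (simp add: power2_eq_iff_nonneg)
qed

text \<open>Multiplication is bilinear and bounded, which gives the product rule for derivatives.\<close>

interpretation qmul: bounded_bilinear qmul
  by standard (auto simp: qmul_add_left qmul_add_right qmul_scale_left qmul_scale_right norm_qmul
      intro!: exI[of _ 1])

lemma qone_mult [simp]: "qone \<star> x = x" "x \<star> qone = x"
  by (simp_all add: qmul_def qone_def)

lemma qcnj_qmul: "qcnj (x \<star> y) = qcnj y \<star> qcnj x"
  by (simp add: qmul_def qcnj_def prod_eq_iff Finite_Cartesian_Product.vec_eq_iff forall_3 cross_components inner_vec_def sum_3 algebra_simps)

lemma qcnj_qcnj [simp]: "qcnj (qcnj x) = x" and qcnj_qone [simp]: "qcnj qone = qone"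
  by (simp_all add: qcnj_def qone_def)

lemma norm_qcnj [simp]: "norm (qcnj x) = norm x"
  by (simp add: qcnj_def norm_prod_def)

lemma qcnj_add: "qcnj (x + y) = qcnj x + qcnj y" and qcnj_scale: "qcnj (r *\<^sub>R x) = r *\<^sub>R qcnj x"
  by (simp_all add: qcnj_def)

lemma bounded_linear_qcnj: "bounded_linear qcnj"
  by standard (auto simp: qcnj_add qcnj_scale intro!: exI[of _ 1])

lemma qmul_qcnj: "x \<star> qcnj x = ((norm x)\<^sup>2, 0)" "qcnj x \<star> x = ((norm x)\<^sup>2, 0)"
  unfolding norm_quat by (simp_all add: qmul_def qcnj_def power2_eq_square)

lemma SU2_iff: "x \<in> SU2 \<longleftrightarrow> norm x = 1"
  by (simp add: SU2_def)

lemma SU2_inverse [simp]: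
  assumes "x \<in> SU2"
  shows "x \<star> qcnj x = qone" "qcnj x \<star> x = qone"
    "x \<star> (qcnj x \<star> y) = y" "qcnj x \<star> (x \<star> y) = y"
proof -
  show *: "x \<star> qcnj x = qone" "qcnj x \<star> x = qone"
    using assms by (simp_all add: qmul_qcnj SU2_iff qone_def)
  show "x \<star> (qcnj x \<star> y) = y" "qcnj x \<star> (x \<star> y) = y"
    by (simp_all add: * flip: qmul_assoc)
qed

lemma SU2_closed [simp, intro]:
  "qone \<in> SU2" "x \<in> SU2 \<Longrightarrow> y \<in> SU2 \<Longrightarrow> x \<star> y \<in> SU2" "x \<in> SU2 \<Longrightarrow> qcnj x \<in> SU2"
  by (simp_all add: SU2_iff norm_qmul) (simp add: qone_def norm_prod_def)

section \<open>Conjugation and commutation\<close>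

definition qconj :: "quat \<Rightarrow> quat \<Rightarrow> quat" where
  "qconj g x = g \<star> x \<star> qcnj g"

lemma qconj_mult: "g \<in> SU2 \<Longrightarrow> qconj g x \<star> qconj g y = qconj g (x \<star> y)"
  by (simp add: qconj_def qmul_assoc)

lemma qconj_comp: "qconj g (qconj h x) = qconj (g \<star> h) x"
  by (simp add: qconj_def qcnj_qmul qmul_assoc)

lemma qconj_inverse [simp]:
  "g \<in> SU2 \<Longrightarrow> qconj g (qconj (qcnj g) x) = x" "g \<in> SU2 \<Longrightarrow> qconj (qcnj g) (qconj g x) = x"
  "qconj qone x = x"
  by (simp_all add: qconj_def qmul_assoc)

lemma norm_qconj: "g \<in> SU2 \<Longrightarrow> norm (qconj g x) = norm x"
  by (simp add: qconj_def norm_qmul SU2_iff)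

lemma qconj_SU2_iff: "g \<in> SU2 \<Longrightarrow> qconj g x \<in> SU2 \<longleftrightarrow> x \<in> SU2"
  by (simp add: SU2_iff norm_qconj)

lemma fst_qmul_commute: "fst (x \<star> y) = fst (y \<star> x)"
  by (simp add: qmul_def inner_commute)

lemma fst_qconj: "g \<in> SU2 \<Longrightarrow> fst (qconj g x) = fst x"
  unfolding qconj_def by (subst fst_qmul_commute) (simp flip: qmul_assoc)

text \<open>The commutator of two quaternions is twice the cross product of their imaginary parts.\<close>

lemma commute_iff_cross: "x \<star> y = y \<star> x \<longleftrightarrow> snd x \<times> snd y = 0"
proof -
  have "x \<star> y - y \<star> x = (0, 2 *\<^sub>R (snd x \<times> snd y))"
    by (simp add: qmul_def prod_eq_iff inner_commute algebra_simps cross_skew[of "snd y"] scaleR_2)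
  then have "x \<star> y - y \<star> x = 0 \<longleftrightarrow> snd x \<times> snd y = 0"
    by (simp add: prod_eq_iff zero_prod_def)
  then show ?thesis by simp
qed

text \<open>The centralizer of an element is closed under products and inverses, so commuting generators
generate an abelian group.\<close>

lemma irreducible_set_iff: "irreducible_set S \<longleftrightarrow> (\<exists>x\<in>S. \<exists>y\<in>S. x \<star> y \<noteq> y \<star> x)"
proof
  show "irreducible_set S" if "\<exists>x\<in>S. \<exists>y\<in>S. x \<star> y \<noteq> y \<star> x"
    using that unfolding irreducible_set_def by (meson generated.incl)
  show "\<exists>x\<in>S. \<exists>y\<in>S. x \<star> y \<noteq> y \<star> x" if irr: "irreducible_set S"
  proof (rule ccontr)
    assume "\<not> (\<exists>x\<in>S. \<exists>y\<in>S. x \<star> y \<noteq> y \<star> x)"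
    then have S: "\<And>x y. x \<in> S \<Longrightarrow> y \<in> S \<Longrightarrow> x \<star> y = y \<star> x" by blast
    have centralizer: "x \<star> y = y \<star> x" if "x \<in> generated T" "\<And>z. z \<in> T \<Longrightarrow> z \<star> y = y \<star> z" for x y T
      using that(1)
    proof induction
      case (inv x)
      then show ?case by (simp add: commute_iff_cross qcnj_def)
    next
      case (mult x x')
      have "x \<star> x' \<star> y = x \<star> y \<star> x'" by (simp only: qmul_assoc mult.IH(2))
      also have "\<dots> = y \<star> x \<star> x'" by (simp only: mult.IH(1))
      also have "\<dots> = y \<star> (x \<star> x')" by (rule qmul_assoc)
      finally show ?case .
    qed (use that in auto)
    have "x \<star> y = y \<star> x" if "x \<in> generated S" "y \<in> S" for x y
      using centralizer that S by blast
    then have "x \<star> y = y \<star> x" if "x \<in> generated S" "y \<in> generated S" for x y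
      using centralizer[of y S x] that by metis
    then show False using irr unfolding irreducible_set_def by blast
  qed
qed

section \<open>Pairs of quaternions and the braid map\<close>

definition tup :: "quat \<Rightarrow> quat \<Rightarrow> 2 tuple" where
  "tup A B = (\<chi> j. if j = 0 then A else B)"

lemma tup_nth [simp]: "tup A B $ 0 = A" "tup A B $ 1 = B"
  by (simp_all add: tup_def)

lemma tuple_eq_iff: "X = Y \<longleftrightarrow> X $ 0 = Y $ 0 \<and> X $ 1 = Y $ (1::2)"
  by (simp add: Finite_Cartesian_Product.vec_eq_iff forall_two_index)

lemma tup_eta: "tup (X $ 0) (X $ 1) = X"
  by (simp add: tuple_eq_iff)

definition conj_tuple :: "quat \<Rightarrow> 2 tuple \<Rightarrow> 2 tuple" where
  "conj_tuple g X = (\<chi> j. qconj g (X $ j))"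

lemma conj_tuple_nth [simp]: "conj_tuple g X $ j = qconj g (X $ j)"
  by (simp add: conj_tuple_def)

lemma conj_act_eq: "conj_act g p = (conj_tuple g (fst p), conj_tuple g (snd p))"
  by (simp add: conj_act_def conj_tuple_def qconj_def)

lemma ordered_prod_two: "ordered_prod X = X $ 0 \<star> X $ (1::2)"
  by (simp add: ordered_prod_def strands_two)

lemma ordered_prod_conj: "g \<in> SU2 \<Longrightarrow> ordered_prod (conj_tuple g X) = qconj g (ordered_prod X)"
  by (simp add: ordered_prod_two qconj_mult)

primrec qpow :: "quat \<Rightarrow> nat \<Rightarrow> quat" where
  "qpow q 0 = qone"
| "qpow q (Suc n) = qpow q n \<star> q"

lemma qpow_SU2: "q \<in> SU2 \<Longrightarrow> qpow q n \<in> SU2"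
  by (induction n) auto

lemma qpow_conj: "g \<in> SU2 \<Longrightarrow> qpow (qconj g q) n = qconj g (qpow q n)"
  by (induction n) (simp_all add: qconj_mult, simp add: qconj_def)

lemma qpow_polar:
  assumes "norm u = 1"
  shows "qpow (cos \<theta>, sin \<theta> *\<^sub>R u) n = (cos (n * \<theta>), sin (n * \<theta>) *\<^sub>R u)"
proof (induction n)
  case (Suc n)
  have "u \<bullet> u = 1" using assms by (simp add: dot_square_norm)
  moreover have "real (Suc n) * \<theta> = n * \<theta> + \<theta>" by (simp add: distrib_right)
  ultimately show ?case
    by (simp add: Suc qmul_def cos_add sin_add cross_mult_left cross_mult_right
        scaleR_add_left mult.commute add.commute)
qed (simp add: qone_def)

lemma word_eval_append: "word_eval X (u @ v) = word_eval X u \<star> word_eval X v"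
  by (induction u) (simp_all add: qmul_assoc)

lemma word_eval_word_inv: "word_eval X (word_inv w) = qcnj (word_eval X w)"
  by (induction w) (auto simp: word_inv_Cons word_eval_append qcnj_qmul, simp add: word_inv_def)

lemma word_eval_word_subst: "word_eval X (word_subst h w) = word_eval (\<chi> j. word_eval X (h j)) w"
  by (induction w) (auto simp: word_subst_Cons word_eval_append word_eval_word_inv,
      simp add: word_subst_def)

text \<open>A full twist is conjugation by the product, which is unchanged by this conjugation. So
the powers of the product accumulate.\<close>

lemma braid_map_torus:
  assumes "X $ 0 \<in> SU2" "X $ 1 \<in> SU2"
  shows "braid_map (fst (torus_link l)) X = conj_tuple (qpow (ordered_prod X) l) X"
proof -
  have "braid_map (replicate (2 * n) (1, True)) X = conj_tuple (qpow (ordered_prod X) n) X"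
    if "X $ 0 \<in> SU2" "X $ 1 \<in> SU2" for X n
    using that
  proof (induction n arbitrary: X)
    case 0
    show ?case by (simp add: braid_map_def braid_act_def tuple_eq_iff)
  next
    case (Suc n)
    define P where "P = ordered_prod X"
    have P: "P \<in> SU2" using Suc.prems by (simp add: P_def ordered_prod_two)
    have double: "(\<chi> j. word_eval X (full_twist j)) = conj_tuple P X"
      using Suc.prems
      by (simp add: tuple_eq_iff full_twist P_def ordered_prod_two qconj_def qcnj_qmul qmul_assoc)
    have "braid_map (replicate (2 * Suc n) (1, True)) X = braid_map (replicate (2 * n) (1, True)) (conj_tuple P X)"
      unfolding braid_map_def braid_act_double word_eval_word_subst double ..
    also have "\<dots> = conj_tuple (qpow (ordered_prod (conj_tuple P X)) n) (conj_tuple P X)"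
      using Suc.prems P by (intro Suc.IH) (simp_all add: qconj_SU2_iff)
    also have "ordered_prod (conj_tuple P X) = P"
      using P unfolding ordered_prod_conj[OF P] P_def[symmetric] by (simp add: qconj_def qmul_assoc)
    finally show ?case
      by (simp add: tuple_eq_iff qconj_comp P_def)
  qed
  then show ?thesis using assms by (simp add: torus_link_def)
qed

section \<open>The spaces of irreducible pairs\<close>

lemma R_space_torus: "X \<in> R_space (snd (torus_link l)) \<alpha> \<longleftrightarrow>
    X $ 0 \<in> SU2 \<and> fst (X $ 0) = cos (\<alpha> $ 1) \<and> X $ 1 \<in> SU2 \<and> fst (X $ 1) = cos (\<alpha> $ 2)"
  unfolding R_space_def mem_Collect_eq forall_two_index snd_torus_link by (auto simp: qtrace_def)

lemma R_space_conj: "g \<in> SU2 \<Longrightarrow> conj_tuple g X \<in> R_space (snd (torus_link l)) \<alpha> \<longleftrightarrow> X \<in> R_space (snd (torus_link l)) \<alpha>"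
  by (simp add: R_space_torus qconj_SU2_iff fst_qconj)

lemma range_tuple: "range (($) X) = {X $ 0, X $ (1::2)}"
  by (auto simp: UNIV_two_index)

lemma irreducible_pair:
  "irreducible_set {A, B} \<longleftrightarrow> snd A \<times> snd B \<noteq> 0"
  unfolding irreducible_set_iff commute_iff_cross using cross_skew[of "snd A" "snd B"] by auto

lemma irreducible_mono: "irreducible_set S \<Longrightarrow> S \<subseteq> T \<Longrightarrow> irreducible_set T"
  unfolding irreducible_set_iff by blast

definition noncommuting :: "2 tuple \<Rightarrow> bool" where
  "noncommuting X \<longleftrightarrow> snd (X $ 0) \<times> snd (X $ 1) \<noteq> 0"

lemma Lambda_irr_iff:
  "p \<in> Lambda_irr (torus_link l) \<alpha> \<longleftrightarrow>
     fst p = snd p \<and> fst p \<in> R_space (snd (torus_link l)) \<alpha> \<and> noncommuting (fst p)"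
proof -
  have "irreducible_set (range (($) (fst p)) \<union> range (($) (snd p))) \<longleftrightarrow> noncommuting (fst p)"
    if "fst p = snd p"
    using that unfolding range_tuple noncommuting_def by (simp add: irreducible_pair)
  moreover have "p \<in> {(X, X) |X. X \<in> R_space (snd (torus_link l)) \<alpha>} \<longleftrightarrow>
     fst p = snd p \<and> fst p \<in> R_space (snd (torus_link l)) \<alpha>"
    by (cases p) auto
  ultimately show ?thesis
    unfolding Lambda_irr_def Irr_def by blast
qed

lemma Gamma_irrI:
  assumes "X \<in> R_space (snd (torus_link l)) \<alpha>" "noncommuting X"
  shows "(X, conj_tuple (qpow (ordered_prod X) l) X) \<in> Gamma_irr (torus_link l) \<alpha>"
  using assms irreducible_mono[of "{X $ 0, X $ 1}"]
  by (auto simp: Gamma_irr_def Irr_def R_space_torus range_tuple braid_map_torus noncommuting_def irreducible_pair)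

lemma Gamma_irrD:
  assumes "p \<in> Gamma_irr (torus_link l) \<alpha>"
  shows "fst p \<in> R_space (snd (torus_link l)) \<alpha>" "snd p = conj_tuple (qpow (ordered_prod (fst p)) l) (fst p)"
  using assms by (auto simp: Gamma_irr_def Irr_def R_space_torus braid_map_torus)

lemma H_irrI:
  assumes "X \<in> R_space (snd (torus_link l)) \<alpha>" "Y \<in> R_space (snd (torus_link l)) \<alpha>"
    "ordered_prod X = ordered_prod Y" "noncommuting X"
  shows "(X, Y) \<in> H_irr (torus_link l) \<alpha>"
  using assms irreducible_mono[of "{X $ 0, X $ 1}"]
  by (auto simp: H_irr_def Irr_def range_tuple noncommuting_def irreducible_pair)

lemma H_irrD:
  assumes "p \<in> H_irr (torus_link l) \<alpha>"
  shows "fst p \<in> R_space (snd (torus_link l)) \<alpha>" "snd p \<in> R_space (snd (torus_link l)) \<alpha>"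
    "ordered_prod (fst p) = ordered_prod (snd p)"
  using assms by (auto simp: H_irr_def Irr_def)

lemma noncommuting_conj: "g \<in> SU2 \<Longrightarrow> noncommuting (conj_tuple g X) \<longleftrightarrow> noncommuting X"
proof -
  assume g: "g \<in> SU2"
  have "qconj g x = qconj g y \<longleftrightarrow> x = y" for x y
    using g by (metis qconj_inverse(2))
  then show ?thesis
    using g by (simp add: noncommuting_def qconj_mult flip: commute_iff_cross)
qed

lemma conj_act_inverse:
  assumes "g \<in> SU2"
  shows "conj_act g (conj_act (qcnj g) p) = (p::2 tuple2)" "conj_act (qcnj g) (conj_act g p) = p"
  using assms by (simp_all add: conj_act_eq prod_eq_iff tuple_eq_iff)

lemma conj_act_comp: "conj_act g (conj_act h p) = conj_act (g \<star> h) (p::2 tuple2)"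
  by (simp add: conj_act_eq prod_eq_iff tuple_eq_iff qconj_comp)

lemma conj_Lambda:
  assumes "g \<in> SU2" "p \<in> Lambda_irr (torus_link l) \<alpha>"
  shows "conj_act g p \<in> Lambda_irr (torus_link l) \<alpha>"
  using assms by (auto simp: Lambda_irr_iff conj_act_eq R_space_conj noncommuting_conj)

lemma conj_irreducible:
  assumes "g \<in> SU2" "irreducible_set S"
  shows "irreducible_set (qconj g ` S)"
proof -
  obtain x y where "x \<in> S" "y \<in> S" "x \<star> y \<noteq> y \<star> x"
    using assms unfolding irreducible_set_iff by blast
  moreover have "qconj g (x \<star> y) \<noteq> qconj g (y \<star> x)"
    using assms calculation by (metis qconj_inverse(2))
  ultimately show ?thesis
    unfolding irreducible_set_iff using qconj_mult[OF assms(1)] by auto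
qed

lemma conj_Irr:
  assumes "g \<in> SU2" "p \<in> Irr M" "conj_act g p \<in> M"
  shows "conj_act g p \<in> Irr (M :: 2 tuple2 set)"
proof -
  have "range (($) (fst (conj_act g p))) \<union> range (($) (snd (conj_act g p))) =
     qconj g ` (range (($) (fst p)) \<union> range (($) (snd p)))"
    by (simp add: conj_act_eq range_tuple UNIV_two_index insert_commute)
  then show ?thesis
    using assms conj_irreducible[of g "range (($) (fst p)) \<union> range (($) (snd p))"]
    by (simp only: Irr_def mem_Collect_eq)
qed

lemma conj_Gamma:
  assumes g: "g \<in> SU2" and p: "p \<in> Gamma_irr (torus_link l) \<alpha>"
  shows "conj_act g p \<in> Gamma_irr (torus_link l) \<alpha>"
  unfolding Gamma_irr_def
proof (rule conj_Irr[OF g p[unfolded Gamma_irr_def]])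
  have "conj_act g p = (conj_tuple g (fst p), braid_map (fst (torus_link l)) (conj_tuple g (fst p)))"
    using Gamma_irrD[OF p] g
    by (simp add: conj_act_eq tuple_eq_iff R_space_torus braid_map_torus qconj_SU2_iff ordered_prod_conj qpow_conj)
       (simp add: qconj_def qcnj_qmul qmul_assoc)
  then show "conj_act g p \<in> {(X, braid_map (fst (torus_link l)) X) |X. X \<in> R_space (snd (torus_link l)) \<alpha>}"
    using Gamma_irrD(1)[OF p] R_space_conj[OF g] by blast
qed

lemma conj_H:
  assumes g: "g \<in> SU2" and p: "p \<in> H_irr (torus_link l) \<alpha>"
  shows "conj_act g p \<in> H_irr (torus_link l) \<alpha>"
  unfolding H_irr_def
  by (rule conj_Irr[OF g p[unfolded H_irr_def]])
     (use H_irrD[OF p] g in \<open>auto simp: conj_act_eq R_space_conj ordered_prod_conj\<close>)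

section \<open>Fixed points of the braid\<close>

lemma SU2_polar:
  assumes "x \<in> SU2"
  obtains \<theta> u where "0 \<le> \<theta>" "\<theta> \<le> pi" "norm u = 1" "x = (cos \<theta>, sin \<theta> *\<^sub>R u)"
proof -
  have n: "(fst x)\<^sup>2 + (norm (snd x))\<^sup>2 = 1"
    using assms norm_quat[of x] by (simp add: SU2_iff dot_square_norm)
  then have le: "-1 \<le> fst x" "fst x \<le> 1"
  proof -
    have "(fst x)\<^sup>2 \<le> 1" using n zero_le_power2[of "norm (snd x)"] by linarith
    then have "\<bar>fst x\<bar> \<le> 1" by (simp add: abs_square_le_1)
    then show "-1 \<le> fst x" "fst x \<le> 1" by linarith+
  qed
  \<comment> \<open>For \<open>x = \<plusminus>1\<close> the axis is arbitrary.\<close>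
  define u where "u = (if snd x = 0 then axis 1 1 else (1 / norm (snd x)) *\<^sub>R snd x)"
  have "sin (arccos (fst x)) = norm (snd x)"
    using n le by (simp add: sin_arccos flip: n)
  then have "x = (cos (arccos (fst x)), sin (arccos (fst x)) *\<^sub>R u)" "norm u = 1"
    using le by (auto simp: u_def prod_eq_iff)
  then show ?thesis using that arccos_lbound[OF le] arccos_ubound[OF le] by blast
qed

text \<open>A vector parallel to two independent vectors vanishes: both \<open>(v \<bullet> v) a\<close> and \<open>(v \<bullet> v) b\<close> are
multiples of \<open>v\<close>.\<close>

lemma cross_dependent:
  assumes "v \<times> a = 0" "v \<times> b = 0" "a \<times> b \<noteq> 0"
  shows "v = (0::real^3)"
proof -
  have a: "(v \<bullet> v) *\<^sub>R a = (v \<bullet> a) *\<^sub>R v" and b: "(v \<bullet> v) *\<^sub>R b = (v \<bullet> b) *\<^sub>R v"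
    using Lagrange[of v v a] Lagrange[of v v b] assms by simp_all
  have "((v \<bullet> v) * (v \<bullet> v)) *\<^sub>R (a \<times> b) = ((v \<bullet> v) *\<^sub>R a) \<times> ((v \<bullet> v) *\<^sub>R b)"
    by (simp add: cross_mult_left cross_mult_right)
  also have "\<dots> = 0"
    unfolding a b by (simp add: cross_mult_left cross_mult_right)
  finally show ?thesis using assms by simp
qed

text \<open>Conjugation by \<open>P\<close> rotates about the imaginary part of \<open>P\<close>, and a nontrivial rotation cannot
fix two independent directions.\<close>

lemma fixed_iff:
  assumes "noncommuting X" "P \<in> SU2"
  shows "conj_tuple P X = X \<longleftrightarrow> snd P = 0"
proof -
  have "qconj P x = x \<longleftrightarrow> snd P \<times> snd x = 0" for x
  proof -
    have "qconj P x = x \<longleftrightarrow> P \<star> x = x \<star> P"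
      unfolding qconj_def using assms(2) by (metis SU2_inverse(2) qmul_assoc qone_mult(2) SU2_inverse(1))
    then show ?thesis by (simp add: commute_iff_cross)
  qed
  then show ?thesis
    using assms(1) cross_dependent[of "snd P" "snd (X $ 0)" "snd (X $ 1)"]
    by (auto simp: tuple_eq_iff noncommuting_def)
qed

text \<open>For \<open>P = exp(\<theta> u)\<close> with \<open>0 < \<theta> < \<pi>\<close> the imaginary part of \<open>P\<^sup>l\<close> is \<open>sin(l \<theta>) u\<close>. The values \<open>0\<close> and \<open>\<pi>\<close>
are excluded, since \<open>P = \<plusminus>1\<close> would make the two factors commute.\<close>

lemma intersection_iff:
  assumes "l > 0"
  shows "p \<in> Lambda_irr (torus_link l) \<alpha> \<inter> Gamma_irr (torus_link l) \<alpha> \<longleftrightarrow>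
    p \<in> Lambda_irr (torus_link l) \<alpha> \<and>
    (\<exists>m\<in>{1..<l}. fst (ordered_prod (fst p)) = cos (pi * m / l))"
proof (cases "p \<in> Lambda_irr (torus_link l) \<alpha>")
  case True
  define X where "X = fst p"
  have X: "p = (X, X)" "X \<in> R_space (snd (torus_link l)) \<alpha>" "noncommuting X"
    using True by (auto simp: Lambda_irr_iff X_def prod_eq_iff)
  then have P: "ordered_prod X \<in> SU2" by (simp add: R_space_torus ordered_prod_two)
  have "p \<in> Gamma_irr (torus_link l) \<alpha> \<longleftrightarrow> conj_tuple (qpow (ordered_prod X) l) X = X"
    using Gamma_irrI[OF X(2,3)] Gamma_irrD(2)[of p l \<alpha>] X(1) by auto
  also have "\<dots> \<longleftrightarrow> snd (qpow (ordered_prod X) l) = 0"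
    by (rule fixed_iff[OF X(3) qpow_SU2[OF P]])
  also have "\<dots> \<longleftrightarrow> (\<exists>m\<in>{1..<l}. fst (ordered_prod X) = cos (pi * m / l))"
  proof -
    obtain \<theta> u where \<theta>: "0 \<le> \<theta>" "\<theta> \<le> pi" "norm u = 1" "ordered_prod X = (cos \<theta>, sin \<theta> *\<^sub>R u)"
      using SU2_polar[OF P] .
    have ne: "sin \<theta> \<noteq> 0"
    proof
      assume "sin \<theta> = 0"
      then have "snd (X $ 0 \<star> X $ 1) = 0" using \<theta>(4) by (simp add: ordered_prod_two)
      then have "snd (X $ 0) \<times> snd (X $ 0 \<star> X $ 1) = 0" by simp
      then have "X $ 0 \<star> (X $ 0 \<star> X $ 1) = (X $ 0 \<star> X $ 1) \<star> X $ 0"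
        by (simp add: commute_iff_cross)
      then have "X $ 0 \<star> X $ 1 = X $ 1 \<star> X $ 0"
        using X(2) by (metis R_space_torus SU2_inverse(4) qmul_assoc)
      then show False using X(3) by (simp add: noncommuting_def commute_iff_cross)
    qed
    then have \<theta>': "0 < \<theta>" "\<theta> < pi"
      using \<theta> by (auto simp: order_less_le)
    have "snd (qpow (ordered_prod X) l) = 0 \<longleftrightarrow> sin (l * \<theta>) = 0"
      using \<theta>(3) unfolding \<theta>(4) qpow_polar[OF \<theta>(3)] by auto
    also have "\<dots> \<longleftrightarrow> (\<exists>m\<in>{1..<l}. cos \<theta> = cos (pi * m / l))"
    proof
      assume "sin (l * \<theta>) = 0"
      then obtain i :: int where i: "l * \<theta> = i * pi" using sin_zero_iff_int2 by blast
      have "0 < i * pi" using \<theta>' assms unfolding i[symmetric] by simp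
      then have i0: "0 < i" by (simp add: zero_less_mult_iff)
      have "i * pi < l * pi" using \<theta>' assms unfolding i[symmetric] by simp
      then have "i < int l" by simp
      moreover have "\<theta> = pi * nat i / l" using i i0 assms by (simp add: field_simps)
      ultimately show "\<exists>m\<in>{1..<l}. cos \<theta> = cos (pi * m / l)"
        using i0 by (intro bexI[of _ "nat i"]) auto
    next
      assume "\<exists>m\<in>{1..<l}. cos \<theta> = cos (pi * m / l)"
      then obtain m where m: "m \<in> {1..<l}" "cos \<theta> = cos (pi * m / l)" by blast
      have "\<theta> = pi * m / l"
        by (rule cos_inj_pi) (use \<theta> m in \<open>auto simp: field_simps\<close>)
      then have "l * \<theta> = m * pi" using assms by (simp add: field_simps)
      then show "sin (l * \<theta>) = 0" by simp
    qed
    finally show ?thesis using \<theta>(4) by simp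
  qed
  finally show ?thesis using True X(1) by simp
qed auto

section \<open>Normal forms up to conjugation\<close>

text \<open>The angles are indexed by \<open>1\<close> and \<open>2\<close>; from here on the index \<open>2\<close> is kept as it is.\<close>

declare two_index_simps(5) [simp del]

text \<open>Quaternions by their four real coordinates, for computations with explicit normal forms.\<close>

definition quat4 :: "real \<Rightarrow> real \<Rightarrow> real \<Rightarrow> real \<Rightarrow> quat" where
  "quat4 a x y z = (a, vector [x, y, z])"

lemma quat4_sel [simp]: "fst (quat4 a x y z) = a" "snd (quat4 a x y z) $ 1 = x"
    "snd (quat4 a x y z) $ 2 = y" "snd (quat4 a x y z) $ 3 = z"
  by (simp_all add: quat4_def)

lemma quat_eq_iff: "p = q \<longleftrightarrow> fst p = fst q \<and> snd p $ 1 = snd q $ 1 \<and> snd p $ 2 = snd q $ 2 \<and> snd p $ 3 = snd (q::quat) $ 3"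
  by (auto simp: prod_eq_iff Finite_Cartesian_Product.vec_eq_iff forall_3)

lemma quat4_eta: "q = quat4 (fst q) (snd q $ 1) (snd q $ 2) (snd q $ 3)"
  by (simp add: quat_eq_iff)

lemma quat4_inject [simp]:
  "quat4 a x y z = quat4 a' x' y' z' \<longleftrightarrow> a = a' \<and> x = x' \<and> y = y' \<and> z = z'"
  by (simp add: quat_eq_iff)

lemma quat4_arith:
  "quat4 a x y z \<star> quat4 a' x' y' z' =
    quat4 (a * a' - x * x' - y * y' - z * z') (a * x' + a' * x + y * z' - z * y')
      (a * y' + a' * y + z * x' - x * z') (a * z' + a' * z + x * y' - y * x')"
  "qcnj (quat4 a x y z) = quat4 a (- x) (- y) (- z)"
  "quat4 a x y z + quat4 a' x' y' z' = quat4 (a + a') (x + x') (y + y') (z + z')"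
  "quat4 a x y z - quat4 a' x' y' z' = quat4 (a - a') (x - x') (y - y') (z - z')"
  "- quat4 a x y z = quat4 (- a) (- x) (- y) (- z)"
  "r *\<^sub>R quat4 a x y z = quat4 (r * a) (r * x) (r * y) (r * z)"
  "qone = quat4 1 0 0 0"
  "0 = quat4 0 0 0 0"
  by (simp_all add: quat_eq_iff qmul_def qcnj_def qone_def cross_components inner_vec_def sum_3 algebra_simps)

lemma norm_quat4: "(norm (quat4 a x y z))\<^sup>2 = a\<^sup>2 + x\<^sup>2 + y\<^sup>2 + z\<^sup>2"
  unfolding norm_quat by (simp add: inner_vec_def sum_3 power2_eq_square)

lemma quat4_SU2: "quat4 a x y z \<in> SU2 \<longleftrightarrow> a\<^sup>2 + x\<^sup>2 + y\<^sup>2 + z\<^sup>2 = 1"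
  unfolding SU2_iff norm_quat4[symmetric] power2_eq_1_iff
  using norm_ge_zero[of "quat4 a x y z"] by linarith

text \<open>The normal form of a pair with product \<open>P = exp(\<theta> i)\<close> has first entry
\<open>cos \<alpha>\<^sub>1 + h i + r j\<close> with \<open>r > 0\<close>; the second entry is then determined by \<open>P\<close>. The number \<open>h\<close> is forced by
the real part of the second entry, \<open>k\<close> is the \<open>i\<close>-coordinate of the second entry, and \<open>r\<close> is
forced by the norm of the first one.\<close>

definition nh :: "real^2 \<Rightarrow> real \<Rightarrow> real" where
  "nh \<alpha> \<theta> = (cos (\<alpha> $ 2) - cos (\<alpha> $ 1) * cos \<theta>) / sin \<theta>"

definition nk :: "real^2 \<Rightarrow> real \<Rightarrow> real" where
  "nk \<alpha> \<theta> = cos (\<alpha> $ 1) * sin \<theta> - nh \<alpha> \<theta> * cos \<theta>"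

definition nr :: "real^2 \<Rightarrow> real \<Rightarrow> real" where
  "nr \<alpha> \<theta> = sqrt ((sin (\<alpha> $ 1))\<^sup>2 - (nh \<alpha> \<theta>)\<^sup>2)"

definition normal_pair :: "real^2 \<Rightarrow> real \<Rightarrow> 2 tuple" where
  "normal_pair \<alpha> \<theta> = tup (quat4 (cos (\<alpha> $ 1)) (nh \<alpha> \<theta>) (nr \<alpha> \<theta>) 0)
     (quat4 (cos (\<alpha> $ 2)) (nk \<alpha> \<theta>) (- nr \<alpha> \<theta> * cos \<theta>) (nr \<alpha> \<theta> * sin \<theta>))"

text \<open>The condition that \<open>r\<close> above is a positive number, so that the normal form exists and is
irreducible.\<close>

definition admissible :: "real^2 \<Rightarrow> real \<Rightarrow> bool" where
  "admissible \<alpha> \<theta> \<longleftrightarrow> 0 < \<theta> \<and> \<theta> < pi \<and> (nh \<alpha> \<theta>)\<^sup>2 < (sin (\<alpha> $ 1))\<^sup>2"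

text \<open>With \<open>x = cos \<theta>\<close>, the difference of the two sides of the inequality in \<open>admissible\<close>,
multiplied by \<open>sin\<^sup>2 \<theta>\<close>, is \<open>(x - cos(\<alpha>\<^sub>1 + \<alpha>\<^sub>2)) (x - cos(\<alpha>\<^sub>1 - \<alpha>\<^sub>2))\<close>.\<close>

lemma admissible_iff:
  assumes "0 < \<alpha> $ 1" "\<alpha> $ 1 < pi" "0 < \<alpha> $ 2" "\<alpha> $ 2 < pi" "0 < \<theta>" "\<theta> < pi"
  shows "admissible \<alpha> \<theta> \<longleftrightarrow> cos (\<alpha> $ 1 + \<alpha> $ 2) < cos \<theta> \<and> cos \<theta> < cos (\<alpha> $ 1 - \<alpha> $ 2)"
proof -
  define c1 where "c1 = cos (\<alpha> $ 1)"
  define s1 where "s1 = sin (\<alpha> $ 1)"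
  define c2 where "c2 = cos (\<alpha> $ 2)"
  define s2 where "s2 = sin (\<alpha> $ 2)"
  define x where "x = cos \<theta>"
  note defs = c1_def s1_def c2_def s2_def x_def
  have pos: "0 < s1" "0 < s2" "0 < sin \<theta>" using assms by (auto simp: defs sin_gt_zero)
  have s: "s1\<^sup>2 = 1 - c1\<^sup>2" "s2\<^sup>2 = 1 - c2\<^sup>2" "(sin \<theta>)\<^sup>2 = 1 - x\<^sup>2"
    by (simp_all add: defs sin_squared_eq)
  have "admissible \<alpha> \<theta> \<longleftrightarrow> (c2 - c1 * x)\<^sup>2 < s1\<^sup>2 * (sin \<theta>)\<^sup>2"
    using assms pos by (simp add: admissible_def nh_def power_divide field_simps flip: defs)
  also have "\<dots> \<longleftrightarrow> (x - (c1 * c2 - s1 * s2)) * (x - (c1 * c2 + s1 * s2)) < 0"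
  proof -
    have "(x - (c1 * c2 - s1 * s2)) * (x - (c1 * c2 + s1 * s2)) = (x - c1 * c2)\<^sup>2 - s1\<^sup>2 * s2\<^sup>2"
      by (simp add: algebra_simps power2_eq_square)
    also have "\<dots> = (c2 - c1 * x)\<^sup>2 - s1\<^sup>2 * (sin \<theta>)\<^sup>2"
      unfolding s by (simp add: algebra_simps power2_eq_square)
    finally show ?thesis by simp
  qed
  also have "\<dots> \<longleftrightarrow> c1 * c2 - s1 * s2 < x \<and> x < c1 * c2 + s1 * s2"
    using mult_pos_pos[OF pos(1,2)] by (auto simp: mult_less_0_iff)
  finally show ?thesis by (simp add: cos_add cos_diff defs)
qed

lemma admissible_simps:
  assumes "admissible \<alpha> \<theta>"
  shows "0 < sin \<theta>" "0 < nr \<alpha> \<theta>" "(nr \<alpha> \<theta>)\<^sup>2 = (sin (\<alpha> $ 1))\<^sup>2 - (nh \<alpha> \<theta>)\<^sup>2"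
    "cos (\<alpha> $ 2) = cos (\<alpha> $ 1) * cos \<theta> + nh \<alpha> \<theta> * sin \<theta>"
    "(nk \<alpha> \<theta>)\<^sup>2 + (nr \<alpha> \<theta>)\<^sup>2 = (sin (\<alpha> $ 2))\<^sup>2"
proof -
  show s: "0 < sin \<theta>" using assms by (simp add: admissible_def sin_gt_zero)
  show "0 < nr \<alpha> \<theta>" using assms by (simp add: admissible_def nr_def)
  show r: "(nr \<alpha> \<theta>)\<^sup>2 = (sin (\<alpha> $ 1))\<^sup>2 - (nh \<alpha> \<theta>)\<^sup>2" using assms by (simp add: admissible_def nr_def)
  show c: "cos (\<alpha> $ 2) = cos (\<alpha> $ 1) * cos \<theta> + nh \<alpha> \<theta> * sin \<theta>"
    using s by (simp add: nh_def)
  have "(cos (\<alpha> $ 1))\<^sup>2 + (sin (\<alpha> $ 1))\<^sup>2 = 1" "(cos \<theta>)\<^sup>2 + (sin \<theta>)\<^sup>2 = 1"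
    by simp_all
  then show "(nk \<alpha> \<theta>)\<^sup>2 + (nr \<alpha> \<theta>)\<^sup>2 = (sin (\<alpha> $ 2))\<^sup>2"
    unfolding sin_squared_eq[of "\<alpha> $ 2"] c nk_def r by Groebner_Basis.algebra
qed

lemma normal_pair_prod:
  assumes "admissible \<alpha> \<theta>"
  shows "ordered_prod (normal_pair \<alpha> \<theta>) = quat4 (cos \<theta>) (sin \<theta>) 0 0"
proof -
  note a = admissible_simps[OF assms]
  have t: "(cos (\<alpha> $ 1))\<^sup>2 + (sin (\<alpha> $ 1))\<^sup>2 = 1" "(cos \<theta>)\<^sup>2 + (sin \<theta>)\<^sup>2 = 1"
    by simp_all
  have r: "nr \<alpha> \<theta> * nr \<alpha> \<theta> = (sin (\<alpha> $ 1))\<^sup>2 - (nh \<alpha> \<theta>)\<^sup>2"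
    using a(3) by (simp add: power2_eq_square)
  show ?thesis
    unfolding ordered_prod_two normal_pair_def tup_nth quat4_arith quat4_inject a(4) nk_def
    by (intro conjI; ((simp add: algebra_simps; fail) | (use r t in Groebner_Basis.algebra)))
qed

lemma normal_pair_R:
  assumes "admissible \<alpha> \<theta>"
  shows "normal_pair \<alpha> \<theta> \<in> R_space (snd (torus_link l)) \<alpha>"
proof -
  note a = admissible_simps[OF assms]
  have "(cos (\<alpha> $ 1))\<^sup>2 + (nh \<alpha> \<theta>)\<^sup>2 + (nr \<alpha> \<theta>)\<^sup>2 + 0\<^sup>2 = 1"
    unfolding a(3) by simp
  moreover have "(cos (\<alpha> $ 2))\<^sup>2 + (nk \<alpha> \<theta>)\<^sup>2 + (- nr \<alpha> \<theta> * cos \<theta>)\<^sup>2 + (nr \<alpha> \<theta> * sin \<theta>)\<^sup>2 = 1"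
  proof -
    have "(cos (\<alpha> $ 2))\<^sup>2 + (nk \<alpha> \<theta>)\<^sup>2 + (- nr \<alpha> \<theta> * cos \<theta>)\<^sup>2 + (nr \<alpha> \<theta> * sin \<theta>)\<^sup>2 =
      (cos (\<alpha> $ 2))\<^sup>2 + (nk \<alpha> \<theta>)\<^sup>2 + (nr \<alpha> \<theta>)\<^sup>2 * ((cos \<theta>)\<^sup>2 + (sin \<theta>)\<^sup>2)"
      unfolding distrib_left power_mult_distrib by simp
    also have "\<dots> = (cos (\<alpha> $ 2))\<^sup>2 + ((nk \<alpha> \<theta>)\<^sup>2 + (nr \<alpha> \<theta>)\<^sup>2)" by simp
    also have "\<dots> = 1" unfolding a(5) by simp
    finally show ?thesis .
  qed
  ultimately show ?thesis
    unfolding R_space_torus normal_pair_def tup_nth quat4_SU2 by simp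
qed

lemma normal_pair_noncommuting:
  assumes "admissible \<alpha> \<theta>"
  shows "noncommuting (normal_pair \<alpha> \<theta>)"
proof -
  note a = admissible_simps[OF assms]
  have "(snd (normal_pair \<alpha> \<theta> $ 0) \<times> snd (normal_pair \<alpha> \<theta> $ 1)) $ 1 = nr \<alpha> \<theta> * (nr \<alpha> \<theta> * sin \<theta>)"
    by (simp add: normal_pair_def cross_components)
  then show ?thesis using a(1,2) unfolding noncommuting_def by force
qed

lemma qconj_eqI: "g \<in> SU2 \<Longrightarrow> g \<star> x = y \<star> g \<Longrightarrow> qconj g x = y"
  by (simp add: qconj_def qmul_assoc)

text \<open>The half-turn about the bisector of two directions exchanges them. For opposite directions
the bisector is replaced by any orthogonal direction.\<close>

lemma conj_to_first_axis:
  assumes P: "P \<in> SU2" "fst P = cos \<theta>" and \<theta>: "0 < \<theta>" "\<theta> < pi"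
  obtains g where "g \<in> SU2" "qconj g P = quat4 (cos \<theta>) (sin \<theta>) 0 0"
proof -
  have s: "0 < sin \<theta>" using \<theta> by (simp add: sin_gt_zero)
  define x where "x = snd P $ 1 / sin \<theta>"
  define y where "y = snd P $ 2 / sin \<theta>"
  define z where "z = snd P $ 3 / sin \<theta>"
  have P': "P = quat4 (cos \<theta>) (sin \<theta> * x) (sin \<theta> * y) (sin \<theta> * z)"
    using s P by (subst quat4_eta) (simp add: x_def y_def z_def)
  have "(sin \<theta>)\<^sup>2 * (x\<^sup>2 + y\<^sup>2 + z\<^sup>2) = (sin \<theta>)\<^sup>2"
    using P(1) unfolding P' quat4_SU2 sin_squared_eq by (simp add: power_mult_distrib sin_squared_eq algebra_simps)
  then have unit: "x\<^sup>2 + y\<^sup>2 + z\<^sup>2 = 1" using s by simp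
  show ?thesis
  proof (cases "x = - 1")
    case True
    then have "y = 0" "z = 0" using unit by (simp_all add: sum_power2_eq_zero_iff)
    then have "qconj (quat4 0 0 1 0) P = quat4 (cos \<theta>) (sin \<theta>) 0 0"
      using True by (intro qconj_eqI) (simp_all add: P' quat4_arith quat4_SU2)
    then show ?thesis using that[of "quat4 0 0 1 0"] by (simp add: quat4_SU2)
  next
    case False
    define q where "q = quat4 0 (1 + x) y z"
    have "q \<noteq> 0" using False by (simp add: q_def quat4_arith(8))
    then have n: "norm q \<noteq> 0" by simp
    define g where "g = (1 / norm q) *\<^sub>R q"
    have "g \<in> SU2" using n by (simp add: g_def SU2_iff)
    moreover have "q \<star> P = quat4 (cos \<theta>) (sin \<theta>) 0 0 \<star> q"
      unfolding q_def P' quat4_arith quat4_inject by (intro conjI; ((simp add: algebra_simps; fail) | (use unit in Groebner_Basis.algebra)))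
    then have "g \<star> P = quat4 (cos \<theta>) (sin \<theta>) 0 0 \<star> g"
      by (simp add: g_def qmul_scale_left qmul_scale_right)
    ultimately show ?thesis using that qconj_eqI by blast
  qed
qed

lemma conj_about_first_axis:
  obtains g where "g \<in> SU2" "qconj g (quat4 a x y z) = quat4 a x (sqrt (y\<^sup>2 + z\<^sup>2)) 0"
    "\<And>c s. qconj g (quat4 c s 0 0) = quat4 c s 0 0"
proof -
  obtain \<phi> where \<phi>: "y = sqrt (y\<^sup>2 + z\<^sup>2) * cos \<phi>" "z = sqrt (y\<^sup>2 + z\<^sup>2) * sin \<phi>"
  proof (cases "y\<^sup>2 + z\<^sup>2 = 0")
    case True
    then show ?thesis using that[of 0] by (simp add: sum_power2_eq_zero_iff)
  next
    case False
    define \<rho> where "\<rho> = sqrt (y\<^sup>2 + z\<^sup>2)"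
    have \<rho>: "\<rho> > 0" "\<rho>\<^sup>2 = y\<^sup>2 + z\<^sup>2" using False by (auto simp: \<rho>_def sum_power2_gt_zero_iff)
    have "(y / \<rho>)\<^sup>2 + (z / \<rho>)\<^sup>2 = 1"
      using \<rho> False by (simp add: power_divide flip: add_divide_distrib)
    then obtain \<phi> where "y / \<rho> = cos \<phi>" "z / \<rho> = sin \<phi>" using sincos_total_2pi by metis
    then have "y = \<rho> * cos \<phi>" "z = \<rho> * sin \<phi>" using \<rho>(1) by (simp_all add: field_simps)
    then show ?thesis using that unfolding \<rho>_def by blast
  qed
  define \<rho> where "\<rho> = sqrt (y\<^sup>2 + z\<^sup>2)"
  define C where "C = cos (\<phi> / 2)"
  define S where "S = sin (\<phi> / 2)"
  have CS: "C\<^sup>2 + S\<^sup>2 = 1" by (simp add: C_def S_def)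
  have yz: "y = \<rho> * (C\<^sup>2 - S\<^sup>2)" "z = \<rho> * (2 * S * C)"
    using \<phi> cos_double[of "\<phi> / 2"] sin_double[of "\<phi> / 2"] by (simp_all add: C_def S_def \<rho>_def)
  define g where "g = quat4 C (- S) 0 0"
  have g: "g \<in> SU2" using CS by (simp add: g_def quat4_SU2)
  moreover have "qconj g (quat4 a x y z) = quat4 a x \<rho> 0"
    unfolding yz
    by (intro qconj_eqI[OF g], unfold g_def quat4_arith quat4_inject, intro conjI; ((simp add: algebra_simps; fail) | (use CS in Groebner_Basis.algebra)))
  moreover have "qconj g (quat4 c s 0 0) = quat4 c s 0 0" for c s
    by (rule qconj_eqI[OF g]) (simp add: g_def quat4_arith)
  ultimately show ?thesis using that unfolding \<rho>_def by blast
qed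

text \<open>Rotate the axis of the product to the first axis; the rotations about this axis that remain
bring the imaginary part of the first entry to the half-plane spanned by \<open>i\<close> and \<open>j\<close> with
nonnegative \<open>j\<close>-coordinate.\<close>

lemma normal_form:
  assumes X: "X \<in> R_space (snd (torus_link l)) \<alpha>" "noncommuting X"
    and \<theta>: "fst (ordered_prod X) = cos \<theta>" "0 < \<theta>" "\<theta> < pi"
  obtains g where "g \<in> SU2" "X = conj_tuple g (normal_pair \<alpha> \<theta>)" "admissible \<alpha> \<theta>"
proof -
  have "ordered_prod X \<in> SU2" using X by (simp add: R_space_torus ordered_prod_two)
  then obtain g1 where g1: "g1 \<in> SU2" "qconj g1 (ordered_prod X) = quat4 (cos \<theta>) (sin \<theta>) 0 0"
    using conj_to_first_axis \<theta> by blast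
  obtain x y z where xyz: "qconj g1 (X $ 0) = quat4 (cos (\<alpha> $ 1)) x y z"
    using quat4_eta[of "qconj g1 (X $ 0)"] X fst_qconj[OF g1(1)] unfolding R_space_torus by metis
  obtain g2 where g2: "g2 \<in> SU2" "qconj g2 (qconj g1 (X $ 0)) = quat4 (cos (\<alpha> $ 1)) x (sqrt (y\<^sup>2 + z\<^sup>2)) 0"
    "\<And>c s. qconj g2 (quat4 c s 0 0) = quat4 c s 0 0"
    using conj_about_first_axis[of "cos (\<alpha> $ 1)" x y z] unfolding xyz by blast
  define g where "g = g2 \<star> g1"
  define \<rho> where "\<rho> = sqrt (y\<^sup>2 + z\<^sup>2)"
  define Y where "Y = conj_tuple g X"
  have g: "g \<in> SU2" using g1 g2 by (simp add: g_def)
  have Y: "Y \<in> R_space (snd (torus_link l)) \<alpha>" "noncommuting Y"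
    using X g by (simp_all add: Y_def R_space_conj noncommuting_conj)
  have Y0: "Y $ 0 = quat4 (cos (\<alpha> $ 1)) x \<rho> 0"
    using g2 by (simp add: Y_def g_def \<rho>_def flip: qconj_comp)
  have "ordered_prod Y = quat4 (cos \<theta>) (sin \<theta>) 0 0"
    unfolding Y_def ordered_prod_conj[OF g] unfolding g_def qconj_comp[symmetric] g1 g2 ..
  then have "qcnj (Y $ 0) \<star> (Y $ 0 \<star> Y $ 1) = qcnj (Y $ 0) \<star> quat4 (cos \<theta>) (sin \<theta>) 0 0"
    by (simp add: ordered_prod_two)
  then have "Y $ 1 = qcnj (Y $ 0) \<star> quat4 (cos \<theta>) (sin \<theta>) 0 0"
    using Y(1) by (simp add: R_space_torus)
  then have Y1: "Y $ 1 = quat4 (cos (\<alpha> $ 1) * cos \<theta> + x * sin \<theta>) (cos (\<alpha> $ 1) * sin \<theta> - x * cos \<theta>)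
     (- \<rho> * cos \<theta>) (\<rho> * sin \<theta>)"
    unfolding Y0 by (simp add: quat4_arith algebra_simps)
  have "sin \<theta> > 0" using \<theta> by (simp add: sin_gt_zero)
  moreover have c2: "cos (\<alpha> $ 2) = cos (\<alpha> $ 1) * cos \<theta> + x * sin \<theta>"
    using Y(1) by (simp add: R_space_torus Y1)
  ultimately have x: "x = nh \<alpha> \<theta>" by (simp add: nh_def field_simps)
  have "Y $ 0 \<in> SU2" using Y(1) by (simp add: R_space_torus)
  then have norm: "(cos (\<alpha> $ 1))\<^sup>2 + x\<^sup>2 + \<rho>\<^sup>2 = 1"
    by (simp add: Y0 quat4_SU2)
  have "\<rho> \<noteq> 0"
  proof
    assume "\<rho> = 0"
    then have "Y $ 0 \<star> Y $ 1 = Y $ 1 \<star> Y $ 0" by (simp add: Y0 Y1 quat4_arith)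
    then show False using Y(2) by (simp add: noncommuting_def commute_iff_cross)
  qed
  then have \<rho>: "\<rho> > 0" by (simp add: \<rho>_def sum_power2_gt_zero_iff order_less_le)
  have sq: "\<rho>\<^sup>2 = (sin (\<alpha> $ 1))\<^sup>2 - (nh \<alpha> \<theta>)\<^sup>2"
    using norm by (simp add: sin_squared_eq x)
  then have "nr \<alpha> \<theta> = \<rho>" using \<rho> by (simp add: nr_def flip: sq)
  then have "Y = normal_pair \<alpha> \<theta>"
    by (simp add: tuple_eq_iff normal_pair_def Y0 Y1 x nk_def c2)
  moreover have "admissible \<alpha> \<theta>"
    using \<theta> sq \<rho> by (simp add: admissible_def) (metis diff_gt_0_iff_gt zero_less_power)
  moreover have "X = conj_tuple (qcnj g) Y"
    using g by (simp add: Y_def tuple_eq_iff)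
  ultimately show ?thesis using that[of "qcnj g"] g by auto
qed

section \<open>The intersection as a union of orbits\<close>

definition normal_point :: "real^2 \<Rightarrow> real \<Rightarrow> 2 tuple2" where
  "normal_point \<alpha> \<theta> = (normal_pair \<alpha> \<theta>, normal_pair \<alpha> \<theta>)"

definition angles :: "nat \<Rightarrow> real^2 \<Rightarrow> nat set" where
  "angles l \<alpha> = {m \<in> {1..<l}. admissible \<alpha> (pi * m / l)}"

lemma normal_point_intersection:
  assumes "m \<in> angles l \<alpha>"
  shows "normal_point \<alpha> (pi * m / l) \<in> Lambda_irr (torus_link l) \<alpha> \<inter> Gamma_irr (torus_link l) \<alpha>"
proof -
  have ad: "admissible \<alpha> (pi * m / l)" "l > 0" "m \<in> {1..<l}" using assms by (auto simp: angles_def)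
  then show ?thesis
    unfolding intersection_iff[OF ad(2)] Lambda_irr_iff normal_point_def fst_conv snd_conv normal_pair_prod[OF ad(1)]
    using normal_pair_R[OF ad(1)] normal_pair_noncommuting[OF ad(1)] by auto
qed

lemma intersection_normal_form:
  assumes p: "p \<in> Lambda_irr (torus_link l) \<alpha> \<inter> Gamma_irr (torus_link l) \<alpha>" and l: "l > 0"
  obtains g m where "g \<in> SU2" "m \<in> angles l \<alpha>" "p = conj_act g (normal_point \<alpha> (pi * m / l))"
proof -
  obtain m where m: "m \<in> {1..<l}" "fst (ordered_prod (fst p)) = cos (pi * m / l)"
    using p unfolding intersection_iff[OF l] by blast
  have bounds: "0 < pi * m / l" "pi * m / l < pi" using m by (auto simp: field_simps)
  have X: "fst p = snd p" "fst p \<in> R_space (snd (torus_link l)) \<alpha>" "noncommuting (fst p)"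
    using p by (auto simp: Lambda_irr_iff)
  obtain g where "g \<in> SU2" "fst p = conj_tuple g (normal_pair \<alpha> (pi * m / l))" "admissible \<alpha> (pi * m / l)"
    using normal_form[OF X(2,3) m(2) bounds] .
  then show ?thesis using that[of g m] m X(1)
    by (simp add: angles_def normal_point_def conj_act_eq prod_eq_iff)
qed

lemma conj_intersection:
  assumes "g \<in> SU2" "p \<in> Lambda_irr (torus_link l) \<alpha> \<inter> Gamma_irr (torus_link l) \<alpha>"
  shows "conj_act g p \<in> Lambda_irr (torus_link l) \<alpha> \<inter> Gamma_irr (torus_link l) \<alpha>"
  using assms conj_Lambda conj_Gamma by blast

lemma intersection_eq_orbits:
  assumes "l > 0"
  shows "Lambda_irr (torus_link l) \<alpha> \<inter> Gamma_irr (torus_link l) \<alpha> =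
    (\<Union>m\<in>angles l \<alpha>. orbit (normal_point \<alpha> (pi * m / l)))"
proof (intro equalityI subsetI)
  fix p assume "p \<in> Lambda_irr (torus_link l) \<alpha> \<inter> Gamma_irr (torus_link l) \<alpha>"
  then obtain g m where "g \<in> SU2" "m \<in> angles l \<alpha>" "p = conj_act g (normal_point \<alpha> (pi * m / l))"
    by (rule intersection_normal_form[OF _ assms])
  then show "p \<in> (\<Union>m\<in>angles l \<alpha>. orbit (normal_point \<alpha> (pi * m / l)))"
    unfolding orbit_def by blast
next
  fix p assume "p \<in> (\<Union>m\<in>angles l \<alpha>. orbit (normal_point \<alpha> (pi * m / l)))"
  then obtain g m where gm: "g \<in> SU2" "m \<in> angles l \<alpha>" "p = conj_act g (normal_point \<alpha> (pi * m / l))"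
    unfolding orbit_def by blast
  show "p \<in> Lambda_irr (torus_link l) \<alpha> \<inter> Gamma_irr (torus_link l) \<alpha>"
    unfolding gm(3) by (rule conj_intersection[OF gm(1) normal_point_intersection[OF gm(2)]])
qed

lemma continuous_on_conj_act: "continuous_on S (\<lambda>g. conj_act g (p :: 2 tuple2))"
proof -
  have "continuous_on S (\<lambda>g. qconj g x)" for x
    unfolding qconj_def
    by (rule qmul.continuous_on[OF qmul.continuous_on[OF continuous_on_id continuous_on_const]
          bounded_linear.continuous_on[OF bounded_linear_qcnj continuous_on_id]])
  then have "continuous_on S (\<lambda>g. conj_tuple g X)" for X
    unfolding conj_tuple_def by (intro continuous_on_vec_lambda)
  then show ?thesis
    unfolding conj_act_eq by (intro continuous_on_Pair)
qed

lemma compact_intersection: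
  assumes "l > 0"
  shows "compact (Lambda_irr (torus_link l) \<alpha> \<inter> Gamma_irr (torus_link l) \<alpha>)"
proof -
  have "compact (orbit p)" for p :: "2 tuple2"
  proof -
    have "orbit p = (\<lambda>g. conj_act g p) ` SU2" by (auto simp: orbit_def)
    moreover have "compact SU2" by (simp add: SU2_def)
    ultimately show ?thesis using compact_continuous_image[OF continuous_on_conj_act] by metis
  qed
  moreover have "finite (angles l \<alpha>)" by (simp add: angles_def)
  ultimately show ?thesis unfolding intersection_eq_orbits[OF assms] by (intro compact_UN) blast+
qed

lemma mem_orbit_self: "p \<in> orbit (p :: 2 tuple2)"
proof -
  have "p = conj_act qone p" by (simp add: conj_act_eq prod_eq_iff tuple_eq_iff)
  then show ?thesis unfolding orbit_def using SU2_closed(1) by blast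
qed

lemma orbit_conj:
  assumes "g \<in> SU2"
  shows "orbit (conj_act g p) = orbit (p :: 2 tuple2)"
proof (intro equalityI subsetI)
  fix q assume "q \<in> orbit (conj_act g p)"
  then obtain h where "h \<in> SU2" "q = conj_act (h \<star> g) p"
    unfolding orbit_def conj_act_comp by blast
  then show "q \<in> orbit p" using assms unfolding orbit_def by blast
next
  fix q assume "q \<in> orbit p"
  then obtain h where h: "h \<in> SU2" "q = conj_act h p" unfolding orbit_def by blast
  then have "q = conj_act (h \<star> qcnj g) (conj_act g p)"
    using assms by (simp add: conj_act_comp qmul_assoc)
  then show "q \<in> orbit (conj_act g p)" using assms h(1) unfolding orbit_def by blast
qed

lemma orbit_eq_iff: "orbit p = orbit q \<longleftrightarrow> (\<exists>g\<in>SU2. q = conj_act g (p :: 2 tuple2))"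
proof
  assume "orbit p = orbit q"
  then have "q \<in> orbit p" using mem_orbit_self by simp
  then show "\<exists>g\<in>SU2. q = conj_act g p" unfolding orbit_def by blast
qed (auto simp: orbit_conj)

text \<open>The real part of the product is invariant under conjugation and separates the orbits.\<close>

lemma inj_normal_orbits: "inj_on (\<lambda>m. orbit (normal_point \<alpha> (pi * m / l))) (angles l \<alpha>)"
proof (rule inj_onI)
  fix m n assume m: "m \<in> angles l \<alpha>" and n: "n \<in> angles l \<alpha>"
    and eq: "orbit (normal_point \<alpha> (pi * m / l)) = orbit (normal_point \<alpha> (pi * n / l))"
  have ad: "admissible \<alpha> (pi * m / l)" "admissible \<alpha> (pi * n / l)" "l > 0"
    using m n by (auto simp: angles_def)
  obtain g where g: "g \<in> SU2" "normal_point \<alpha> (pi * n / l) = conj_act g (normal_point \<alpha> (pi * m / l))"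
    using eq unfolding orbit_eq_iff by blast
  then have "normal_pair \<alpha> (pi * n / l) = conj_tuple g (normal_pair \<alpha> (pi * m / l))"
    by (simp add: normal_point_def conj_act_eq)
  then have "fst (ordered_prod (normal_pair \<alpha> (pi * n / l))) = fst (ordered_prod (normal_pair \<alpha> (pi * m / l)))"
    using g by (simp add: ordered_prod_conj fst_qconj)
  then have cos: "cos (pi * n / l) = cos (pi * m / l)"
    unfolding normal_pair_prod[OF ad(1)] normal_pair_prod[OF ad(2)] by simp
  have "0 \<le> pi * n / l" "pi * n / l \<le> pi" "0 \<le> pi * m / l" "pi * m / l \<le> pi"
    using ad unfolding admissible_def by linarith+
  then have "pi * n / l = pi * m / l"
    using cos by (rule cos_inj_pi)
  then show "m = n" using ad(3) by simp
qed

lemma orbit_images: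
  assumes "l > 0"
  shows "orbit ` Lambda_irr (torus_link l) \<alpha> \<inter> orbit ` Gamma_irr (torus_link l) \<alpha> =
    (\<lambda>m. orbit (normal_point \<alpha> (pi * m / l))) ` angles l \<alpha>"
proof -
  have "orbit ` Lambda_irr (torus_link l) \<alpha> \<inter> orbit ` Gamma_irr (torus_link l) \<alpha> =
    orbit ` (Lambda_irr (torus_link l) \<alpha> \<inter> Gamma_irr (torus_link l) \<alpha>)"
  proof (intro equalityI subsetI)
    fix P assume "P \<in> orbit ` Lambda_irr (torus_link l) \<alpha> \<inter> orbit ` Gamma_irr (torus_link l) \<alpha>"
    then obtain p q where p: "p \<in> Lambda_irr (torus_link l) \<alpha>" "P = orbit p"
      and q: "q \<in> Gamma_irr (torus_link l) \<alpha>" "P = orbit q" by blast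
    then obtain g where "g \<in> SU2" "q = conj_act g p" using orbit_eq_iff by blast
    then have "q \<in> Lambda_irr (torus_link l) \<alpha>" using conj_Lambda p(1) by blast
    then show "P \<in> orbit ` (Lambda_irr (torus_link l) \<alpha> \<inter> Gamma_irr (torus_link l) \<alpha>)"
      using q by blast
  qed blast
  also have "\<dots> = (\<lambda>m. orbit (normal_point \<alpha> (pi * m / l))) ` angles l \<alpha>"
  proof (intro equalityI subsetI)
    fix P assume "P \<in> orbit ` (Lambda_irr (torus_link l) \<alpha> \<inter> Gamma_irr (torus_link l) \<alpha>)"
    then obtain p where p: "p \<in> Lambda_irr (torus_link l) \<alpha> \<inter> Gamma_irr (torus_link l) \<alpha>" "P = orbit p"
      by blast
    obtain g m where "g \<in> SU2" "m \<in> angles l \<alpha>" "p = conj_act g (normal_point \<alpha> (pi * m / l))"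
      by (rule intersection_normal_form[OF p(1) assms])
    then show "P \<in> (\<lambda>m. orbit (normal_point \<alpha> (pi * m / l))) ` angles l \<alpha>"
      by (auto simp: p(2) orbit_conj)
  next
    fix P assume "P \<in> (\<lambda>m. orbit (normal_point \<alpha> (pi * m / l))) ` angles l \<alpha>"
    then obtain m where "m \<in> angles l \<alpha>" "P = orbit (normal_point \<alpha> (pi * m / l))"
      by blast
    then show "P \<in> orbit ` (Lambda_irr (torus_link l) \<alpha> \<inter> Gamma_irr (torus_link l) \<alpha>)"
      using normal_point_intersection[of m l \<alpha>] by blast
  qed
  finally show ?thesis .
qed

section \<open>Velocities and tangent spaces\<close>

lemma bounded_linear_tup: "bounded_linear (\<lambda>p. tup (fst p) (snd p))"
proof -
  have "linear (\<lambda>p. tup (fst p) (snd p))"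
    by (rule linearI) (simp_all add: tuple_eq_iff)
  then show ?thesis by (simp add: linear_conv_bounded_linear)
qed

lemma has_vector_derivative_tup:
  assumes "(f has_vector_derivative f') (at t)" "(g has_vector_derivative g') (at t)"
  shows "((\<lambda>t. tup (f t) (g t)) has_vector_derivative tup f' g') (at t)"
  using bounded_linear.has_vector_derivative[OF bounded_linear_tup has_vector_derivative_Pair[OF assms]]
  by simp

lemma has_vector_derivative_quat4:
  assumes "(a has_real_derivative a') F" "(x has_real_derivative x') F"
    "(y has_real_derivative y') F" "(z has_real_derivative z') F"
  shows "((\<lambda>t. quat4 (a t) (x t) (y t) (z t)) has_vector_derivative quat4 a' x' y' z') F"
proof -
  have lin: "quat4 a x y z = a *\<^sub>R quat4 1 0 0 0 + x *\<^sub>R quat4 0 1 0 0 + y *\<^sub>R quat4 0 0 1 0 + z *\<^sub>R quat4 0 0 0 1"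
    for a x y z by (simp add: quat4_arith)
  have scale: "((\<lambda>t. f t *\<^sub>R v) has_vector_derivative f' *\<^sub>R v) F"
    if "(f has_real_derivative f') F" for f f' and v :: quat
    using bounded_linear.has_vector_derivative[OF bounded_linear_scaleR_left] that
    unfolding has_real_derivative_iff_has_vector_derivative .
  show ?thesis
    unfolding lin[of "a _"] lin[of a'] by (intro has_vector_derivative_add scale assms)
qed

lemma has_vector_derivative_qmul:
  assumes "(f has_vector_derivative f') (at t)" "(g has_vector_derivative g') (at t)"
  shows "((\<lambda>t. f t \<star> g t) has_vector_derivative f t \<star> g' + f' \<star> g t) (at t)"
  by (rule qmul.has_vector_derivative[OF assms])

lemma has_vector_derivative_qcnj:
  "(f has_vector_derivative f') F \<Longrightarrow> ((\<lambda>t. qcnj (f t)) has_vector_derivative qcnj f') F"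
  by (rule bounded_linear.has_vector_derivative[OF bounded_linear_qcnj])

lemma has_vector_derivative_qconj:
  assumes "(f has_vector_derivative f') (at t)" "(g has_vector_derivative g') (at t)"
  shows "((\<lambda>t. qconj (f t) (g t)) has_vector_derivative
     f t \<star> g t \<star> qcnj f' + (f t \<star> g' + f' \<star> g t) \<star> qcnj (f t)) (at t)"
  unfolding qconj_def
  by (intro has_vector_derivative_qmul has_vector_derivative_qcnj assms)

lemma conj_tuple_eq_tup: "conj_tuple g X = tup (qconj g (X $ 0)) (qconj g (X $ 1))"
  by (simp add: tuple_eq_iff)

lemma bounded_linear_conj_act: "bounded_linear (conj_act g :: 2 tuple2 \<Rightarrow> 2 tuple2)"
proof -
  have "qconj g (x + y) = qconj g x + qconj g y" "qconj g (r *\<^sub>R x) = r *\<^sub>R qconj g x" for x y r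
    by (simp_all add: qconj_def qmul_add_left qmul_add_right qmul_scale_left qmul_scale_right)
  then have "linear (conj_act g :: 2 tuple2 \<Rightarrow> 2 tuple2)"
    by (intro linearI) (simp_all add: conj_act_eq prod_eq_iff tuple_eq_iff)
  then show ?thesis by (simp add: linear_conv_bounded_linear)
qed

lemma has_vector_derivative_shift:
  assumes "(f has_vector_derivative v) (at (x + c * 0))"
  shows "((\<lambda>t. f (x + c * t)) has_vector_derivative c *\<^sub>R v) (at 0)"
proof -
  have "((\<lambda>t. x + c * t) has_vector_derivative c) (at 0)"
    unfolding has_real_derivative_iff_has_vector_derivative[symmetric]
    by (auto intro!: derivative_eq_intros)
  from vector_diff_chain_at[OF this assms] show ?thesis by (simp add: o_def)
qed

text \<open>Constraints that hold along a curve in a subset pass to its velocity in this way.\<close>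

lemma derivative_zero_if_locally_constant:
  assumes "(f has_vector_derivative d) (at t)" "\<forall>\<^sub>F u in nhds t. f u = c"
  shows "d = 0"
proof -
  have "((\<lambda>_. c) has_vector_derivative d) (at t)"
    using assms has_vector_derivative_cong_ev[where f=f and g="\<lambda>_. c" and S=UNIV and x=t and f'=d]
      eventually_nhds_x_imp_x[OF assms(2)] by simp
  then show ?thesis
    using has_vector_derivative_const[of c] vector_derivative_unique_at by blast
qed

lemma tangent_spaceI:
  "curve_at M p \<gamma> \<Longrightarrow> (\<gamma> has_vector_derivative v) (at 0) \<Longrightarrow> v \<in> tangent_space M p"
  by (auto simp: tangent_space_def)

lemma tangent_space_scale:
  assumes "v \<in> tangent_space M p"
  shows "c *\<^sub>R v \<in> tangent_space M p"
proof -
  obtain \<gamma> where \<gamma>: "\<gamma> 0 = p" "\<forall>\<^sub>F t in nhds 0. \<gamma> t \<in> M" "(\<gamma> has_vector_derivative v) (at 0)"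
    using assms by (auto simp: tangent_space_def curve_at_def)
  have "filterlim (\<lambda>t::real. c * t) (nhds 0) (nhds 0)"
    using tendsto_mult_right_zero[of "\<lambda>t. t" "nhds 0" c] by (simp add: filterlim_ident)
  then have "\<forall>\<^sub>F t in nhds 0. \<gamma> (c * t) \<in> M"
    using \<gamma>(2) by (rule eventually_compose_filterlim[rotated])
  then have "curve_at M p (\<lambda>t. \<gamma> (0 + c * t))" using \<gamma>(1) by (simp add: curve_at_def)
  moreover have "((\<lambda>t. \<gamma> (0 + c * t)) has_vector_derivative c *\<^sub>R v) (at 0)"
    by (rule has_vector_derivative_shift) (simp add: \<gamma>(3))
  ultimately show ?thesis by (rule tangent_spaceI)
qed

lemma tangent_space_conj:
  assumes "v \<in> tangent_space M p" "\<And>q. q \<in> M \<Longrightarrow> conj_act g q \<in> M"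
  shows "conj_act g v \<in> tangent_space M (conj_act g p :: 2 tuple2)"
proof -
  obtain \<gamma> where \<gamma>: "\<gamma> 0 = p" "\<forall>\<^sub>F t in nhds 0. \<gamma> t \<in> M" "(\<gamma> has_vector_derivative v) (at 0)"
    using assms by (auto simp: tangent_space_def curve_at_def)
  have "curve_at M (conj_act g p) (\<lambda>t. conj_act g (\<gamma> t))"
    unfolding curve_at_def using \<gamma>(1) eventually_mono[OF \<gamma>(2) assms(2)] by simp
  moreover have "((\<lambda>t. conj_act g (\<gamma> t)) has_vector_derivative conj_act g v) (at 0)"
    by (rule bounded_linear.has_vector_derivative[OF bounded_linear_conj_act \<gamma>(3)])
  ultimately show ?thesis by (rule tangent_spaceI)
qed

text \<open>The velocity at \<open>0\<close> of \<open>t \<mapsto> exp(t q) X exp(-t q)\<close> for imaginary \<open>q\<close>.\<close>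

definition conj_velocity :: "quat \<Rightarrow> 2 tuple \<Rightarrow> 2 tuple" where
  "conj_velocity q X = (\<chi> j. q \<star> X $ j - X $ j \<star> q)"

text \<open>The one-parameter group \<open>exp(t q)\<close>, for an imaginary unit quaternion \<open>q\<close>.\<close>

definition rotation :: "quat \<Rightarrow> real \<Rightarrow> quat" where
  "rotation q t = cos t *\<^sub>R qone + sin t *\<^sub>R q"

lemma rotation_SU2:
  assumes "norm v = 1"
  shows "rotation (0, v) t \<in> SU2"
proof -
  have "v \<bullet> v = 1" using assms by (simp add: dot_square_norm)
  then have "(norm (rotation (0, v) t))\<^sup>2 = 1"
    unfolding norm_quat by (simp add: rotation_def qone_def power2_eq_square[symmetric])
  then show ?thesis unfolding SU2_iff power2_eq_1_iff
    using norm_ge_zero[of "rotation (0, v) t"] by linarith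
qed

lemma rotation_derivative: "(rotation q has_vector_derivative q) (at 0)"
proof -
  have scale: "((\<lambda>t. f t *\<^sub>R v) has_vector_derivative f' *\<^sub>R v) (at 0)"
    if "(f has_real_derivative f') (at 0)" for f f' and v :: quat
    using bounded_linear.has_vector_derivative[OF bounded_linear_scaleR_left] that
    unfolding has_real_derivative_iff_has_vector_derivative .
  have "((\<lambda>t. cos t *\<^sub>R qone + sin t *\<^sub>R q) has_vector_derivative 0 *\<^sub>R qone + 1 *\<^sub>R q) (at 0)"
    by (intro has_vector_derivative_add scale) (auto intro!: derivative_eq_intros)
  then show ?thesis by (simp add: rotation_def[abs_def])
qed

lemma rotation_0 [simp]: "rotation q 0 = qone"
  by (simp add: rotation_def)

lemma qconj_rotation_derivative:
  assumes "fst q = 0"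
  shows "((\<lambda>t. qconj (rotation q t) x) has_vector_derivative q \<star> x - x \<star> q) (at 0)"
proof -
  have "qcnj q = - q" using assms by (simp add: qcnj_def prod_eq_iff)
  then show ?thesis
    using has_vector_derivative_qconj[OF rotation_derivative has_vector_derivative_const, of q x]
    by (simp add: qmul.zero_right qmul.minus_right)
qed

lemma conj_rotation_derivative:
  assumes "fst q = 0"
  shows "((\<lambda>t. conj_tuple (rotation q t) X) has_vector_derivative conj_velocity q X) (at 0)"
proof -
  have "conj_velocity q X = tup (q \<star> X $ 0 - X $ 0 \<star> q) (q \<star> X $ 1 - X $ 1 \<star> q)"
    by (simp add: conj_velocity_def tuple_eq_iff)
  then show ?thesis
    unfolding conj_tuple_eq_tup
    by (simp only: has_vector_derivative_tup[OF qconj_rotation_derivative[OF assms] qconj_rotation_derivative[OF assms]])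
qed

lemma conj_qone [simp]: "conj_tuple qone X = X"
  by (simp add: tuple_eq_iff)

lemma orbit_frame_eq:
  "orbit_frame p = map (\<lambda>v. (conj_velocity (0, v) (fst p), conj_velocity (0, v) (snd p)))
     [axis 1 1, axis 2 1, axis 3 1]" for p :: "2 tuple2"
  by (simp add: orbit_frame_def conj_velocity_def Let_def)

lemma orbit_frame_tangent:
  assumes "p \<in> M" "\<And>g q. g \<in> SU2 \<Longrightarrow> q \<in> M \<Longrightarrow> conj_act g q \<in> M"
  shows "set (orbit_frame p) \<subseteq> tangent_space M (p :: 2 tuple2)"
proof -
  have "(conj_velocity (0, v) (fst p), conj_velocity (0, v) (snd p)) \<in> tangent_space M p" if "norm v = 1" for v
  proof (rule tangent_spaceI)
    show "curve_at M p (\<lambda>t. conj_act (rotation (0, v) t) p)"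
      using assms rotation_SU2[OF that] by (simp add: curve_at_def) (simp add: conj_act_eq)
    show "((\<lambda>t. conj_act (rotation (0, v) t) p) has_vector_derivative
        (conj_velocity (0, v) (fst p), conj_velocity (0, v) (snd p))) (at 0)"
      unfolding conj_act_eq by (intro has_vector_derivative_Pair conj_rotation_derivative) auto
  qed
  then show ?thesis by (simp add: orbit_frame_eq)
qed

section \<open>The curve of normal forms\<close>

definition normal_velocity :: "real^2 \<Rightarrow> real \<Rightarrow> 2 tuple" where
  "normal_velocity \<alpha> \<theta> = (let h = nh \<alpha> \<theta>; k = nk \<alpha> \<theta>; r = nr \<alpha> \<theta>; r' = - (h * k) / (sin \<theta> * r) in
     tup (quat4 0 (k / sin \<theta>) r' 0)
       (quat4 0 (h / sin \<theta>) (r * sin \<theta> - r' * cos \<theta>) (r' * sin \<theta> + r * cos \<theta>)))"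

text \<open>The constraint \<open>cos \<alpha>\<^sub>2 = cos \<alpha>\<^sub>1 cos \<theta> + h sin \<theta>\<close> gives \<open>h' = k / sin \<theta>\<close>, and then
\<open>k' = h / sin \<theta>\<close> and \<open>r r' = - h h'\<close>.\<close>

lemma normal_pair_derivative:
  assumes "admissible \<alpha> \<theta>"
  shows "(normal_pair \<alpha> has_vector_derivative normal_velocity \<alpha> \<theta>) (at \<theta>)"
proof -
  note a = admissible_simps[OF assms]
  have h: "(nh \<alpha> has_real_derivative nk \<alpha> \<theta> / sin \<theta>) (at \<theta>)"
    unfolding nh_def[abs_def] nk_def using a(1)
    by (auto intro!: derivative_eq_intros simp: nh_def field_simps power2_eq_square)
  have k: "(nk \<alpha> has_real_derivative nh \<alpha> \<theta> / sin \<theta>) (at \<theta>)"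
  proof -
    have "(nk \<alpha> has_real_derivative cos (\<alpha> $ 1) * cos \<theta> - (nk \<alpha> \<theta> / sin \<theta> * cos \<theta> - nh \<alpha> \<theta> * sin \<theta>)) (at \<theta>)"
      unfolding nk_def[abs_def] by (auto intro!: derivative_eq_intros h[unfolded nk_def])
    moreover have "cos (\<alpha> $ 1) * cos \<theta> - (nk \<alpha> \<theta> / sin \<theta> * cos \<theta> - nh \<alpha> \<theta> * sin \<theta>) = nh \<alpha> \<theta> / sin \<theta>"
    proof -
      have "(cos (\<alpha> $ 1) * cos \<theta> - (nk \<alpha> \<theta> / sin \<theta> * cos \<theta> - nh \<alpha> \<theta> * sin \<theta>)) * sin \<theta>
        = cos (\<alpha> $ 1) * cos \<theta> * sin \<theta> - nk \<alpha> \<theta> * cos \<theta> + nh \<alpha> \<theta> * (sin \<theta>)\<^sup>2"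
        using a(1) by (simp add: field_simps power2_eq_square)
      also have "\<dots> = nh \<alpha> \<theta>"
        unfolding nk_def using sin_cos_squared_add[of \<theta>] by Groebner_Basis.algebra
      finally have "(cos (\<alpha> $ 1) * cos \<theta> - (nk \<alpha> \<theta> / sin \<theta> * cos \<theta> - nh \<alpha> \<theta> * sin \<theta>)) * sin \<theta> = nh \<alpha> \<theta>" .
      then show ?thesis
        by (rule eq_divide_imp[OF less_imp_neq[OF a(1), symmetric]])
    qed
    ultimately show ?thesis by simp
  qed
  have r: "(nr \<alpha> has_real_derivative - (nh \<alpha> \<theta> * nk \<alpha> \<theta>) / (sin \<theta> * nr \<alpha> \<theta>)) (at \<theta>)"
  proof -
    have pos: "(sin (\<alpha> $ 1))\<^sup>2 - (nh \<alpha> \<theta>)\<^sup>2 > 0" using assms by (simp add: admissible_def)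
    have "((\<lambda>t. (sin (\<alpha> $ 1))\<^sup>2 - (nh \<alpha> t)\<^sup>2) has_real_derivative - (2 * nh \<alpha> \<theta> * (nk \<alpha> \<theta> / sin \<theta>))) (at \<theta>)"
      by (auto intro!: derivative_eq_intros h)
    from DERIV_chain2[OF DERIV_real_sqrt[OF pos] this] show ?thesis
      using a(1,2) unfolding nr_def[abs_def] by (simp add: field_simps)
  qed
  have "((\<lambda>t. - nr \<alpha> t * cos t) has_real_derivative
      nr \<alpha> \<theta> * sin \<theta> - - (nh \<alpha> \<theta> * nk \<alpha> \<theta>) / (sin \<theta> * nr \<alpha> \<theta>) * cos \<theta>) (at \<theta>)"
    by (rule DERIV_cong[OF DERIV_mult[OF DERIV_minus[OF r] DERIV_cos]]) simp
  moreover have "((\<lambda>t. nr \<alpha> t * sin t) has_real_derivative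
      - (nh \<alpha> \<theta> * nk \<alpha> \<theta>) / (sin \<theta> * nr \<alpha> \<theta>) * sin \<theta> + nr \<alpha> \<theta> * cos \<theta>) (at \<theta>)"
    by (rule DERIV_cong[OF DERIV_mult[OF r DERIV_sin]]) simp
  ultimately show ?thesis
    unfolding normal_pair_def[abs_def] normal_velocity_def Let_def
    by (intro has_vector_derivative_tup has_vector_derivative_quat4 h k r DERIV_const)
qed

lemma eventually_admissible:
  assumes "admissible \<alpha> \<theta>"
  shows "\<forall>\<^sub>F t in nhds 0. admissible \<alpha> (\<theta> + t)"
proof -
  have lim: "filterlim (\<lambda>t. \<theta> + t) (nhds \<theta>) (nhds 0)"
    using tendsto_add[OF tendsto_const filterlim_ident, of \<theta> 0] by (simp add: filterlim_ident)
  have "isCont (nh \<alpha>) \<theta>"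
    unfolding nh_def[abs_def] using admissible_simps(1)[OF assms] by (intro continuous_intros) auto
  then have "isCont (\<lambda>\<theta>. (nh \<alpha> \<theta>)\<^sup>2) \<theta>" by (intro continuous_intros)
  then have "((\<lambda>\<theta>. (nh \<alpha> \<theta>)\<^sup>2) \<longlongrightarrow> (nh \<alpha> \<theta>)\<^sup>2) (nhds \<theta>)"
    using tendsto_at_iff_tendsto_nhds[of "\<lambda>\<theta>. (nh \<alpha> \<theta>)\<^sup>2" \<theta>] unfolding isCont_def by simp
  then have "\<forall>\<^sub>F t in nhds \<theta>. (nh \<alpha> t)\<^sup>2 < (sin (\<alpha> $ 1))\<^sup>2"
    using assms by (auto simp: admissible_def dest: order_tendstoD)
  moreover have "\<forall>\<^sub>F t in nhds \<theta>. 0 < t \<and> t < pi"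
    using assms eventually_nhds_in_open[of "{0<..<pi}" \<theta>] by (auto simp: admissible_def)
  ultimately have "\<forall>\<^sub>F t in nhds \<theta>. admissible \<alpha> t"
    by eventually_elim (auto simp: admissible_def)
  then show ?thesis by (rule eventually_compose_filterlim[OF _ lim])
qed

lemma normal_pair_shift_derivative:
  assumes "admissible \<alpha> \<theta>"
  shows "((\<lambda>t. normal_pair \<alpha> (\<theta> + t)) has_vector_derivative normal_velocity \<alpha> \<theta>) (at 0)"
  using has_vector_derivative_shift[of "normal_pair \<alpha>" _ \<theta> 1] normal_pair_derivative[OF assms] by simp

lemma normal_velocity_Lambda:
  assumes "admissible \<alpha> \<theta>"
  shows "(normal_velocity \<alpha> \<theta>, normal_velocity \<alpha> \<theta>) \<in> tangent_space (Lambda_irr (torus_link l) \<alpha>) (normal_point \<alpha> \<theta>)"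
proof (rule tangent_spaceI)
  show "curve_at (Lambda_irr (torus_link l) \<alpha>) (normal_point \<alpha> \<theta>) (\<lambda>t. (normal_pair \<alpha> (\<theta> + t), normal_pair \<alpha> (\<theta> + t)))"
    unfolding curve_at_def Lambda_irr_iff normal_point_def using eventually_admissible[OF assms]
    by (auto simp: normal_pair_R normal_pair_noncommuting elim!: eventually_mono)
qed (intro has_vector_derivative_Pair normal_pair_shift_derivative assms)

lemma qpow_first_axis: "qpow (quat4 (cos \<theta>) (sin \<theta>) 0 0) n = quat4 (cos (n * \<theta>)) (sin (n * \<theta>)) 0 0"
proof (induction n)
  case (Suc n)
  have "real (Suc n) * \<theta> = n * \<theta> + \<theta>" by (simp add: distrib_right)
  then show ?case by (simp add: Suc quat4_arith cos_add sin_add)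
qed (simp add: quat4_arith)

text \<open>The velocity of the normal form under rotation about the axis of its product.\<close>

definition axis_velocity1 :: "real^2 \<Rightarrow> real \<Rightarrow> 2 tuple" where
  "axis_velocity1 \<alpha> \<theta> = conj_velocity (quat4 0 1 0 0) (normal_pair \<alpha> \<theta>)"

text \<open>On the curve of normal forms the braid acts as conjugation by \<open>exp(l \<theta> i)\<close>. At
\<open>\<theta> = \<pi> m / l\<close> this element is \<open>\<plusminus>1\<close>, so only its derivative contributes to the velocity, by \<open>l\<close>
times the velocity of rotation about the first axis.\<close>

lemma normal_velocity_Gamma:
  assumes "m \<in> angles l \<alpha>" "\<theta> = pi * m / l"
  shows "(normal_velocity \<alpha> \<theta>, normal_velocity \<alpha> \<theta> + real l *\<^sub>R axis_velocity1 \<alpha> \<theta>)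
     \<in> tangent_space (Gamma_irr (torus_link l) \<alpha>) (normal_point \<alpha> \<theta>)"
proof (rule tangent_spaceI)
  have ad: "admissible \<alpha> \<theta>" and l: "l > 0" using assms by (auto simp: angles_def)
  define E where "E = (\<lambda>t. quat4 (cos (l * (\<theta> + t))) (sin (l * (\<theta> + t))) 0 0)"
  let ?\<gamma> = "\<lambda>t. (normal_pair \<alpha> (\<theta> + t), conj_tuple (E t) (normal_pair \<alpha> (\<theta> + t)))"
  have s0: "sin (l * \<theta>) = 0" using assms l by simp
  define \<epsilon> where "\<epsilon> = cos (l * \<theta>)"
  have \<epsilon>: "\<epsilon> * \<epsilon> = 1"
    using sin_cos_squared_add[of "l * \<theta>"] by (simp add: \<epsilon>_def s0 power2_eq_square)
  have E0: "E 0 = \<epsilon> *\<^sub>R qone" by (simp add: E_def \<epsilon>_def s0 quat4_arith)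
  have E': "(E has_vector_derivative (l * \<epsilon>) *\<^sub>R quat4 0 1 0 0) (at 0)"
  proof -
    have "(E has_vector_derivative quat4 (- (l * sin (l * \<theta>))) (l * cos (l * \<theta>)) 0 0) (at 0)"
      unfolding E_def by (intro has_vector_derivative_quat4) (auto intro!: derivative_eq_intros)
    then show ?thesis by (simp add: s0 \<epsilon>_def quat4_arith)
  qed
  have "conj_tuple (E 0) X = X" for X
    unfolding E0 using \<epsilon> by (simp add: tuple_eq_iff qconj_def qcnj_scale qmul_scale_left qmul_scale_right)
  moreover have "\<forall>\<^sub>F t in nhds 0. ?\<gamma> t \<in> Gamma_irr (torus_link l) \<alpha>"
    using eventually_admissible[OF ad]
  proof eventually_elim
    case (elim t)
    have "E t = qpow (ordered_prod (normal_pair \<alpha> (\<theta> + t))) l"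
      unfolding normal_pair_prod[OF elim] qpow_first_axis E_def ..
    then show ?case
      using Gamma_irrI[OF normal_pair_R[OF elim] normal_pair_noncommuting[OF elim], of l] by simp
  qed
  ultimately show "curve_at (Gamma_irr (torus_link l) \<alpha>) (normal_point \<alpha> \<theta>) ?\<gamma>"
    by (simp add: curve_at_def normal_point_def)
  have comp: "((\<lambda>t. qconj (E t) (f t)) has_vector_derivative f' + real l *\<^sub>R (quat4 0 1 0 0 \<star> f 0 - f 0 \<star> quat4 0 1 0 0)) (at 0)"
    if "(f has_vector_derivative f') (at 0)" for f f'
  proof -
    have "qcnj ((l * \<epsilon>) *\<^sub>R quat4 0 1 0 0) = - ((l * \<epsilon>) *\<^sub>R quat4 0 1 0 0)"
      by (simp add: quat4_arith)
    moreover have e2: "\<epsilon> * (\<epsilon> * x) = x" for x using \<epsilon> by (simp flip: mult.assoc)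
    ultimately show ?thesis
      using has_vector_derivative_qconj[OF E' that] \<epsilon> unfolding E0
      by (simp add: e2 qmul_scale_left qmul_scale_right qcnj_scale qmul.minus_right qmul_add_left qmul_add_right
          scaleR_right_diff_distrib scaleR_add_right algebra_simps)
  qed
  have "((\<lambda>t. conj_tuple (E t) (normal_pair \<alpha> (\<theta> + t))) has_vector_derivative
     tup (normal_velocity \<alpha> \<theta> $ 0 + real l *\<^sub>R (quat4 0 1 0 0 \<star> normal_pair \<alpha> (\<theta> + 0) $ 0 - normal_pair \<alpha> (\<theta> + 0) $ 0 \<star> quat4 0 1 0 0))
         (normal_velocity \<alpha> \<theta> $ 1 + real l *\<^sub>R (quat4 0 1 0 0 \<star> normal_pair \<alpha> (\<theta> + 0) $ 1 - normal_pair \<alpha> (\<theta> + 0) $ 1 \<star> quat4 0 1 0 0))) (at 0)"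
    unfolding conj_tuple_eq_tup
    by (intro has_vector_derivative_tup comp
        bounded_linear.has_vector_derivative[OF bounded_linear_vec_nth normal_pair_shift_derivative[OF ad]])
  moreover have "tup (normal_velocity \<alpha> \<theta> $ 0 + real l *\<^sub>R (quat4 0 1 0 0 \<star> normal_pair \<alpha> (\<theta> + 0) $ 0 - normal_pair \<alpha> (\<theta> + 0) $ 0 \<star> quat4 0 1 0 0))
         (normal_velocity \<alpha> \<theta> $ 1 + real l *\<^sub>R (quat4 0 1 0 0 \<star> normal_pair \<alpha> (\<theta> + 0) $ 1 - normal_pair \<alpha> (\<theta> + 0) $ 1 \<star> quat4 0 1 0 0))
      = normal_velocity \<alpha> \<theta> + real l *\<^sub>R axis_velocity1 \<alpha> \<theta>"
    by (simp add: tuple_eq_iff axis_velocity1_def conj_velocity_def)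
  ultimately show "(?\<gamma> has_vector_derivative (normal_velocity \<alpha> \<theta>, normal_velocity \<alpha> \<theta> + real l *\<^sub>R axis_velocity1 \<alpha> \<theta>)) (at 0)"
    by (intro has_vector_derivative_Pair normal_pair_shift_derivative[OF ad]) simp
qed

lemma Lambda_subset_H: "Lambda_irr (torus_link l) \<alpha> \<subseteq> H_irr (torus_link l) \<alpha>"
  by (auto simp: Lambda_irr_iff intro!: H_irrI)

lemma Gamma_subset_H: "Gamma_irr (torus_link l) \<alpha> \<subseteq> H_irr (torus_link l) \<alpha>"
proof
  fix p assume p: "p \<in> Gamma_irr (torus_link l) \<alpha>"
  let ?X = "fst p" and ?P = "ordered_prod (fst p)"
  have X: "?X \<in> R_space (snd (torus_link l)) \<alpha>" and Y: "snd p = conj_tuple (qpow ?P l) ?X"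
    using Gamma_irrD[OF p] by auto
  have P: "?P \<in> SU2" using X by (simp add: R_space_torus ordered_prod_two)
  have "qpow ?P l \<star> ?P = ?P \<star> qpow ?P l" by (induction l) (simp_all, simp add: qmul_assoc)
  then have "ordered_prod (snd p) = ?P"
    unfolding Y ordered_prod_conj[OF qpow_SU2[OF P]] by (intro qconj_eqI qpow_SU2 P)
  moreover have "snd p \<in> R_space (snd (torus_link l)) \<alpha>"
    unfolding Y using R_space_conj[OF qpow_SU2[OF P]] X by simp
  moreover have "irreducible_set (range (($) (fst p)) \<union> range (($) (snd p)))"
    using p by (simp add: Gamma_irr_def Irr_def)
  ultimately show "p \<in> H_irr (torus_link l) \<alpha>"
    using X unfolding H_irr_def Irr_def by (cases p) auto
qed

lemma tangent_space_mono: "M \<subseteq> M' \<Longrightarrow> tangent_space M p \<subseteq> tangent_space M' p"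
  unfolding tangent_space_def curve_at_def by (auto elim!: eventually_mono)

section \<open>Transversality\<close>

lemma axis_velocity1_eq:
  "axis_velocity1 \<alpha> \<theta> = tup (quat4 0 0 0 (2 * nr \<alpha> \<theta>)) (quat4 0 0 (- 2 * nr \<alpha> \<theta> * sin \<theta>) (- 2 * nr \<alpha> \<theta> * cos \<theta>))"
  by (simp add: axis_velocity1_def conj_velocity_def tuple_eq_iff normal_pair_def quat4_arith)

text \<open>Tangent vectors of a conjugacy class, which is a sphere of imaginary parts.\<close>

definition class_tangent :: "quat \<Rightarrow> quat \<Rightarrow> bool" where
  "class_tangent x v \<longleftrightarrow> fst v = 0 \<and> snd x \<bullet> snd v = 0"

lemma class_tangentI:
  assumes "curve_at M p \<gamma>" "(\<gamma> has_vector_derivative v) (at 0)" "bounded_linear f"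
    "\<And>q. q \<in> M \<Longrightarrow> f q \<in> SU2 \<and> fst (f q) = c"
  shows "class_tangent (f p) (f v)"
proof -
  have d: "((\<lambda>t. f (\<gamma> t)) has_vector_derivative f v) (at 0)"
    by (rule bounded_linear.has_vector_derivative[OF assms(3,2)])
  have p: "\<gamma> 0 = p" and M: "\<forall>\<^sub>F t in nhds 0. \<gamma> t \<in> M" using assms(1) by (auto simp: curve_at_def)
  have fst0: "fst (f v) = 0"
  proof (rule derivative_zero_if_locally_constant)
    show "((\<lambda>t. fst (f (\<gamma> t))) has_vector_derivative fst (f v)) (at 0)"
      by (rule bounded_linear.has_vector_derivative[OF bounded_linear_fst d])
    show "\<forall>\<^sub>F t in nhds 0. fst (f (\<gamma> t)) = c"
      using M by (rule eventually_mono) (use assms(4) in blast)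
  qed
  have "f (\<gamma> 0) \<bullet> f v + f v \<bullet> f (\<gamma> 0) = 0"
  proof (rule derivative_zero_if_locally_constant)
    show "((\<lambda>t. f (\<gamma> t) \<bullet> f (\<gamma> t)) has_vector_derivative f (\<gamma> 0) \<bullet> f v + f v \<bullet> f (\<gamma> 0)) (at 0)"
      by (rule bounded_bilinear.has_vector_derivative[OF bounded_bilinear_inner d d])
    show "\<forall>\<^sub>F t in nhds 0. f (\<gamma> t) \<bullet> f (\<gamma> t) = 1"
      using M by (rule eventually_mono) (use assms(4) in \<open>auto simp: SU2_iff dot_square_norm\<close>)
  qed
  then show ?thesis using fst0 by (simp add: class_tangent_def p inner_prod_def inner_commute)
qed

text \<open>The converse of \<open>class_tangentI\<close>: every such vector is the velocity of a rotation.\<close>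

lemma class_curve:
  assumes "class_tangent x v" "snd x \<noteq> 0" "x \<in> SU2"
  obtains \<gamma> where "\<gamma> 0 = x" "\<And>t. \<gamma> t \<in> SU2 \<and> fst (\<gamma> t) = fst x" "(\<gamma> has_vector_derivative v) (at 0)"
proof -
  \<comment> \<open>The curve is a rotation about the axis orthogonal to position and velocity. The factor \<open>2\<close> is
     there because conjugation by \<open>exp(t q)\<close> rotates by the angle \<open>2 t\<close>.\<close>
  let ?\<xi> = "snd x"
  define w where "w = (1 / (2 * (?\<xi> \<bullet> ?\<xi>))) *\<^sub>R (?\<xi> \<times> snd v)"
  have pos: "?\<xi> \<bullet> ?\<xi> \<noteq> 0" using assms by simp
  have wv: "(0, w) \<star> x - x \<star> (0, w) = v"
  proof -
    have "(?\<xi> \<times> snd v) \<times> ?\<xi> = (?\<xi> \<bullet> ?\<xi>) *\<^sub>R snd v"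
      using assms(1) Lagrange[of ?\<xi> ?\<xi> "snd v"] cross_skew[of "?\<xi> \<times> snd v" ?\<xi>]
      by (simp add: class_tangent_def)
    then have "w \<times> ?\<xi> = (1/2) *\<^sub>R snd v"
      using pos by (simp add: w_def cross_mult_left)
    moreover have "?\<xi> \<times> w = - (w \<times> ?\<xi>)" by (rule cross_skew)
    ultimately show ?thesis
      using assms(1) by (simp add: qmul_def class_tangent_def prod_eq_iff inner_commute flip: scaleR_left.add)
  qed
  show ?thesis
  proof (cases "w = 0")
    case True
    then have "v = 0" using wv by (simp add: qmul_def zero_prod_def[symmetric])
    then show ?thesis using that[of "\<lambda>_. x"] assms(3) by simp
  next
    case False
    define n where "n = norm w"
    have n: "n \<noteq> 0" using False by (simp add: n_def)
    define q where "q = (0 :: real, (1 / n) *\<^sub>R w)"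
    have q: "norm (snd q) = 1" using n by (simp add: q_def n_def)
    have "((\<lambda>t. qconj (rotation q t) x) has_vector_derivative q \<star> x - x \<star> q) (at (0 + n * 0))"
      using qconj_rotation_derivative[of q x] by (simp add: q_def)
    from has_vector_derivative_shift[OF this]
    have "((\<lambda>t. qconj (rotation q (0 + n * t)) x) has_vector_derivative n *\<^sub>R (q \<star> x - x \<star> q)) (at 0)" .
    moreover have "n *\<^sub>R (q \<star> x - x \<star> q) = v"
    proof -
      have nq: "n *\<^sub>R q = (0, w)" using n by (simp add: q_def)
      have "n *\<^sub>R (q \<star> x) = (0, w) \<star> x"
        by (simp only: nq flip: qmul_scale_left)
      moreover have "n *\<^sub>R (x \<star> q) = x \<star> (0, w)"
        by (simp only: nq flip: qmul_scale_right)
      ultimately show ?thesis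
        unfolding wv[symmetric] scaleR_right_diff_distrib by simp
    qed
    ultimately have "((\<lambda>t. qconj (rotation q (0 + n * t)) x) has_vector_derivative v) (at 0)" by simp
    moreover have "rotation q t \<in> SU2" for t
      using rotation_SU2[OF q] by (simp add: q_def)
    ultimately show ?thesis
      using that[of "\<lambda>t. qconj (rotation q (0 + n * t)) x"] assms(3) by (simp add: qconj_SU2_iff fst_qconj)
  qed
qed

lemma noncommuting_open:
  assumes "(\<gamma> has_vector_derivative v) (at 0)" "noncommuting (\<gamma> 0)"
  shows "\<forall>\<^sub>F t in nhds 0. noncommuting (\<gamma> t)"
proof -
  define f where "f = (\<lambda>t. \<gamma> t $ 0 \<star> \<gamma> t $ 1 - \<gamma> t $ 1 \<star> \<gamma> t $ 0)"
  have "isCont \<gamma> 0" by (rule has_vector_derivative_continuous[OF assms(1)])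
  then have "isCont (\<lambda>t. \<gamma> t $ j) 0" for j
    by (intro continuous_intros)
  then have "isCont f 0"
    unfolding f_def by (intro continuous_diff qmul.continuous)
  then have lim: "(f \<longlongrightarrow> f 0) (nhds 0)"
    using tendsto_at_iff_tendsto_nhds[of f 0] unfolding isCont_def by simp
  have iff: "noncommuting (\<gamma> t) \<longleftrightarrow> f t \<noteq> 0" for t
    by (simp add: f_def noncommuting_def flip: commute_iff_cross)
  show ?thesis
    unfolding iff by (rule tendsto_imp_eventually_ne[OF lim]) (use assms(2) iff in blast)
qed

lemma tangent_Lambda:
  assumes X: "X \<in> R_space (snd (torus_link l)) \<alpha>" "noncommuting X"
    and v: "class_tangent (X $ 0) (v $ 0)" "class_tangent (X $ 1) (v $ 1)"
  shows "(v, v) \<in> tangent_space (Lambda_irr (torus_link l) \<alpha>) (X, X)"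
proof -
  have nz: "snd (X $ 0) \<noteq> 0" "snd (X $ 1) \<noteq> 0" and SU2: "X $ 0 \<in> SU2" "X $ 1 \<in> SU2"
    using X by (auto simp: noncommuting_def R_space_torus)
  obtain a where a: "a 0 = X $ 0" "\<And>t. a t \<in> SU2 \<and> fst (a t) = fst (X $ 0)" "(a has_vector_derivative v $ 0) (at 0)"
    using class_curve[OF v(1) nz(1) SU2(1)] by blast
  obtain b where b: "b 0 = X $ 1" "\<And>t. b t \<in> SU2 \<and> fst (b t) = fst (X $ 1)" "(b has_vector_derivative v $ 1) (at 0)"
    using class_curve[OF v(2) nz(2) SU2(2)] by blast
  have d: "((\<lambda>t. tup (a t) (b t)) has_vector_derivative v) (at 0)"
    using has_vector_derivative_tup[OF a(3) b(3)] by (simp add: tup_eta)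
  have R: "tup (a t) (b t) \<in> R_space (snd (torus_link l)) \<alpha>" for t
    using a(2)[of t] b(2)[of t] X(1) by (simp add: R_space_torus)
  have 0: "tup (a 0) (b 0) = X" by (simp add: a b tup_eta)
  have "\<forall>\<^sub>F t in nhds 0. noncommuting (tup (a t) (b t))"
    by (rule noncommuting_open[OF d]) (simp add: 0 X)
  then have "curve_at (Lambda_irr (torus_link l) \<alpha>) (X, X) (\<lambda>t. (tup (a t) (b t), tup (a t) (b t)))"
    unfolding curve_at_def Lambda_irr_iff using R 0 by (auto elim: eventually_mono)
  then show ?thesis by (rule tangent_spaceI) (intro has_vector_derivative_Pair d)
qed

text \<open>The linearized equations of \<open>H\<close>: the real parts and norms are constant, and the two products
agree.\<close>

lemma tangent_H:
  assumes "u \<in> tangent_space (H_irr (torus_link l) \<alpha>) p"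
  shows "class_tangent (fst p $ j) (fst u $ j)" "class_tangent (snd p $ j) (snd u $ j)"
    "fst p $ 0 \<star> fst u $ 1 + fst u $ 0 \<star> fst p $ 1 = snd p $ 0 \<star> snd u $ 1 + snd u $ 0 \<star> snd p $ 1"
proof -
  obtain \<gamma> where \<gamma>: "curve_at (H_irr (torus_link l) \<alpha>) p \<gamma>" "(\<gamma> has_vector_derivative u) (at 0)"
    using assms by (auto simp: tangent_space_def)
  have lin: "bounded_linear (\<lambda>p. fst p $ j)" "bounded_linear (\<lambda>p. snd p $ j)" for j :: 2
    by (intro bounded_linear_compose[OF bounded_linear_vec_nth] bounded_linear_fst bounded_linear_snd)+
  have R: "fst q $ j \<in> SU2 \<and> fst (fst q $ j) = cos (\<alpha> $ snd (torus_link l) j)"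
     "snd q $ j \<in> SU2 \<and> fst (snd q $ j) = cos (\<alpha> $ snd (torus_link l) j)"
    if "q \<in> H_irr (torus_link l) \<alpha>" for q j
    using H_irrD(1,2)[OF that] by (auto simp: R_space_def qtrace_def)
  show "class_tangent (fst p $ j) (fst u $ j)"
    by (rule class_tangentI[OF \<gamma> lin(1)]) (rule R)
  show "class_tangent (snd p $ j) (snd u $ j)"
    by (rule class_tangentI[OF \<gamma> lin(2)]) (rule R)
  have p: "\<gamma> 0 = p" and M: "\<forall>\<^sub>F t in nhds 0. \<gamma> t \<in> H_irr (torus_link l) \<alpha>"
    using \<gamma>(1) by (auto simp: curve_at_def)
  note d = bounded_linear.has_vector_derivative[OF lin(1) \<gamma>(2)] bounded_linear.has_vector_derivative[OF lin(2) \<gamma>(2)]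
  have "(fst (\<gamma> 0) $ 0 \<star> fst u $ 1 + fst u $ 0 \<star> fst (\<gamma> 0) $ 1) - (snd (\<gamma> 0) $ 0 \<star> snd u $ 1 + snd u $ 0 \<star> snd (\<gamma> 0) $ 1) = 0"
  proof (rule derivative_zero_if_locally_constant)
    show "((\<lambda>t. fst (\<gamma> t) $ 0 \<star> fst (\<gamma> t) $ 1 - snd (\<gamma> t) $ 0 \<star> snd (\<gamma> t) $ 1) has_vector_derivative
      (fst (\<gamma> 0) $ 0 \<star> fst u $ 1 + fst u $ 0 \<star> fst (\<gamma> 0) $ 1) - (snd (\<gamma> 0) $ 0 \<star> snd u $ 1 + snd u $ 0 \<star> snd (\<gamma> 0) $ 1)) (at 0)"
      by (intro has_vector_derivative_diff has_vector_derivative_qmul d)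
    show "\<forall>\<^sub>F t in nhds 0. fst (\<gamma> t) $ 0 \<star> fst (\<gamma> t) $ 1 - snd (\<gamma> t) $ 0 \<star> snd (\<gamma> t) $ 1 = 0"
      using M by (rule eventually_mono) (use H_irrD(3) in \<open>simp add: ordered_prod_two\<close>)
  qed
  then show "fst p $ 0 \<star> fst u $ 1 + fst u $ 0 \<star> fst p $ 1 = snd p $ 0 \<star> snd u $ 1 + snd u $ 0 \<star> snd p $ 1"
    by (simp add: p)
qed

lemma class_tangent_diff: "class_tangent x u \<Longrightarrow> class_tangent x v \<Longrightarrow> class_tangent x (u - v)"
  by (simp add: class_tangent_def inner_diff_right)

lemma class_tangent_scale: "class_tangent x v \<Longrightarrow> class_tangent x (c *\<^sub>R v)"
  by (simp add: class_tangent_def)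

text \<open>Since the product of the normal form lies on the first axis, rotation about this axis
does not change it. Conversely the equation for the kernel determines \<open>z\<^sub>2\<close> from \<open>z\<^sub>1\<close>, and \<open>z\<^sub>2\<close> is
imaginary only if \<open>z\<^sub>1\<close> is a multiple of the third quaternion unit.\<close>

lemma product_kernel:
  assumes ad: "admissible \<alpha> \<theta>" and z: "class_tangent (normal_pair \<alpha> \<theta> $ 0) (z $ 0)" "class_tangent (normal_pair \<alpha> \<theta> $ 1) (z $ 1)"
    and prod: "normal_pair \<alpha> \<theta> $ 0 \<star> z $ 1 + z $ 0 \<star> normal_pair \<alpha> \<theta> $ 1 = 0"
  obtains \<mu> where "z = \<mu> *\<^sub>R axis_velocity1 \<alpha> \<theta>"
proof -
  note a = admissible_simps[OF ad]
  define N where "N = normal_pair \<alpha> \<theta>"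
  have N: "N $ 0 \<in> SU2" using normal_pair_R[OF ad] by (simp add: R_space_torus N_def)
  obtain p1 p2 p3 where z0: "z $ 0 = quat4 0 p1 p2 p3"
    using quat4_eta[of "z $ 0"] z(1) unfolding class_tangent_def by metis
  have orth: "nh \<alpha> \<theta> * p1 + nr \<alpha> \<theta> * p2 = 0"
    using z(1) by (simp add: class_tangent_def normal_pair_def z0 inner_vec_def sum_3)
  have determined: "y $ 1 = - (qcnj (N $ 0) \<star> (y $ 0 \<star> N $ 1))" if "N $ 0 \<star> y $ 1 + y $ 0 \<star> N $ 1 = 0" for y
  proof -
    have "N $ 0 \<star> y $ 1 = - (y $ 0 \<star> N $ 1)" using that by (simp add: eq_neg_iff_add_eq_0)
    then have "qcnj (N $ 0) \<star> (N $ 0 \<star> y $ 1) = - (qcnj (N $ 0) \<star> (y $ 0 \<star> N $ 1))"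
      by (simp add: qmul.minus_right)
    then show ?thesis using N by simp
  qed
  have z1: "z $ 1 = - (qcnj (N $ 0) \<star> (z $ 0 \<star> N $ 1))"
    by (rule determined) (use prod in \<open>simp add: N_def\<close>)
  have "fst (qcnj (N $ 0) \<star> (z $ 0 \<star> N $ 1)) = 0"
    using z(2) unfolding z1 class_tangent_def by simp
  then have real: "cos (\<alpha> $ 1) * (- p1 * nk \<alpha> \<theta> + p2 * nr \<alpha> \<theta> * cos \<theta> - p3 * nr \<alpha> \<theta> * sin \<theta>)
     + nh \<alpha> \<theta> * (cos (\<alpha> $ 2) * p1 + p2 * nr \<alpha> \<theta> * sin \<theta> + p3 * nr \<alpha> \<theta> * cos \<theta>)
     + nr \<alpha> \<theta> * (cos (\<alpha> $ 2) * p2 + p3 * nk \<alpha> \<theta> - p1 * nr \<alpha> \<theta> * sin \<theta>) = 0"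
    by (simp add: z0 N_def normal_pair_def quat4_arith algebra_simps)
  \<comment> \<open>With \<open>p1\<close> and \<open>p2\<close> proportional to \<open>r\<close> and \<open>-h\<close>, the equation \<open>real\<close> reduces to
     \<open>p1 (cos\<^sup>2 \<alpha>\<^sub>1 + h\<^sup>2 + r\<^sup>2) sin \<theta> = 0\<close>, up to sign.\<close>
  have "p1 * sin \<theta> = 0"
  proof -
    have "(cos (\<alpha> $ 1))\<^sup>2 + (sin (\<alpha> $ 1))\<^sup>2 = 1" "(cos \<theta>)\<^sup>2 + (sin \<theta>)\<^sup>2 = 1" by simp_all
    with real orth a(3) show ?thesis
      unfolding a(4) nk_def by Groebner_Basis.algebra
  qed
  then have p1: "p1 = 0" using a(1) by simp
  then have p2: "p2 = 0" using orth a(2) by simp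
  define \<mu> where "\<mu> = p3 / (2 * nr \<alpha> \<theta>)"
  have eq0: "z $ 0 = (\<mu> *\<^sub>R axis_velocity1 \<alpha> \<theta>) $ 0"
    using a(2) by (simp add: z0 p1 p2 axis_velocity1_eq quat4_arith \<mu>_def)
  have "(\<mu> *\<^sub>R axis_velocity1 \<alpha> \<theta>) $ 1 = - (qcnj (N $ 0) \<star> ((\<mu> *\<^sub>R axis_velocity1 \<alpha> \<theta>) $ 0 \<star> N $ 1))"
  proof (rule determined)
    have q: "quat4 0 1 0 0 \<star> ordered_prod N = ordered_prod N \<star> quat4 0 1 0 0"
      unfolding N_def normal_pair_prod[OF ad] by (simp add: quat4_arith)
    have "N $ 0 \<star> axis_velocity1 \<alpha> \<theta> $ 1 + axis_velocity1 \<alpha> \<theta> $ 0 \<star> N $ 1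
       = quat4 0 1 0 0 \<star> ordered_prod N - ordered_prod N \<star> quat4 0 1 0 0"
      unfolding axis_velocity1_def conj_velocity_def N_def[symmetric] ordered_prod_two
      by (simp add: qmul.diff_left qmul.diff_right qmul_assoc)
    then have "N $ 0 \<star> axis_velocity1 \<alpha> \<theta> $ 1 + axis_velocity1 \<alpha> \<theta> $ 0 \<star> N $ 1 = 0" using q by simp
    then show "N $ 0 \<star> (\<mu> *\<^sub>R axis_velocity1 \<alpha> \<theta>) $ 1 + (\<mu> *\<^sub>R axis_velocity1 \<alpha> \<theta>) $ 0 \<star> N $ 1 = 0"
      by (simp add: qmul_scale_left qmul_scale_right flip: scaleR_add_right)
  qed
  then have "z $ 1 = (\<mu> *\<^sub>R axis_velocity1 \<alpha> \<theta>) $ 1" unfolding z1 eq0 by simp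
  then show ?thesis using that[of \<mu>] eq0 by (simp only: tuple_eq_iff)
qed

text \<open>The difference of the two components of \<open>u\<close> is a multiple \<open>\<mu> F\<close> of the velocity of rotation about
the first axis. Subtracting \<open>\<mu> / l\<close> times the tangent vector \<open>(V, V + l F)\<close> of \<open>\<Gamma>\<close> makes the components equal.\<close>

lemma transversal_at_normal_point:
  assumes m: "m \<in> angles l \<alpha>" and \<theta>: "\<theta> = pi * m / l" and u: "u \<in> tangent_space (H_irr (torus_link l) \<alpha>) (normal_point \<alpha> \<theta>)"
  obtains v w where "u = v + w" "v \<in> tangent_space (Lambda_irr (torus_link l) \<alpha>) (normal_point \<alpha> \<theta>)"
    "w \<in> tangent_space (Gamma_irr (torus_link l) \<alpha>) (normal_point \<alpha> \<theta>)"
proof -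
  have ad: "admissible \<alpha> \<theta>" and l: "l > 0" using m \<theta> by (auto simp: angles_def)
  let ?N = "normal_pair \<alpha> \<theta>"
  note tan = tangent_H[OF u, unfolded normal_point_def fst_conv snd_conv]
  define z where "z = snd u - fst u"
  have "class_tangent (?N $ j) (z $ j)" for j
    unfolding z_def vector_minus_component by (intro class_tangent_diff tan)
  moreover have "?N $ 0 \<star> z $ 1 + z $ 0 \<star> ?N $ 1 = 0"
    using tan(3) by (simp add: z_def qmul.diff_left qmul.diff_right algebra_simps)
  ultimately obtain \<mu> where \<mu>: "z = \<mu> *\<^sub>R axis_velocity1 \<alpha> \<theta>"
    using product_kernel[OF ad] by blast
  define V where "V = normal_velocity \<alpha> \<theta>"
  define w where "w = (\<mu> / l) *\<^sub>R (V, V + real l *\<^sub>R axis_velocity1 \<alpha> \<theta>)"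
  have w: "w \<in> tangent_space (Gamma_irr (torus_link l) \<alpha>) (normal_point \<alpha> \<theta>)"
    unfolding w_def V_def by (intro tangent_space_scale normal_velocity_Gamma[OF m \<theta>])
  have VH: "(V, V) \<in> tangent_space (H_irr (torus_link l) \<alpha>) (normal_point \<alpha> \<theta>)"
    using normal_velocity_Lambda[OF ad] tangent_space_mono[OF Lambda_subset_H] unfolding V_def by blast
  note tanV = tangent_H(1)[OF VH, unfolded normal_point_def fst_conv]
  define v where "v = fst u - (\<mu> / l) *\<^sub>R V"
  have "(v, v) \<in> tangent_space (Lambda_irr (torus_link l) \<alpha>) (normal_point \<alpha> \<theta>)"
    unfolding normal_point_def
    by (rule tangent_Lambda[OF normal_pair_R[OF ad] normal_pair_noncommuting[OF ad]];
        unfold v_def vector_minus_component vector_scaleR_component;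
        intro class_tangent_diff class_tangent_scale tan tanV)
  moreover have "u = (v, v) + w"
  proof -
    have "snd u = fst u + \<mu> *\<^sub>R axis_velocity1 \<alpha> \<theta>" using \<mu> by (simp add: z_def algebra_simps)
    then show ?thesis using l by (simp add: w_def v_def prod_eq_iff algebra_simps)
  qed
  ultimately show ?thesis using that w by blast
qed

text \<open>Conjugation carries the decomposition of tangent vectors from the normal form to its orbit.\<close>

lemma generic_perturbation_id:
  assumes l: "l > 0"
  shows "generic_perturbation (torus_link l) \<alpha> id"
  unfolding generic_perturbation_def transversal_in_def image_id id_apply
proof (intro ballI subsetI)
  fix p u assume p: "p \<in> Lambda_irr (torus_link l) \<alpha> \<inter> Gamma_irr (torus_link l) \<alpha>"
    and u: "u \<in> tangent_space (H_irr (torus_link l) \<alpha>) p"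
  obtain g m where g: "g \<in> SU2" and m: "m \<in> angles l \<alpha>" and pg: "p = conj_act g (normal_point \<alpha> (pi * m / l))"
    by (rule intersection_normal_form[OF p l])
  have g': "qcnj g \<in> SU2" using g by simp
  have inv: "conj_act (qcnj g) p = normal_point \<alpha> (pi * m / l)" unfolding pg by (rule conj_act_inverse(2)[OF g])
  have "conj_act (qcnj g) u \<in> tangent_space (H_irr (torus_link l) \<alpha>) (normal_point \<alpha> (pi * m / l))"
    unfolding inv[symmetric] by (rule tangent_space_conj[OF u conj_H[OF g']])
  then obtain v w where vw: "conj_act (qcnj g) u = v + w"
    "v \<in> tangent_space (Lambda_irr (torus_link l) \<alpha>) (normal_point \<alpha> (pi * m / l))"
    "w \<in> tangent_space (Gamma_irr (torus_link l) \<alpha>) (normal_point \<alpha> (pi * m / l))"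
    using transversal_at_normal_point[OF m refl] by blast
  have "u = conj_act g (v + w)" unfolding vw(1)[symmetric] by (rule conj_act_inverse(1)[OF g, symmetric])
  also have "\<dots> = conj_act g v + conj_act g w"
    by (rule linear_add[OF bounded_linear.linear[OF bounded_linear_conj_act]])
  finally have "u = conj_act g v + conj_act g w" .
  moreover have "conj_act g v \<in> tangent_space (Lambda_irr (torus_link l) \<alpha>) p"
    unfolding pg by (rule tangent_space_conj[OF vw(2) conj_Lambda[OF g]])
  moreover have "conj_act g w \<in> tangent_space (Gamma_irr (torus_link l) \<alpha>) p"
    unfolding pg by (rule tangent_space_conj[OF vw(3) conj_Gamma[OF g]])
  ultimately show "u \<in> {v + w |v w. v \<in> tangent_space (Lambda_irr (torus_link l) \<alpha>) p \<and>
      w \<in> tangent_space (Gamma_irr (torus_link l) \<alpha>) p}" by blast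
qed

section \<open>Determinants of explicit matrices\<close>

unbundle no cross3_syntax

text \<open>Laplace expansion along the first row, for evaluating determinants by rewriting. The case
distinction keeps minors with a vanishing coefficient unevaluated.\<close>

fun list_det :: "real list list \<Rightarrow> real" where
  "list_det [] = 1"
| "list_det (r # rs) = (\<Sum>j<length r. if r ! j = 0 then 0
     else (-1) ^ j * (r ! j) * list_det (map (\<lambda>x. take j x @ drop (Suc j) x) rs))"

lemma det_list_det:
  assumes "length rws = n" "\<And>r. r \<in> set rws \<Longrightarrow> length r = n"
  shows "Determinant.det (mat n n (\<lambda>(i, j). rws ! i ! j)) = list_det rws"
  using assms
proof (induction n arbitrary: rws)
  case 0
  then show ?case by simp
next
  case (Suc n')
  define n where "n = Suc n'"
  obtain r rs where rws: "rws = r # rs" using Suc.prems(1) by (cases rws) auto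
  have len: "length rs = n'" "length r = Suc n'" "\<And>x. x \<in> set rs \<Longrightarrow> length x = Suc n'"
    using Suc.prems by (auto simp: rws)
  let ?A = "mat n n (\<lambda>(i, j). (r # rs) ! i ! j)"
  have minor: "Determinant.det (mat_delete ?A 0 j) = list_det (map (\<lambda>x. take j x @ drop (Suc j) x) rs)" if j: "j < n" for j
  proof -
    have "mat_delete ?A 0 j = mat n' n' (\<lambda>(i, k). map (\<lambda>x. take j x @ drop (Suc j) x) rs ! i ! k)"
    proof (rule eq_matI)
      fix i k assume "i < dim_row (mat n' n' (\<lambda>(i, k). map (\<lambda>x. take j x @ drop (Suc j) x) rs ! i ! k))"
        "k < dim_col (mat n' n' (\<lambda>(i, k). map (\<lambda>x. take j x @ drop (Suc j) x) rs ! i ! k))"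
      then have ik: "i < n'" "k < n'" by auto
      then have "length (rs ! i) = Suc n'" using len by simp
      then show "mat_delete ?A 0 j $$ (i, k) = mat n' n' (\<lambda>(i, k). map (\<lambda>x. take j x @ drop (Suc j) x) rs ! i ! k) $$ (i, k)"
        using ik j len by (auto simp: mat_delete_def n_def nth_append min_def)
    qed (simp_all add: mat_delete_def n_def)
    also have "Determinant.det \<dots> = list_det (map (\<lambda>x. take j x @ drop (Suc j) x) rs)"
      by (rule Suc.IH) (use j len in \<open>auto simp: n_def min_def\<close>)
    finally show ?thesis .
  qed
  have "Determinant.det ?A = (\<Sum>j<n. ?A $$ (0, j) * cofactor ?A 0 j)"
    by (rule laplace_expansion_row) (auto simp: n_def)
  also have "\<dots> = (\<Sum>j<n. if r ! j = 0 then 0 else (-1) ^ j * (r ! j) * list_det (map (\<lambda>x. take j x @ drop (Suc j) x) rs))"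
    by (intro sum.cong) (auto simp: cofactor_def minor[unfolded n_def] n_def)
  finally show ?case using len by (simp add: rws n_def)
qed

text \<open>Without the case distinction, for symbolic entries that may vanish.\<close>

lemma list_det_Cons:
  "list_det (r # rs) = (\<Sum>j<length r. (-1) ^ j * (r ! j) * list_det (map (\<lambda>x. take j x @ drop (Suc j) x) rs))"
  by (auto intro!: sum.cong)

lemma list_det_3:
  "list_det [[a1, a2, a3], [b1, b2, b3], [c1, c2, c3]] =
    a1 * (b2 * c3 - b3 * c2) - a2 * (b1 * c3 - b3 * c1) + a3 * (b1 * c2 - b2 * c1)"
proof -
  have 1: "list_det [[a]] = a" for a
    by (subst list_det_Cons) simp
  have 2: "list_det [[a, b], [c, d]] = a * d - b * c" for a b c d
    by (subst list_det_Cons) (simp add: lessThan_Suc 1 del: list_det.simps(2))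
  show ?thesis
    by (subst list_det_Cons) (simp add: lessThan_Suc 2 del: list_det.simps(2))
qed

lemma list_det_4:
  "list_det [[a1, a2, a3, a4], b # bs, c # cs, d # ds] =
    a1 * list_det [bs, cs, ds] - a2 * list_det [b # tl bs, c # tl cs, d # tl ds]
    + a3 * list_det (map (\<lambda>x. take 2 x @ drop 3 x) [b # bs, c # cs, d # ds])
    - a4 * list_det (map (\<lambda>x. take 3 x @ drop 4 x) [b # bs, c # cs, d # ds])"
  by (subst list_det_Cons) (simp add: lessThan_Suc numeral_eq_Suc drop_Suc del: list_det.simps(2))

definition lin_comb :: "real list \<Rightarrow> 'a::real_vector list \<Rightarrow> 'a" where
  "lin_comb r bs = (\<Sum>j<length bs. (r ! j) *\<^sub>R (bs ! j))"

lemma same_orientation_list_det: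
  assumes "length rws = length bs" "\<forall>r\<in>set rws. length r = length bs"
    "list_det rws > 0" "vs = map (\<lambda>r. lin_comb r bs) rws"
  shows "same_orientation bs vs"
  unfolding same_orientation_def
proof (intro conjI bexI)
  show "length vs = length bs" using assms by simp
  show "Determinant.det (mat (length bs) (length bs) (\<lambda>(i, j). rws ! i ! j)) > 0"
    using assms det_list_det[of rws "length bs"] by simp
  show "\<forall>i<length bs. vs ! i = (\<Sum>j<length bs. mat (length bs) (length bs) (\<lambda>(i, j). rws ! i ! j) $$ (i, j) *\<^sub>R bs ! j)"
    using assms(1,4) by (auto simp: lin_comb_def intro!: sum.cong)
qed simp

lemma lin_comb_simps:
  "lin_comb [] [] = 0" "lin_comb (c # r) (b # bs) = c *\<^sub>R b + lin_comb r bs"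
  by (simp_all add: lin_comb_def sum.lessThan_Suc_shift del: sum.lessThan_Suc)

section \<open>Orientations\<close>

lemma tup_arith:
  "tup a b + tup a' b' = tup (a + a') (b + b')" "r *\<^sub>R tup a b = tup (r *\<^sub>R a) (r *\<^sub>R b)"
  "- tup a b = tup (- a) (- b)" "0 = tup 0 0"
  "tup a b = tup a' b' \<longleftrightarrow> a = a' \<and> b = b'"
  by (simp_all add: tuple_eq_iff)

lemma axis_tup: "axis 0 a = tup a 0" "axis 1 a = tup 0 a"
  by (simp_all add: tuple_eq_iff axis_def)

text \<open>The velocities of rotation about the other two axes.\<close>

definition axis_velocity2 :: "real^2 \<Rightarrow> real \<Rightarrow> 2 tuple" where
  "axis_velocity2 \<alpha> \<theta> = conj_velocity (quat4 0 0 1 0) (normal_pair \<alpha> \<theta>)"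

definition axis_velocity3 :: "real^2 \<Rightarrow> real \<Rightarrow> 2 tuple" where
  "axis_velocity3 \<alpha> \<theta> = conj_velocity (quat4 0 0 0 1) (normal_pair \<alpha> \<theta>)"

lemma axis_velocity2_eq:
  "axis_velocity2 \<alpha> \<theta> = tup (quat4 0 0 0 (- 2 * nh \<alpha> \<theta>)) (quat4 0 (2 * nr \<alpha> \<theta> * sin \<theta>) 0 (- 2 * nk \<alpha> \<theta>))"
  and axis_velocity3_eq:
  "axis_velocity3 \<alpha> \<theta> = tup (quat4 0 (- 2 * nr \<alpha> \<theta>) (2 * nh \<alpha> \<theta>) 0) (quat4 0 (2 * nr \<alpha> \<theta> * cos \<theta>) (2 * nk \<alpha> \<theta>) 0)"
  by (simp_all add: axis_velocity2_def axis_velocity3_def conj_velocity_def tuple_eq_iff normal_pair_def quat4_arith)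

lemma quat4_axis:
  "(0, axis 1 1) = quat4 0 1 0 0" "(0, axis 2 1) = quat4 0 0 1 0" "(0, axis 3 1) = quat4 0 0 0 1"
  by (simp_all add: quat_eq_iff axis_def)

lemma orbit_frame_normal_point:
  "orbit_frame (normal_point \<alpha> \<theta>) = [(axis_velocity1 \<alpha> \<theta>, axis_velocity1 \<alpha> \<theta>), (axis_velocity2 \<alpha> \<theta>, axis_velocity2 \<alpha> \<theta>), (axis_velocity3 \<alpha> \<theta>, axis_velocity3 \<alpha> \<theta>)]"
  by (simp add: orbit_frame_eq quat4_axis normal_point_def axis_velocity1_def axis_velocity2_def axis_velocity3_def)

text \<open>The rows are the coordinates of the reversed velocity of the normal form and of the three rotations,
in a positive frame of the product of two spheres.\<close>

lemma positive_basis_det: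
  fixes h k r s c :: real
  assumes "s > 0" "r > 0" "c\<^sup>2 + s\<^sup>2 = 1" "k\<^sup>2 + 2 * h * k * c + h\<^sup>2 + r\<^sup>2 * s\<^sup>2 = s\<^sup>2"
  shows "list_det [[0, - (k / (s * r)), - (h / (s * r)), - r], [2 * r, 0, 0, - 2 * r],
    [- 2 * h, 0, 2 * s, - 2 * k * c], [0, -2, 2 * c, 2 * k * s]] = 8 * s"
proof -
  have det: "list_det [[0, - x, - y, - r], [2 * r, 0, 0, - 2 * r],
      [- 2 * h, 0, 2 * s, - 2 * k * c], [0, -2, 2 * c, 2 * k * s]] =
    8 * (r * x * k * (c\<^sup>2 + s\<^sup>2) + r * y * k * c + r * x * h * c + r * y * h + r * r * s)" for x y
    unfolding list_det_4 by (simp add: list_det_3 algebra_simps power2_eq_square del: list_det.simps(2))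
  have x: "r * (k / (s * r)) = k / s" "r * (h / (s * r)) = h / s"
    using assms(1,2) by simp_all
  have "list_det [[0, - (k / (s * r)), - (h / (s * r)), - r], [2 * r, 0, 0, - 2 * r],
      [- 2 * h, 0, 2 * s, - 2 * k * c], [0, -2, 2 * c, 2 * k * s]] =
    8 * (k / s * k + h / s * k * c + k / s * h * c + h / s * h + r * r * s)"
    unfolding det x assms(3) by simp
  also have "\<dots> = 8 * (k\<^sup>2 + 2 * h * k * c + h\<^sup>2 + r\<^sup>2 * s\<^sup>2) / s"
    using assms(1) by (simp add: field_simps power2_eq_square)
  also have "\<dots> = 8 * s"
    unfolding assms(4) using assms(1) by (simp add: power2_eq_square)
  finally show ?thesis .
qed

text \<open>The velocity is reversed because together with the rotations it is a negative basis.\<close>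

lemma ori_R_normal_pair:
  assumes ad: "admissible \<alpha> \<theta>"
  shows "ori_R (normal_pair \<alpha> \<theta>) [- normal_velocity \<alpha> \<theta>, axis_velocity1 \<alpha> \<theta>, axis_velocity2 \<alpha> \<theta>, axis_velocity3 \<alpha> \<theta>]"
proof -
  note ads = admissible_simps[OF ad]
  define h where "h = nh \<alpha> \<theta>"
  define k where "k = nk \<alpha> \<theta>"
  define r where "r = nr \<alpha> \<theta>"
  define s where "s = sin \<theta>"
  define c where "c = cos \<theta>"
  note defs = h_def k_def r_def s_def c_def
  have pos: "s > 0" "r > 0" using ads by (simp_all add: defs)
  have cs: "c\<^sup>2 + s\<^sup>2 = 1" by (simp add: defs)
  \<comment> \<open>Orthogonal frames \<open>a j, b j\<close> of the two spheres, chosen with polynomial coordinates and ordered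
     positively for the outward normal.\<close>
  define a where "a j = (if j = 0 then vector [0, 0, 1] else vector [r, k * c, - k * s] :: real^3)" for j :: 2
  define b where "b j = (if j = 0 then vector [r, - h, 0] else vector [0, s, c] :: real^3)" for j :: 2
  let ?N = "normal_pair \<alpha> \<theta>"
  have nN: "snd (?N $ 0) = vector [h, r, 0]" "snd (?N $ 1) = vector [k, - r * c, r * s]"
    by (simp_all add: normal_pair_def quat4_def defs)
  have orth: "\<forall>j. a j \<bullet> snd (?N $ j) = 0 \<and> b j \<bullet> snd (?N $ j) = 0 \<and> snd (?N $ j) \<bullet> cross3 (a j) (b j) > 0"
  proof -
    have "vector [h, r, 0] \<bullet> cross3 (vector [0, 0, 1]) (vector [r, - h, 0]) = h\<^sup>2 + r\<^sup>2"
      by (simp add: inner_vec_def sum_3 cross_components power2_eq_square)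
    moreover have "vector [k, - r * c, r * s] \<bullet> cross3 (vector [r, k * c, - k * s]) (vector [0, s, c]) = k\<^sup>2 + r\<^sup>2"
      by (simp add: inner_vec_def sum_3 cross_components) (use cs in Groebner_Basis.algebra)
    moreover have "h\<^sup>2 + r\<^sup>2 > 0" "k\<^sup>2 + r\<^sup>2 > 0" using pos by (simp_all add: sum_power2_gt_zero_iff)
    moreover have "vector [r, k * c, - k * s] \<bullet> (vector [k, - r * c, r * s] :: real^3) = 0"
      by (simp add: inner_vec_def sum_3) (use cs in Groebner_Basis.algebra)
    moreover have "vector [0, 0, 1] \<bullet> (vector [h, r, 0] :: real^3) = 0" "vector [r, - h, 0] \<bullet> (vector [h, r, 0] :: real^3) = 0"
      "vector [0, s, c] \<bullet> (vector [k, - r * c, r * s] :: real^3) = 0"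
      by (simp_all add: inner_vec_def sum_3)
    ultimately show ?thesis
      unfolding forall_two_index nN a_def b_def by simp
  qed
  have "same_orientation [axis 0 (0, a 0), axis 0 (0, b 0), axis 1 (0, a 1), axis 1 (0, b 1)]
     [- normal_velocity \<alpha> \<theta>, axis_velocity1 \<alpha> \<theta>, axis_velocity2 \<alpha> \<theta>, axis_velocity3 \<alpha> \<theta>]"
  proof (rule same_orientation_list_det[where rws = "[[0, - (k / (s * r)), - (h / (s * r)), - r], [2 * r, 0, 0, - 2 * r],
    [- 2 * h, 0, 2 * s, - 2 * k * c], [0, -2, 2 * c, 2 * k * s]]"])
    have "k\<^sup>2 + 2 * h * k * c + h\<^sup>2 + r\<^sup>2 * s\<^sup>2 = s\<^sup>2"
    proof -
      have "(cos (\<alpha> $ 1))\<^sup>2 + (sin (\<alpha> $ 1))\<^sup>2 = 1" by simp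
      then show ?thesis
        using cs ads(3) unfolding k_def nk_def unfolding defs by Groebner_Basis.algebra
    qed
    then show "list_det [[0, - (k / (s * r)), - (h / (s * r)), - r], [2 * r, 0, 0, - 2 * r],
      [- 2 * h, 0, 2 * s, - 2 * k * c], [0, -2, 2 * c, 2 * k * s]] > 0"
      using positive_basis_det[OF pos cs] pos by simp
    have ab: "(0, a 0) = quat4 0 0 0 1" "(0, b 0) = quat4 0 r (- h) 0"
      "(0, a 1) = quat4 0 r (k * c) (- k * s)" "(0, b 1) = quat4 0 0 s c"
      by (simp_all add: a_def b_def quat4_def)
    have V: "normal_velocity \<alpha> \<theta> = tup (quat4 0 (k / s) (- (h * k) / (s * r)) 0)
       (quat4 0 (h / s) (r * s - - (h * k) / (s * r) * c) (- (h * k) / (s * r) * s + r * c))"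
      by (simp add: normal_velocity_def Let_def defs)
    have F: "axis_velocity1 \<alpha> \<theta> = tup (quat4 0 0 0 (2 * r)) (quat4 0 0 (- 2 * r * s) (- 2 * r * c))"
      "axis_velocity2 \<alpha> \<theta> = tup (quat4 0 0 0 (- 2 * h)) (quat4 0 (2 * r * s) 0 (- 2 * k))"
      "axis_velocity3 \<alpha> \<theta> = tup (quat4 0 (- 2 * r) (2 * h) 0) (quat4 0 (2 * r * c) (2 * k) 0)"
      by (simp_all add: axis_velocity1_eq axis_velocity2_eq axis_velocity3_eq defs)
    have cs': "k = k * c * c + k * s * s" using cs by Groebner_Basis.algebra
    show "[- normal_velocity \<alpha> \<theta>, axis_velocity1 \<alpha> \<theta>, axis_velocity2 \<alpha> \<theta>, axis_velocity3 \<alpha> \<theta>] = map (\<lambda>r. lin_comb r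
       [axis 0 (0, a 0), axis 0 (0, b 0), axis 1 (0, a 1), axis 1 (0, b 1)])
       [[0, - (k / (s * r)), - (h / (s * r)), - r], [2 * r, 0, 0, - 2 * r],
        [- 2 * h, 0, 2 * s, - 2 * k * c], [0, -2, 2 * c, 2 * k * s]]"
      unfolding V F axis_tup ab list.map list.inject lin_comb_simps tup_arith quat4_arith quat4_inject
      using pos cs' by (intro conjI; simp add: field_simps)
  qed auto
  then show ?thesis
    unfolding ori_R_def using orth by (intro exI[of _ a] exI[of _ b]) (simp add: strands_two)
qed

text \<open>Subtracting the fourth vector from the fifth and cancelling one component of each of the last three reduces the
matrix to a permutation matrix with one entry \<open>-l\<close> and one entry \<open>-1\<close>; the permutation is even. The
first three vectors complement the tangent space of \<open>H\<close>.\<close>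

lemma ori_RR_normal_point:
  fixes e0 e1 e2 e3 :: "2 tuple"
  assumes "ori_R X [e0, e1, e2, e3]" "l > 0"
  shows "ori_RR (X, X) [(- e0, 0), (e2, 0), (e3, 0), (e0, e0), (e0, e0 - l *\<^sub>R e1),
    (e1, e1), (e2, e2), (e3, e3)]"
proof -
  let ?bs = "map (\<lambda>e. (e, 0)) [e0, e1, e2, e3] @ map (\<lambda>f. (0, f)) [e0, e1, e2, e3]"
  have "same_orientation ?bs [(- e0, 0), (e2, 0), (e3, 0), (e0, e0), (e0, e0 - l *\<^sub>R e1),
    (e1, e1), (e2, e2), (e3, e3)]"
  proof (rule same_orientation_list_det[where rws = "[[-1, 0, 0, 0, 0, 0, 0, 0], [0, 0, 1, 0, 0, 0, 0, 0], [0, 0, 0, 1, 0, 0, 0, 0],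
      [1, 0, 0, 0, 1, 0, 0, 0], [1, 0, 0, 0, 1, - l, 0, 0], [0, 1, 0, 0, 0, 1, 0, 0],
      [0, 0, 1, 0, 0, 0, 1, 0], [0, 0, 0, 1, 0, 0, 0, 1]]"])
    show "list_det [[-1, 0, 0, 0, 0, 0, 0, 0], [0, 0, 1, 0, 0, 0, 0, 0], [0, 0, 0, 1, 0, 0, 0, 0],
      [1, 0, 0, 0, 1, 0, 0, 0], [1, 0, 0, 0, 1, - l, 0, 0], [0, 1, 0, 0, 0, 1, 0, 0],
      [0, 0, 1, 0, 0, 0, 1, 0], [0, 0, 0, 1, 0, 0, 0, 1]] > 0"
      using assms(2) by (simp add: lessThan_Suc numeral_eq_Suc)
  qed (simp_all add: lin_comb_simps zero_prod_def)
  then show ?thesis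
    unfolding ori_RR_def fst_conv snd_conv using assms(1) by blast
qed

lemma tangent_R_first:
  assumes "curve_at (R_space (snd (torus_link l)) \<alpha>) X \<gamma>" "(\<gamma> has_vector_derivative u) (at 0)"
    "((\<lambda>t. ordered_prod (\<gamma> t) \<star> qcnj (ordered_prod X)) has_vector_derivative d) (at 0)"
    "X \<in> R_space (snd (torus_link l)) \<alpha>"
  shows "tangent_map (R_space (snd (torus_link l)) \<alpha> \<times> R_space (snd (torus_link l)) \<alpha>) f_map (X, X) (u, 0) d"
  unfolding tangent_map_def
proof (intro exI conjI)
  show "curve_at (R_space (snd (torus_link l)) \<alpha> \<times> R_space (snd (torus_link l)) \<alpha>) (X, X) (\<lambda>t. (\<gamma> t, X))"
    using assms(1,4) by (auto simp: curve_at_def elim: eventually_mono)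
  show "((\<lambda>t. (\<gamma> t, X)) has_vector_derivative (u, 0)) (at 0)"
    by (intro has_vector_derivative_Pair assms has_vector_derivative_const)
  show "((f_map \<circ> (\<lambda>t. (\<gamma> t, X))) has_vector_derivative d) (at 0)"
    using assms(3) by (simp add: f_map_def o_def)
qed

lemma tangent_f_rotation:
  assumes ad: "admissible \<alpha> \<theta>" and q: "norm v = 1"
    and d: "((0, v) \<star> quat4 (cos \<theta>) (sin \<theta>) 0 0 - quat4 (cos \<theta>) (sin \<theta>) 0 0 \<star> (0, v)) \<star> qcnj (quat4 (cos \<theta>) (sin \<theta>) 0 0) = d"
  shows "tangent_map (R_space (snd (torus_link l)) \<alpha> \<times> R_space (snd (torus_link l)) \<alpha>) f_map
     (normal_point \<alpha> \<theta>) (conj_velocity (0, v) (normal_pair \<alpha> \<theta>), 0) d"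
  unfolding normal_point_def
proof (rule tangent_R_first)
  let ?N = "normal_pair \<alpha> \<theta>" and ?\<gamma> = "\<lambda>t. conj_tuple (rotation (0, v) t) (normal_pair \<alpha> \<theta>)"
  show R: "?N \<in> R_space (snd (torus_link l)) \<alpha>" by (rule normal_pair_R[OF ad])
  show "curve_at (R_space (snd (torus_link l)) \<alpha>) ?N ?\<gamma>"
    unfolding curve_at_def using R rotation_SU2[OF q] by (simp add: R_space_conj)
  show "(?\<gamma> has_vector_derivative conj_velocity (0, v) ?N) (at 0)"
    by (rule conj_rotation_derivative) simp
  show "((\<lambda>t. ordered_prod (?\<gamma> t) \<star> qcnj (ordered_prod ?N)) has_vector_derivative d) (at 0)"
    unfolding ordered_prod_conj[OF rotation_SU2[OF q]] normal_pair_prod[OF ad] d[symmetric]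
    by (rule bounded_linear.has_vector_derivative[OF qmul.bounded_linear_left qconj_rotation_derivative]) simp
qed

lemma tangent_f_velocity:
  assumes ad: "admissible \<alpha> \<theta>"
  shows "tangent_map (R_space (snd (torus_link l)) \<alpha> \<times> R_space (snd (torus_link l)) \<alpha>) f_map
     (normal_point \<alpha> \<theta>) (normal_velocity \<alpha> \<theta>, 0) (quat4 0 1 0 0)"
  unfolding normal_point_def
proof (rule tangent_R_first)
  let ?N = "normal_pair \<alpha> \<theta>" and ?\<gamma> = "\<lambda>t. normal_pair \<alpha> (\<theta> + t)"
  show "?N \<in> R_space (snd (torus_link l)) \<alpha>" by (rule normal_pair_R[OF ad])
  then show "curve_at (R_space (snd (torus_link l)) \<alpha>) ?N ?\<gamma>"
    unfolding curve_at_def using eventually_admissible[OF ad] by (auto simp: normal_pair_R elim: eventually_mono)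
  show "(?\<gamma> has_vector_derivative normal_velocity \<alpha> \<theta>) (at 0)"
    by (rule normal_pair_shift_derivative[OF ad])
  define f where "f t = quat4 (cos (\<theta> + t)) (sin (\<theta> + t)) 0 0 \<star> qcnj (quat4 (cos \<theta>) (sin \<theta>) 0 0)" for t
  have "((\<lambda>t. quat4 (cos (\<theta> + t)) (sin (\<theta> + t)) 0 0) has_vector_derivative quat4 (- sin \<theta>) (cos \<theta>) 0 0) (at 0)"
    by (intro has_vector_derivative_quat4) (auto intro!: derivative_eq_intros)
  from bounded_linear.has_vector_derivative[OF qmul.bounded_linear_left this, of "qcnj (quat4 (cos \<theta>) (sin \<theta>) 0 0)"]
  have f: "(f has_vector_derivative quat4 0 1 0 0) (at 0)"
    by (simp add: f_def[abs_def] quat4_arith mult.commute flip: power2_eq_square)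
  have eq: "\<forall>\<^sub>F t in nhds 0. ordered_prod (?\<gamma> t) \<star> qcnj (ordered_prod ?N) = f t"
    using eventually_admissible[OF ad]
    by eventually_elim (simp add: normal_pair_prod normal_pair_prod[OF ad] f_def)
  show "((\<lambda>t. ordered_prod (?\<gamma> t) \<star> qcnj (ordered_prod ?N)) has_vector_derivative quat4 0 1 0 0) (at 0)"
    using f has_vector_derivative_cong_ev[where f="\<lambda>t. ordered_prod (?\<gamma> t) \<star> qcnj (ordered_prod ?N)" and g=f and S=UNIV and x=0]
      eq eventually_nhds_x_imp_x[OF eq] by simp
qed

text \<open>The three vectors mapped to a positive basis of the imaginary quaternions
by the derivative of \<open>f_map\<close> are the velocity of the normal form, on which the product moves along the
first axis, and the rotations about the other two axes, which rotate the product.\<close>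

lemma intersection_sign_normal_point:
  assumes m: "m \<in> angles l \<alpha>" and \<theta>: "\<theta> = pi * m / l"
  shows "intersection_sign (ori_quotient (ori_H (torus_link l) \<alpha>))
       (ori_quotient (ori_graph (Lambda_irr (torus_link l) \<alpha>)))
       (ori_quotient (ori_image (Gamma_irr (torus_link l) \<alpha>) id (ori_graph (Gamma_irr (torus_link l) \<alpha>))))
       (orbit (normal_point \<alpha> \<theta>)) = 1"
proof -
  have ad: "admissible \<alpha> \<theta>" and l: "real l > 0" using m \<theta> by (auto simp: angles_def)
  let ?p = "normal_point \<alpha> \<theta>"
  let ?L = "Lambda_irr (torus_link l) \<alpha>" and ?G = "Gamma_irr (torus_link l) \<alpha>" and ?H = "H_irr (torus_link l) \<alpha>"
  let ?R = "R_space (snd (torus_link l)) \<alpha>"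
  \<comment> \<open>Reversed, to be positive on the first factor together with the rotations.\<close>
  define V where "V = - normal_velocity \<alpha> \<theta>"
  define v where "v = (V, V)"
  define w where "w = (V, V - real l *\<^sub>R axis_velocity1 \<alpha> \<theta>)"
  have p: "?p \<in> ?L" "?p \<in> ?G" using normal_point_intersection[OF m] \<theta> by auto
  have v: "v \<in> tangent_space ?L ?p"
    using tangent_space_scale[OF normal_velocity_Lambda[OF ad], of "-1"] by (simp add: v_def V_def)
  have w: "w \<in> tangent_space ?G ?p"
    using tangent_space_scale[OF normal_velocity_Gamma[OF m \<theta>], of "-1"] by (simp add: w_def V_def)
  have frame: "set (orbit_frame ?p) \<subseteq> tangent_space ?L ?p" "set (orbit_frame ?p) \<subseteq> tangent_space ?G ?p"
    using p by (auto intro!: orbit_frame_tangent[THEN subsetD] conj_Lambda conj_Gamma)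
  have R: "ori_R (fst ?p) [V, axis_velocity1 \<alpha> \<theta>, axis_velocity2 \<alpha> \<theta>, axis_velocity3 \<alpha> \<theta>]"
    unfolding V_def normal_point_def fst_conv by (rule ori_R_normal_pair[OF ad])
  have L: "ori_quotient (ori_graph ?L) ?p [v]"
    using v frame R by (simp add: ori_quotient_def ori_graph_def orbit_frame_normal_point v_def)
  have "ori_graph ?G ?p (w # orbit_frame ?p)"
    using w frame R by (simp add: ori_graph_def orbit_frame_normal_point w_def)
  moreover have "tangent_map ?G id ?p u u" if "u \<in> tangent_space ?G ?p" for u
    using that by (auto simp: tangent_map_def tangent_space_def)
  then have "list_all2 (tangent_map ?G id ?p) (w # orbit_frame ?p) (w # orbit_frame ?p)"
    using w frame by (intro list.rel_refl_strong) auto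
  ultimately have G: "ori_quotient (ori_image ?G id (ori_graph ?G)) ?p [w]"
    unfolding ori_quotient_def ori_image_def using p(2)
    by (intro bexI[of _ ?p] exI[of _ "w # orbit_frame ?p"]) simp_all
  have "ori_quotient (ori_H (torus_link l) \<alpha>) ?p [v, w]"
    unfolding ori_quotient_def ori_H_def
  proof (intro conjI exI)
    show "set ([v, w] @ orbit_frame ?p) \<subseteq> tangent_space ?H ?p"
      using v w frame tangent_space_mono[OF Lambda_subset_H[of l \<alpha>], of ?p] tangent_space_mono[OF Gamma_subset_H[of l \<alpha>], of ?p]
      by auto
    let ?s = "sin \<theta>" and ?c = "cos \<theta>"
    let ?d1 = "vector [1, 0, 0] :: real^3"
    let ?d2 = "vector [0, 2 * ?s * ?s, - 2 * ?s * ?c] :: real^3"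
    let ?d3 = "vector [0, 2 * ?s * ?c, 2 * ?s * ?s] :: real^3"
    show "tangent_map (?R \<times> ?R) f_map ?p (- V, 0) (0, ?d1)"
      using tangent_f_velocity[OF ad, of l] by (simp add: V_def quat4_def)
    have "tangent_map (?R \<times> ?R) f_map ?p (conj_velocity (0, axis 2 1) (normal_pair \<alpha> \<theta>), 0) (quat4 0 0 (2 * ?s * ?s) (- 2 * ?s * ?c))"
      by (rule tangent_f_rotation[OF ad]) (simp_all add: quat4_axis quat4_arith)
    then show "tangent_map (?R \<times> ?R) f_map ?p (axis_velocity2 \<alpha> \<theta>, 0) (0, ?d2)"
      unfolding axis_velocity2_def quat4_axis by (simp only: quat4_def)
    have "tangent_map (?R \<times> ?R) f_map ?p (conj_velocity (0, axis 3 1) (normal_pair \<alpha> \<theta>), 0) (quat4 0 0 (2 * ?s * ?c) (2 * ?s * ?s))"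
      by (rule tangent_f_rotation[OF ad]) (simp_all add: quat4_axis quat4_arith)
    then show "tangent_map (?R \<times> ?R) f_map ?p (axis_velocity3 \<alpha> \<theta>, 0) (0, ?d3)"
      unfolding axis_velocity3_def quat4_axis by (simp only: quat4_def)
    have "?d1 \<bullet> cross3 ?d2 ?d3 = (2 * ?s)\<^sup>2"
      by (simp add: inner_vec_def sum_3 cross_components power2_eq_square)
         (use sin_cos_squared_add[of \<theta>] in Groebner_Basis.algebra)
    then show "?d1 \<bullet> cross3 ?d2 ?d3 > 0"
      using admissible_simps(1)[OF ad] by simp
    show "ori_RR ?p ([(- V, 0), (axis_velocity2 \<alpha> \<theta>, 0), (axis_velocity3 \<alpha> \<theta>, 0)] @ [v, w] @ orbit_frame ?p)"
      using ori_RR_normal_point[OF R l] unfolding orbit_frame_normal_point v_def w_def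
      by (simp add: normal_point_def)
  qed
  with L G mem_orbit_self[of ?p] show ?thesis
    unfolding intersection_sign_def by (auto intro!: exI)
qed

section \<open>The invariant of the torus link\<close>

theorem corollary5p6:
  fixes l :: nat and \<alpha> :: "real^2"
  assumes "l > 0"
    and "0 < \<alpha> $ 1" "\<alpha> $ 1 < pi" "0 < \<alpha> $ 2" "\<alpha> $ 2 < pi"
    and "\<And>m::int. (0 < m \<and> m < int l) \<or> (int l < m \<and> m < 2 * int l) \<Longrightarrow>
           \<alpha> $ 1 + \<alpha> $ 2 \<noteq> pi * m / l \<and> \<alpha> $ 1 - \<alpha> $ 2 + pi \<noteq> pi * m / l"
  shows "benard_conway_well_defined (torus_link l) \<alpha> \<and>
    benard_conway (torus_link l) \<alpha> =
      int (card {m::nat. m \<in> {1..<l} \<and> cos (pi * m / l) \<in> {cos (\<alpha> $ 1 + \<alpha> $ 2)..cos (\<alpha> $ 1 - \<alpha> $ 2)}})"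
proof
  show "benard_conway_well_defined (torus_link l) \<alpha>"
    unfolding benard_conway_well_defined_def
  proof (intro conjI exI[of _ "geometric l"] allI impI)
    fix \<epsilon> :: "2 \<Rightarrow> real" assume "\<forall>k. complex_of_real (\<epsilon> k) \<in> {1, -1}"
    then have \<epsilon>: "\<epsilon> k \<in> {1, -1}" for k
      using of_real_eq_iff[of "\<epsilon> k" "- 1", where 'a=complex] by (auto simp: of_real_eq_1_iff)
    show "laurent_eval (\<chi> k. exp (2 * \<i> * \<epsilon> k * (\<alpha> $ k))) (geometric l) \<noteq> 0"
      by (rule torus_alexander_nonzero[OF assms(1-5)]) (use assms(6) \<epsilon> in blast)+
  qed (use is_alexander_polynomial_torus compact_intersection assms(1) in \<open>simp_all\<close>)
  have "m \<in> angles l \<alpha> \<longleftrightarrow> m \<in> {1..<l} \<and> cos (pi * m / l) \<in> {cos (\<alpha> $ 1 + \<alpha> $ 2)..cos (\<alpha> $ 1 - \<alpha> $ 2)}" for m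
  proof (cases "m \<in> {1..<l}")
    case True
    then have bounds: "0 < pi * m / l" "pi * m / l < pi" by (auto simp: field_simps)
    \<comment> \<open>If the sum exceeds \<open>\<pi>\<close>, reflect it to \<open>2 \<pi> - (\<alpha>\<^sub>1 + \<alpha>\<^sub>2)\<close>, where the cosine is injective.\<close>
    have "cos (pi * m / l) \<noteq> cos (\<alpha> $ 1 + \<alpha> $ 2)"
    proof (cases "\<alpha> $ 1 + \<alpha> $ 2 \<le> pi")
      case le: True
      have "\<alpha> $ 1 + \<alpha> $ 2 \<noteq> pi * m / l" using assms(6)[of "int m"] True by simp
      moreover have "pi * m / l = \<alpha> $ 1 + \<alpha> $ 2" if eq: "cos (pi * m / l) = cos (\<alpha> $ 1 + \<alpha> $ 2)"
        by (rule cos_inj_pi[OF _ _ _ _ eq]) (use bounds le assms(2-5) in linarith)+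
      ultimately show ?thesis by metis
    next
      case False
      have "\<alpha> $ 1 + \<alpha> $ 2 \<noteq> pi * (2 * int l - int m) / l" using assms(6)[of "2 * int l - int m"] True by simp
      also have "pi * (2 * int l - int m) / l = 2 * pi - pi * m / l" using assms(1) by (simp add: field_simps)
      finally have "pi * m / l \<noteq> 2 * pi - (\<alpha> $ 1 + \<alpha> $ 2)" by simp
      moreover have "pi * m / l = 2 * pi - (\<alpha> $ 1 + \<alpha> $ 2)"
        if eq: "cos (pi * m / l) = cos (2 * pi - (\<alpha> $ 1 + \<alpha> $ 2))"
        by (rule cos_inj_pi[OF _ _ _ _ eq]) (use bounds False assms(2-5) in linarith)+
      ultimately show ?thesis by (metis cos_2pi_minus)
    qed
    moreover have "cos (pi * m / l) \<noteq> cos (\<alpha> $ 1 - \<alpha> $ 2)"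
    proof -
      have "\<alpha> $ 1 - \<alpha> $ 2 + pi \<noteq> pi * (int l + int m) / l" using assms(6)[of "int l + int m"] True by simp
      moreover have "\<alpha> $ 1 - \<alpha> $ 2 + pi \<noteq> pi * (int l - int m) / l" using assms(6)[of "int l - int m"] True by simp
      ultimately have "\<bar>\<alpha> $ 1 - \<alpha> $ 2\<bar> \<noteq> pi * m / l" using assms(1) by (auto simp: field_simps abs_if)
      moreover have "cos \<bar>\<alpha> $ 1 - \<alpha> $ 2\<bar> = cos (\<alpha> $ 1 - \<alpha> $ 2)" by (rule cos_abs_real)
      moreover have "pi * m / l = \<bar>\<alpha> $ 1 - \<alpha> $ 2\<bar>" if eq: "cos (pi * m / l) = cos \<bar>\<alpha> $ 1 - \<alpha> $ 2\<bar>"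
        by (rule cos_inj_pi[OF _ _ _ _ eq]) (use bounds assms(2-5) in linarith)+
      ultimately show ?thesis by metis
    qed
    ultimately show ?thesis
      using admissible_iff[OF assms(2-5) bounds] True by (auto simp: angles_def)
  qed (auto simp: angles_def)
  then have angles: "angles l \<alpha> = {m::nat. m \<in> {1..<l} \<and> cos (pi * m / l) \<in> {cos (\<alpha> $ 1 + \<alpha> $ 2)..cos (\<alpha> $ 1 - \<alpha> $ 2)}}"
    by blast
  have image: "id ` Gamma_irr (torus_link l) \<alpha> = Gamma_irr (torus_link l) \<alpha>" by simp
  have "benard_conway (torus_link l) \<alpha> = perturbed_count (torus_link l) \<alpha> id"
    by (simp add: benard_conway_def generic_perturbation_id[OF assms(1)])
  also have "\<dots> = (\<Sum>m\<in>angles l \<alpha>. 1)"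
    unfolding perturbed_count_def signed_count_def image orbit_images[OF assms(1)]
      sum.reindex[OF inj_normal_orbits]
    by (rule sum.cong[OF refl]) (simp only: o_apply intersection_sign_normal_point[OF _ refl])
  also have "\<dots> = int (card (angles l \<alpha>))" by simp
  finally show "benard_conway (torus_link l) \<alpha> =
      int (card {m::nat. m \<in> {1..<l} \<and> cos (pi * m / l) \<in> {cos (\<alpha> $ 1 + \<alpha> $ 2)..cos (\<alpha> $ 1 - \<alpha> $ 2)}})"
    unfolding angles .
qed

end
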